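(* For every natural number $n$, the Chabauty space $\mathscr{C}(\mathbb{R}^n)$ of closed subgroups of $\mathbb{R}^n$ is simply connected.
   Context: $\mathscr{C}(\mathbb{R}^n)$ is the set of all closed subgroups of $(\mathbb{R}^n,+)$, topologized so that a basis of neighborhoods of $\Gamma$ is given by the sets $\{\Gamma' : \Gamma'\cap K\subset \Gamma+U \text{ and } \Gamma\cap K\subset \Gamma'+U\}$, where $K$ runs over the compact subsets of $\mathbb{R}^n$ and $U$ over the neighborhoods of $0$. *)

theory Defs
  imports "HOL-Analysis.Analysis"
begin

section \<open>The Chabauty space of closed subgroups\<close>

typedef (overloaded) 'a closed_subgroup =
  "{G :: 'a::topological_ab_group_add set.
      closed G \<and> 0 \<in> G \<and> (\<forall>x\<in>G. \<forall>y\<in>G. x + y \<in> G) \<and> (\<forall>x\<in>G. - x \<in> G)}"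
  morphisms elts Closed_Subgroup
  by (rule exI[of _ UNIV]) auto

definition chabauty_nbhd ::
  "'a::topological_ab_group_add set \<Rightarrow> 'a set \<Rightarrow> 'a closed_subgroup \<Rightarrow> 'a closed_subgroup set"
  where "chabauty_nbhd K U G =
    {H. elts H \<inter> K \<subseteq> {x + u | x u. x \<in> elts G \<and> u \<in> U} \<and>
        elts G \<inter> K \<subseteq> {x + u | x u. x \<in> elts H \<and> u \<in> U}}"

lemma chabauty_nbhd_self: "0 \<in> U \<Longrightarrow> G \<in> chabauty_nbhd K U G"
  unfolding chabauty_nbhd_def by force

lemma chabauty_nbhd_mono:
  "K' \<subseteq> K \<Longrightarrow> U \<subseteq> U' \<Longrightarrow> chabauty_nbhd K U G \<subseteq> chabauty_nbhd K' U' G"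
  unfolding chabauty_nbhd_def by blast

instantiation closed_subgroup :: (topological_ab_group_add) topological_space
begin

definition open_closed_subgroup :: "'a closed_subgroup set \<Rightarrow> bool" where
  "open_closed_subgroup W \<longleftrightarrow>
    (\<forall>G\<in>W. \<exists>K U. compact K \<and> 0 \<in> interior U \<and> chabauty_nbhd K U G \<subseteq> W)"

instance
proof
  show "open (UNIV :: 'a closed_subgroup set)"
    unfolding open_closed_subgroup_def
    by (intro ballI exI[of _ "{}"] exI[of _ UNIV]) auto
next
  fix S T :: "'a closed_subgroup set"
  assume S: "open S" and T: "open T"
  show "open (S \<inter> T)"
    unfolding open_closed_subgroup_def
  proof
    fix G assume "G \<in> S \<inter> T"
    then obtain K U K' U' where
        *: "compact K" "0 \<in> interior U" "chabauty_nbhd K U G \<subseteq> S"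
      and **: "compact K'" "0 \<in> interior U'" "chabauty_nbhd K' U' G \<subseteq> T"
      using S T unfolding open_closed_subgroup_def by (metis IntD1 IntD2)
    have "compact (K \<union> K')" "0 \<in> interior (U \<inter> U')"
      using * ** by auto
    moreover have "chabauty_nbhd (K \<union> K') (U \<inter> U') G \<subseteq> S \<inter> T"
      using chabauty_nbhd_mono[of K "K \<union> K'" "U \<inter> U'" U G]
        chabauty_nbhd_mono[of K' "K \<union> K'" "U \<inter> U'" U' G] * ** by blast
    ultimately show "\<exists>K U. compact K \<and> 0 \<in> interior U \<and> chabauty_nbhd K U G \<subseteq> S \<inter> T"
      by blast
  qed
next
  fix \<K> :: "'a closed_subgroup set set"
  assume "\<forall>S\<in>\<K>. open S"
  then show "open (\<Union>\<K>)"
    unfolding open_closed_subgroup_def by (meson Sup_upper UnionE order_trans)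
qed

end

lemma chabauty_nbhd_trans:
  assumes U: "\<And>u. u \<in> U \<Longrightarrow> - u \<in> U" "\<And>u v. u \<in> U \<Longrightarrow> v \<in> U \<Longrightarrow> u + v \<in> U'"
      and K: "\<And>x u. x \<in> K' \<Longrightarrow> u \<in> U \<Longrightarrow> x + u \<in> K" "K' \<subseteq> K"
      and H: "H \<in> chabauty_nbhd K U G" and H': "H' \<in> chabauty_nbhd K U H"
    shows "H' \<in> chabauty_nbhd K' U' G"
proof -
  have step: "\<exists>x u. z = x + u \<and> x \<in> A \<and> u \<in> U'"
    if z: "z \<in> C" "z \<in> K'"
      and CB: "C \<inter> K \<subseteq> {x + u | x u. x \<in> B \<and> u \<in> U}"
      and BA: "B \<inter> K \<subseteq> {x + u | x u. x \<in> A \<and> u \<in> U}" for z and A B C :: "'a set"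
  proof -
    obtain b u where b: "z = b + u" "b \<in> B" "u \<in> U"
      using z CB K(2) by blast
    have "b = z + - u" using b(1) by simp
    then have "b \<in> K" using K(1)[OF z(2) U(1)[OF b(3)]] by simp
    then obtain a v where a: "b = a + v" "a \<in> A" "v \<in> U"
      using b(2) BA by blast
    have "z = a + (v + u)" using a(1) b(1) by (simp add: add.assoc)
    then show ?thesis using a(2) U(2)[OF a(3) b(3)] by blast
  qed
  show ?thesis
    using H H' unfolding chabauty_nbhd_def
    by (auto intro: step[where B = "elts H"])
qed

text \<open>The topology is defined by declaring \<^term>\<open>W\<close> open if it contains a set
  \<^term>\<open>chabauty_nbhd K U G\<close> around each of its points \<^term>\<open>G\<close>. In the locally compact case
  these sets are themselves neighbourhoods, hence form a neighbourhood basis at \<^term>\<open>G\<close>.\<close>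

theorem eventually_nhds_closed_subgroup:
  fixes G :: "'a::{real_normed_vector, heine_borel} closed_subgroup"
  shows "eventually P (nhds G) \<longleftrightarrow>
    (\<exists>K U. compact K \<and> 0 \<in> interior U \<and> (\<forall>H\<in>chabauty_nbhd K U G. P H))"
proof
  assume "eventually P (nhds G)"
  then show "\<exists>K U. compact K \<and> 0 \<in> interior U \<and> (\<forall>H\<in>chabauty_nbhd K U G. P H)"
    unfolding eventually_nhds open_closed_subgroup_def by (meson subsetD)
next
  assume "\<exists>K U. compact K \<and> 0 \<in> interior U \<and> (\<forall>H\<in>chabauty_nbhd K U G. P H)"
  then obtain K U where K: "compact K" and U: "0 \<in> interior U"
    and P: "\<forall>H\<in>chabauty_nbhd K U G. P H" by blast
  define W where "W = {D. \<exists>K' U'. compact K' \<and> 0 \<in> interior U' \<and>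
    chabauty_nbhd K' U' D \<subseteq> chabauty_nbhd K U G}"
  have "open W"
    unfolding open_closed_subgroup_def
  proof
    fix D assume "D \<in> W"
    then obtain K' U' where K': "compact K'" and U': "0 \<in> interior U'"
      and sub: "chabauty_nbhd K' U' D \<subseteq> chabauty_nbhd K U G"
      unfolding W_def by blast
    obtain e where e: "e > 0" "ball 0 e \<subseteq> U'"
      using U' mem_interior by blast
    define V where "V = cball (0::'a) (e/3)"
    define L where "L = {x + y | x y. x \<in> K' \<and> y \<in> V}"
    have L: "compact L" unfolding L_def V_def by (intro compact_sums K' compact_cball)
    have V: "0 \<in> interior V"
      unfolding V_def mem_interior_cball using e(1) by (intro exI[of _ "e/3"]) auto
    have V_minus: "- u \<in> V" if "u \<in> V" for u
      using that unfolding V_def by simp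
    have V_add: "u + v \<in> U'" if "u \<in> V" "v \<in> V" for u v
    proof -
      have "norm u \<le> e/3" "norm v \<le> e/3" using that unfolding V_def by auto
      then have "norm (u + v) < e" using norm_triangle_ineq[of u v] e(1) by linarith
      then show ?thesis using e(2) by auto
    qed
    have L_add: "x + u \<in> L" if "x \<in> K'" "u \<in> V" for x u
      using that unfolding L_def by blast
    have "0 \<in> V" using V interior_subset by blast
    then have L_sup: "K' \<subseteq> L" using L_add[of _ 0] by auto
    have "chabauty_nbhd L V D \<subseteq> W"
    proof
      fix E assume E: "E \<in> chabauty_nbhd L V D"
      have "chabauty_nbhd L V E \<subseteq> chabauty_nbhd K' U' D"
        using chabauty_nbhd_trans[OF V_minus V_add L_add L_sup E] by blast
      then show "E \<in> W" unfolding W_def using L V sub by blast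
    qed
    then show "\<exists>K U. compact K \<and> 0 \<in> interior U \<and> chabauty_nbhd K U D \<subseteq> W"
      using L V by blast
  qed
  moreover have "G \<in> W" unfolding W_def using K U by blast
  moreover have "P H" if H: "H \<in> W" for H
  proof -
    obtain K' U' where U': "0 \<in> interior U'"
      and sub: "chabauty_nbhd K' U' H \<subseteq> chabauty_nbhd K U G"
      using H unfolding W_def by blast
    have "0 \<in> U'" using U' interior_subset by blast
    then show ?thesis using chabauty_nbhd_self sub P by blast
  qed
  ultimately show "eventually P (nhds G)"
    unfolding eventually_nhds by blast
qed


section \<open>The zero-dimensional Euclidean space\<close>

text \<open>Index types of \<^typ>\<open>real ^ 'n\<close> are non-empty, so the trivial group stands in for the
  Euclidean space of dimension 0.\<close>

datatype euclidean0 = Origin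

lemma euclidean0_eq: "(x::euclidean0) = y"
  by (cases x; cases y) simp

instantiation euclidean0 :: ab_group_add
begin

definition "(0::euclidean0) = Origin"
definition "(x::euclidean0) + y = Origin"
definition "(x::euclidean0) - y = Origin"
definition "- (x::euclidean0) = Origin"

instance by standard (rule euclidean0_eq)+

end

instantiation euclidean0 :: topological_space
begin

definition "open (X::euclidean0 set) = True"

instance by standard (simp_all add: open_euclidean0_def)

end

instance euclidean0 :: topological_ab_group_add
proof
  fix a b :: euclidean0
  have "(\<lambda>x. fst x + snd x :: euclidean0) = (\<lambda>_. a + b)"
    by (rule ext) (rule euclidean0_eq)
  then show "((\<lambda>x. fst x + snd x) \<longlongrightarrow> a + b) (nhds a \<times>\<^sub>F nhds b)"
    by simp
  have "(\<lambda>_. - a) = uminus"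
    by (rule ext) (rule euclidean0_eq)
  then show "(uminus \<longlongrightarrow> - a) (nhds a)"
    by (rule subst) (rule tendsto_const)
qed

end

theory Submission
  imports Defs
begin

text \<open>Scaling a closed subgroup by a factor that tends to 0 fills up its linear span. If the subgroup
  spans the space, the limit is the whole space, and the convergence is uniform near the subgroup,
  because a subgroup that is \<open>r\<close>-dense in a large ball is \<open>2 r\<close>-dense everywhere
  (\<open>dense_nearby\<close>). Hence the cocompact subgroups are contracted to the point \<open>UNIV\<close> inside the
  Chabauty space. Any other subgroup \<open>G\<close>, with linear span \<open>W\<close>, is joined to a cocompact one by
  letting a lattice of a complement of \<open>W\<close> come in from infinity (\<open>fill\<close>). Both moves together
  give a path \<open>tail G\<close> from \<open>G\<close> to \<open>UNIV\<close>.

  Tails do not depend continuously on \<open>G\<close>, since the dimension of the span jumps, but they are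
  consistent up to homotopy. Call a path \<^emph>\<open>tame\<close> if following it and then the tail of its end is
  homotopic to the tail of its start. Tame paths can be composed, reversed and cancelled, and a tame
  loop is null-homotopic. So it suffices to find around every \<open>G0\<close> a neighbourhood in which all
  paths are tame (\<open>simply_connected_if_locally_tame\<close>, \<open>locally_tame\<close>).

  Let \<open>W\<close> be the span of \<open>G0\<close> and \<open>P\<close> a linear projection onto \<open>W\<close>. A subgroup \<open>G\<close> near \<open>G0\<close> has
  elements that follow a basis of \<open>W\<close> taken from \<open>G0\<close>; they span a subspace near \<open>W\<close>. An element of
  \<open>G\<close> that is only slightly off this subspace lies in it: otherwise some multiple of it, reduced
  modulo the lattice of the following elements, would be of bounded size and at a definite distance
  from \<open>W\<close>, where subgroups near \<open>G0\<close> have no elements (\<open>unmove_snaps\<close>). Hence the subspace does not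
  depend on the chosen elements and varies continuously with \<open>G\<close>, and so does a linear map that
  straightens it to \<open>W\<close>. The straightened group meets \<open>W\<close> in a uniformly dense subgroup and has no
  elements near \<open>W\<close> but off \<open>W\<close>. Shrinking it along \<open>W\<close> and then spreading it to infinity along the
  kernel of \<open>P\<close> is therefore continuous, also at the limits (\<open>tendsto_shrink\<close>, \<open>tendsto_spread\<close>), and
  contracts the neighbourhood of \<open>G0\<close> to the single point \<open>W\<close> of the Chabauty space.

  A path in this neighbourhood is thus homotopic to the track of its start under the contraction
  followed by the reversed track of its end, and it remains to see that tracks are tame. Moving the
  start a little along \<open>fill\<close> reduces this to a cocompact start. Then the track runs
  through cocompact subgroups until it reaches \<open>W\<close> plus a lattice of the complement, and its last
  stage sends this lattice to infinity. That is the reverse of the first part of the tail of \<open>W\<close>, up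
  to the choice of the lattice. The choice is immaterial: any two lattices of the complement are
  joined by exchanging one basis vector at a time along a line segment (\<open>tame_spread_lattice\<close>).\<close>

section \<open>Paths up to homotopy\<close>

lemma homotopic_paths_convex_image:
  fixes H :: "'v::real_normed_vector \<Rightarrow> 'x::topological_space"
  assumes H: "continuous_on S H" and S: "convex S"
    and f: "path f" "path_image f \<subseteq> S"
    and g: "path g" "path_image g \<subseteq> S"
    and ends: "pathstart f = pathstart g" "pathfinish f = pathfinish g"
  shows "homotopic_paths UNIV (H \<circ> f) (H \<circ> g)"
proof -
  have "f t \<in> S" "g t \<in> S" if "t \<in> {0..1}" for t
    using f(2) g(2) that by (auto simp: path_image_def image_subset_iff)
  then have "closed_segment (f t) (g t) \<subseteq> S" if "t \<in> {0..1}" for t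
    using S that by (intro closed_segment_subset)
  then have "homotopic_paths S f g"
    using ends f(1) g(1) by (intro homotopic_paths_linear) auto
  then show ?thesis
    using H by (rule homotopic_paths_continuous_image) auto
qed

text \<open>Apart from reparametrizations, all homotopies between paths below are obtained from such squares.\<close>

lemma homotopic_paths_square_sides:
  fixes H :: "real \<times> real \<Rightarrow> 'x::topological_space"
  assumes H: "continuous_on ({0..1} \<times> {0..1}) H"
  shows "homotopic_paths UNIV ((\<lambda>t. H (t, 0)) +++ (\<lambda>t. H (1, t))) ((\<lambda>t. H (0, t)) +++ (\<lambda>t. H (t, 1)))"
proof -
  let ?b = "linepath (0::real, 0::real) (1, 0)" and ?r = "linepath (1::real, 0::real) (1, 1)"
  let ?l = "linepath (0::real, 0::real) (0, 1)" and ?t = "linepath (0::real, 1::real) (1, 1)"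
  have conv: "convex ({0..1::real} \<times> {0..1::real})" by (intro convex_Times) auto
  have sub: "closed_segment x y \<subseteq> {0..1} \<times> {0..1}"
    if "x \<in> {0..1} \<times> {0..1}" "y \<in> {0..1} \<times> {0..1}" for x y :: "real \<times> real"
    using conv that by (simp add: closed_segment_subset)
  have "homotopic_paths UNIV (H \<circ> (?b +++ ?r)) (H \<circ> (?l +++ ?t))"
    by (rule homotopic_paths_convex_image[OF H conv]; (intro subset_path_image_join)?)
      (simp_all add: sub)
  moreover have "H \<circ> (?b +++ ?r) = (\<lambda>t. H (t, 0)) +++ (\<lambda>t. H (1, t))"
      "H \<circ> (?l +++ ?t) = (\<lambda>t. H (0, t)) +++ (\<lambda>t. H (t, 1))"
    by (auto simp: joinpaths_def linepath_def fun_eq_iff)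
  ultimately show ?thesis by simp
qed

text \<open>The group laws for paths modulo homotopy are reparametrizations. They are derived here for
  arbitrary topological spaces, such as the Chabauty space, that carry no linear structure.\<close>

lemma homotopic_paths_reparametrized:
  assumes "path p" "path f" "path_image f \<subseteq> {0..1}" "path g" "path_image g \<subseteq> {0..1}"
    and "pathstart f = pathstart g" "pathfinish f = pathfinish g"
    and "\<And>t. P t = p (f t)" "\<And>t. Q t = p (g t)"
  shows "homotopic_paths UNIV P Q"
proof -
  have "P = p \<circ> f" "Q = p \<circ> g" using assms by auto
  then show ?thesis
    using assms by (simp add: homotopic_paths_convex_image[where S = "{0..1}"] path_def)
qed

lemma homotopic_paths_const_join:
  assumes "path p" "pathstart p = x"
  shows "homotopic_paths UNIV ((\<lambda>_. x) +++ p) p"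
  by (rule homotopic_paths_reparametrized[where f = "linepath 0 0 +++ linepath 0 1" and g = "linepath 0 1" and p = p];
      insert assms; (simp add: path_image_join closed_segment_eq_real_ivl; fail | auto simp: joinpaths_def linepath_def pathstart_def))

lemma homotopic_paths_join_const:
  assumes "path p" "pathfinish p = x"
  shows "homotopic_paths UNIV (p +++ (\<lambda>_. x)) p"
  by (rule homotopic_paths_reparametrized[where f = "linepath 0 1 +++ linepath 1 1" and g = "linepath 0 1" and p = p];
      insert assms; (simp add: path_image_join closed_segment_eq_real_ivl; fail | auto simp: joinpaths_def linepath_def pathfinish_def))

lemma homotopic_paths_join_reversepath:
  assumes "path p" "pathstart p = x"
  shows "homotopic_paths UNIV (p +++ reversepath p) (\<lambda>_. x)"
  by (rule homotopic_paths_reparametrized[where f = "linepath 0 1 +++ linepath 1 0" and g = "linepath 0 0" and p = p];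
      insert assms; (simp add: path_image_join closed_segment_eq_real_ivl; fail | auto simp: joinpaths_def linepath_def
      reversepath_def pathstart_def))

definition portion :: "real \<Rightarrow> real \<Rightarrow> (real \<Rightarrow> 'x) \<Rightarrow> real \<Rightarrow> 'x::topological_space" where
  "portion a b p = (\<lambda>t. p (linepath a b t))"

lemma path_portion:
  assumes "path p" "a \<in> {0..1}" "b \<in> {0..1}"
  shows "path (portion a b p)" "path_image (portion a b p) = p ` closed_segment a b"
    "pathstart (portion a b p) = p a" "pathfinish (portion a b p) = p b"
proof -
  have "continuous_on {0..1} (p \<circ> linepath a b)"
    using assms unfolding path_def
    by (intro continuous_on_compose continuous_on_linepath)
      (auto intro: continuous_on_subset simp: linepath_image_01 closed_segment_eq_real_ivl)
  then show "path (portion a b p)" by (simp add: portion_def path_def o_def)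
  show "path_image (portion a b p) = p ` closed_segment a b"
    by (simp add: path_image_def portion_def linepath_image_01 [symmetric] image_image)
  show "pathstart (portion a b p) = p a" "pathfinish (portion a b p) = p b"
    by (auto simp: pathstart_def pathfinish_def portion_def linepath_def)
qed

lemma portion_join:
  assumes "path p" "a \<in> {0..1}" "b \<in> {0..1}" "d \<in> {0..1}"
  shows "homotopic_paths UNIV (portion a b p +++ portion b d p) (portion a d p)"
  by (rule homotopic_paths_reparametrized[where f = "linepath a b +++ linepath b d" and g = "linepath a d" and p = p];
      insert assms; (simp add: path_image_join closed_segment_eq_real_ivl; fail | auto simp: joinpaths_def portion_def))

lemma path_const: "path (\<lambda>_. x)"
  by (simp add: path_def)

lemma homotopic_paths_reversepath_join:
  fixes p :: "real \<Rightarrow> 'x::topological_space"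
  assumes "path p" "pathfinish p = x"
  shows "homotopic_paths UNIV (reversepath p +++ p) (\<lambda>_. x)"
  using homotopic_paths_join_reversepath[of "reversepath p" x] assms by simp

lemma tendsto_fst_of_path:
  fixes p :: "real \<Rightarrow> 'x::topological_space"
  assumes "path p" "z \<in> {0..1} \<times> {0..1}"
  shows "((\<lambda>z. p (fst z)) \<longlongrightarrow> p (fst z)) (at z within {0..1} \<times> {0..1::real})"
proof -
  have "continuous_on ({0..1} \<times> {0..1}) (\<lambda>z::real\<times>real. p (fst z))"
    by (rule continuous_on_compose2[OF assms(1)[unfolded path_def]]) (auto intro!: continuous_intros)
  then show ?thesis using assms(2) unfolding continuous_on_def by (rule bspec)
qed

text \<open>One path from every point to a common base point amounts to a candidate for a section of the
  universal cover. A path is tame if the candidate is consistent along it.\<close>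

locale tails =
  fixes c :: "'x::topological_space \<Rightarrow> real \<Rightarrow> 'x" and z :: 'x
  assumes path_tail: "path (c x)"
    and tail_start: "pathstart (c x) = x"
    and tail_finish: "pathfinish (c x) = z"
begin

definition tame :: "(real \<Rightarrow> 'x) \<Rightarrow> bool" where
  "tame p \<longleftrightarrow> path p \<and> homotopic_paths UNIV (p +++ c (pathfinish p)) (c (pathstart p))"

lemma tame_imp_path: "tame p \<Longrightarrow> path p"
  by (simp add: tame_def)

lemma tame_homotopic:
  assumes "tame p" "homotopic_paths UNIV p q"
  shows "tame q"
proof -
  have q: "path q" "pathstart q = pathstart p" "pathfinish q = pathfinish p"
    using assms(2) homotopic_paths_imp_path homotopic_paths_imp_pathstart homotopic_paths_imp_pathfinish
    by metis+
  have "homotopic_paths UNIV (p +++ c (pathfinish p)) (q +++ c (pathfinish p))"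
    using assms(2) by (intro homotopic_paths_join) (auto simp: path_tail tail_start)
  then show ?thesis
    using assms(1) q unfolding tame_def by (metis homotopic_paths_sym homotopic_paths_trans)
qed

lemma homotopic_tail_assoc:
  assumes "path p" "path q" "pathfinish p = pathstart q"
  shows "homotopic_paths UNIV (p +++ (q +++ c (pathfinish q))) ((p +++ q) +++ c (pathfinish q))"
  using assms by (intro homotopic_paths_assoc) (auto simp: path_tail tail_start)

lemma homotopic_join_tail:
  assumes "path p" "tame q" "pathfinish p = pathstart q"
  shows "homotopic_paths UNIV (p +++ (q +++ c (pathfinish q))) (p +++ c (pathfinish p))"
  using assms unfolding tame_def by (intro homotopic_paths_join) (auto simp: tail_start)

lemma tame_join:
  assumes "tame p" "tame q" "pathfinish p = pathstart q"
  shows "tame (p +++ q)"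
proof -
  have "path p" "path q" using assms by (auto simp: tame_imp_path)
  have "homotopic_paths UNIV ((p +++ q) +++ c (pathfinish q)) (p +++ (q +++ c (pathfinish q)))"
    using \<open>path p\<close> \<open>path q\<close> assms(3) by (intro homotopic_paths_sym[OF homotopic_tail_assoc])
  also have "homotopic_paths UNIV \<dots> (p +++ c (pathfinish p))"
    using \<open>path p\<close> assms by (intro homotopic_join_tail)
  also have "homotopic_paths UNIV \<dots> (c (pathstart p))"
    using assms(1) by (simp add: tame_def)
  finally show ?thesis
    using \<open>path p\<close> \<open>path q\<close> assms(3) by (simp add: tame_def)
qed

lemma tame_cancel:
  assumes "tame (p +++ q)" "tame q" "path p" "pathfinish p = pathstart q"
  shows "tame p"
proof -
  have "path q" using assms by (auto simp: tame_imp_path)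
  have "homotopic_paths UNIV (p +++ c (pathfinish p)) (p +++ (q +++ c (pathfinish q)))"
    using assms by (intro homotopic_paths_sym[OF homotopic_join_tail])
  also have "homotopic_paths UNIV \<dots> ((p +++ q) +++ c (pathfinish q))"
    using \<open>path p\<close> \<open>path q\<close> assms(4) by (intro homotopic_tail_assoc)
  also have "homotopic_paths UNIV \<dots> (c (pathstart p))"
    using assms(1) by (simp add: tame_def)
  finally show ?thesis
    using \<open>path p\<close> by (simp add: tame_def)
qed

lemma tame_const: "tame (\<lambda>_. x)"
  using homotopic_paths_const_join[of "c x" x] path_tail tail_start
  unfolding tame_def by (simp add: path_const) (simp add: pathstart_def pathfinish_def)

lemma tame_reversepath:
  assumes "tame p"
  shows "tame (reversepath p)"
proof (rule tame_cancel)
  have "homotopic_paths UNIV (reversepath p +++ p) (\<lambda>_. pathfinish p)"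
    using assms by (intro homotopic_paths_reversepath_join) (auto simp: tame_def)
  then show "tame (reversepath p +++ p)"
    using tame_homotopic[OF tame_const] homotopic_paths_sym by blast
qed (use assms in \<open>auto simp: tame_def\<close>)

text \<open>By homotopy, the side in question followed by the right one is tame, and the right one can be
  cancelled.\<close>

lemma tame_square:
  assumes H: "continuous_on ({0..1} \<times> {0..1}) H"
    and l: "tame (\<lambda>t. H (0, t))" and t: "tame (\<lambda>t. H (t, 1))" and r: "tame (\<lambda>t. H (1, t))"
  shows "tame (\<lambda>t. H (t, 0))"
proof (rule tame_cancel[OF _ r])
  have "tame ((\<lambda>t. H (0, t)) +++ (\<lambda>t. H (t, 1)))"
    by (intro tame_join l t) (simp add: pathfinish_def pathstart_def)
  then show "tame ((\<lambda>t. H (t, 0)) +++ (\<lambda>t. H (1, t)))"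
    using homotopic_paths_square_sides[OF H] tame_homotopic homotopic_paths_sym by blast
  have "continuous_on {0..1} (\<lambda>t. H (t, 0))"
    by (rule continuous_on_compose2[OF H]) (auto intro!: continuous_intros)
  then show "path (\<lambda>t. H (t, 0))" by (simp add: path_def)
qed (simp add: pathfinish_def pathstart_def)

lemma tame_loop_null:
  assumes "tame p" "pathstart p = x" "pathfinish p = x"
  shows "homotopic_paths UNIV p (\<lambda>_. x)"
proof -
  have p: "path p" using assms by (simp add: tame_def)
  have cc: "homotopic_paths UNIV (c x +++ reversepath (c x)) (\<lambda>_. x)"
    by (intro homotopic_paths_join_reversepath path_tail tail_start)
  have "homotopic_paths UNIV (p +++ (\<lambda>_. x)) (p +++ (c x +++ reversepath (c x)))"
    using cc p assms by (intro homotopic_paths_join)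
      (auto simp: homotopic_paths_sym_eq path_tail pathstart_def)
  moreover have "homotopic_paths UNIV (p +++ (c x +++ reversepath (c x))) ((p +++ c x) +++ reversepath (c x))"
    using p assms by (intro homotopic_paths_assoc) (auto simp: path_tail tail_start)
  moreover have "homotopic_paths UNIV ((p +++ c x) +++ reversepath (c x)) (c x +++ reversepath (c x))"
    using assms by (intro homotopic_paths_join) (auto simp: path_tail tail_start tame_def)
  ultimately show ?thesis
    using cc homotopic_paths_join_const[OF p assms(3)]
    by (meson homotopic_paths_sym homotopic_paths_trans)
qed

text \<open>Composition of tame paths makes tameness of the portions of a path an additive property of
  intervals, so local tameness implies tameness by bisection.\<close>

lemma simply_connected_if_locally_tame:
  assumes loc: "\<And>x. \<exists>N. open N \<and> x \<in> N \<and> (\<forall>p. path p \<and> path_image p \<subseteq> N \<longrightarrow> tame p)"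
  shows "simply_connected (UNIV :: 'x set)"
proof -
  have tame: "tame p" if p: "path p" for p
  proof -
    define Q where "Q a b \<longleftrightarrow> ({a..b} \<subseteq> {0..1} \<longrightarrow> tame (portion a b p))" for a b
    have "Q 0 (1::real)"
      using zero_le_one
    proof (induction rule: Bolzano)
      case (trans a b c)
      show ?case unfolding Q_def
      proof
        assume ac: "{a..c} \<subseteq> {0..1}"
        with trans have abc: "a \<in> {0..1}" "b \<in> {0..1}" "c \<in> {0..1}" by auto
        have "tame (portion a b p +++ portion b c p)"
          using trans abc unfolding Q_def by (intro tame_join) (auto simp: path_portion p)
        then show "tame (portion a c p)"
          by (rule tame_homotopic) (intro portion_join p abc)
      qed
    next
      case (local x)
      obtain N where N: "open N" "p x \<in> N" "\<And>p. path p \<Longrightarrow> path_image p \<subseteq> N \<Longrightarrow> tame p"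
        using loc[of "p x"] by blast
      have "continuous_on UNIV (\<lambda>t. p (min 1 (max 0 t)))"
        by (rule continuous_on_compose2[OF p[unfolded path_def]]) (auto intro!: continuous_intros)
      then have "((\<lambda>t. p (min 1 (max 0 t))) \<longlongrightarrow> p (min 1 (max 0 x))) (at x)"
        by (simp add: continuous_on_def)
      moreover have "min 1 (max 0 x) = x" using local by simp
      ultimately have "\<forall>\<^sub>F t in at x. p (min 1 (max 0 t)) \<in> N"
        using N(1,2) by (simp add: topological_tendstoD)
      then obtain d where d: "d > 0" "\<And>t. t \<noteq> x \<Longrightarrow> \<bar>t - x\<bar> < d \<Longrightarrow> p (min 1 (max 0 t)) \<in> N"
        unfolding eventually_at by (auto simp: dist_real_def)
      have "Q a b" if "a \<le> x" "x \<le> b" "b - a < d" for a b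
        unfolding Q_def
      proof
        assume ab: "{a..b} \<subseteq> {0..1}"
        then have "p t \<in> N" if "t \<in> {a..b}" for t
        proof (cases "t = x")
          case False
          have "min 1 (max 0 t) = t" using ab that by auto
          moreover have "\<bar>t - x\<bar> < d" using that \<open>a \<le> x\<close> \<open>x \<le> b\<close> \<open>b - a < d\<close> by auto
          ultimately show ?thesis using d(2)[of t] False by simp
        qed (use N(2) in simp)
        then show "tame (portion a b p)"
          using that ab by (intro N(3)) (auto simp: p path_portion closed_segment_eq_real_ivl)
      qed
      then show ?case using d(1) by blast
    qed
    then show ?thesis by (simp add: Q_def portion_def linepath_def)
  qed
  have "homotopic_loops UNIV p q"
    if "path p" "pathfinish p = pathstart p" "path q" "pathfinish q = pathstart q" for p q :: "real \<Rightarrow> 'x"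
  proof -
    have null: "homotopic_loops UNIV p (\<lambda>_. pathstart p)"
      if "path p" "pathfinish p = pathstart p" for p :: "real \<Rightarrow> 'x"
      using tame_loop_null[OF tame[OF that(1)] refl that(2)] that(2)
      by (rule homotopic_paths_imp_homotopic_loops) (simp add: pathfinish_def)
    have const: "homotopic_loops UNIV (\<lambda>_. x) (\<lambda>_. z)" for x
      unfolding homotopic_loops
    proof (intro exI conjI)
      show "continuous_on ({0..1} \<times> {0..1}) (\<lambda>y::real\<times>real. c x (fst y))"
        by (rule continuous_on_compose2[OF path_tail[of x, unfolded path_def]])
          (auto intro!: continuous_intros)
    qed (use tail_start[of x] tail_finish[of x] in \<open>auto simp: pathstart_def pathfinish_def\<close>)
    show ?thesis
      using homotopic_loops_trans[OF homotopic_loops_trans[OF null const] homotopic_loops_sym[OF homotopic_loops_trans[OF null const]]] that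
      by blast
  qed
  then show ?thesis by (simp add: simply_connected_def)
qed

end

section \<open>Convergence of closed subgroups\<close>

definition additive_subgroup :: "'a::ab_group_add set \<Rightarrow> bool" where
  "additive_subgroup A \<longleftrightarrow> 0 \<in> A \<and> (\<forall>x\<in>A. \<forall>y\<in>A. x + y \<in> A) \<and> (\<forall>x\<in>A. - x \<in> A)"

lemma additive_subgroupD:
  assumes "additive_subgroup A"
  shows "0 \<in> A" "x \<in> A \<Longrightarrow> y \<in> A \<Longrightarrow> x + y \<in> A" "x \<in> A \<Longrightarrow> - x \<in> A"
    "x \<in> A \<Longrightarrow> y \<in> A \<Longrightarrow> x - y \<in> A"
  using assms unfolding additive_subgroup_def by (auto simp: diff_conv_add_uminus simp del: add_uminus_conv_diff)

lemma additive_subgroup_sum: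
  "additive_subgroup A \<Longrightarrow> (\<And>i. i \<in> I \<Longrightarrow> f i \<in> A) \<Longrightarrow> sum f I \<in> A"
  by (induction I rule: infinite_finite_induct) (auto simp: additive_subgroup_def)

lemma additive_subgroup_of_int:
  assumes "additive_subgroup (A :: 'a::real_vector set)" "x \<in> A"
  shows "of_int n *\<^sub>R x \<in> A"
proof -
  have nat: "of_nat k *\<^sub>R x \<in> A" for k
    using assms by (induction k) (auto simp: additive_subgroup_def scaleR_add_left)
  show ?thesis
  proof (cases "n \<ge> 0")
    case True
    then show ?thesis using nat[of "nat n"] by simp
  next
    case False
    then show ?thesis using additive_subgroupD(3)[OF assms(1) nat[of "nat (- n)"]] by simp
  qed
qed

lemma additive_subgroup_linear_image:
  "linear f \<Longrightarrow> additive_subgroup A \<Longrightarrow> additive_subgroup (f ` A)"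
  unfolding additive_subgroup_def
  by (auto simp: linear_add[symmetric] linear_neg[symmetric] intro!: image_eqI[OF linear_0[symmetric]])

lemma elts_subgroup: "additive_subgroup (elts G)"
  using elts[of G] by (auto simp: additive_subgroup_def)

lemma closed_elts: "closed (elts G)"
  using elts[of G] by auto

lemma subspace_additive_subgroup: "subspace S \<Longrightarrow> additive_subgroup S"
  by (auto simp: additive_subgroup_def subspace_def subspace_neg)

lemma additive_subgroup_closure:
  fixes A :: "'a::real_normed_vector set"
  assumes A: "additive_subgroup A"
  shows "additive_subgroup (closure A)"
proof -
  have "x + y \<in> closure A" if x: "x \<in> closure A" and y: "y \<in> closure A" for x y
  proof -
    obtain f g where "\<And>n. f n \<in> A" "f \<longlonglongrightarrow> x" "\<And>n. g n \<in> A" "g \<longlonglongrightarrow> y"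
      using x y unfolding closure_sequential by blast
    then show ?thesis
      using additive_subgroupD(2)[OF A] unfolding closure_sequential
      by (intro exI[of _ "\<lambda>n. f n + g n"]) (auto intro: tendsto_add)
  qed
  moreover have "- x \<in> closure A" if x: "x \<in> closure A" for x
  proof -
    obtain f where "\<And>n. f n \<in> A" "f \<longlonglongrightarrow> x"
      using x unfolding closure_sequential by blast
    then show ?thesis
      using additive_subgroupD(3)[OF A] unfolding closure_sequential
      by (intro exI[of _ "\<lambda>n. - f n"]) (auto intro: tendsto_minus)
  qed
  moreover have "0 \<in> closure A" using additive_subgroupD(1)[OF A] closure_subset by blast
  ultimately show ?thesis unfolding additive_subgroup_def by blast
qed

text \<open>Intended for additive subgroups \<open>A\<close>, where it is the smallest closed subgroup containing \<open>A\<close>. Taking the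
  closure in the definition spares a proof of closedness for every group that is constructed.\<close>

definition closed_hull :: "'a::real_normed_vector set \<Rightarrow> 'a closed_subgroup" where
  "closed_hull A = Closed_Subgroup (closure A)"

lemma elts_closed_hull:
  "additive_subgroup A \<Longrightarrow> elts (closed_hull A) = closure A"
  unfolding closed_hull_def using additive_subgroup_closure[of A]
  by (intro Closed_Subgroup_inverse) (auto simp: additive_subgroup_def)

lemma closed_hull_elts: "closed_hull (elts G) = G"
  by (simp add: closed_hull_def closure_closed closed_elts elts_inverse)

text \<open>One half of the condition defining a basic Chabauty neighbourhood, for a ball of radius \<open>R\<close> as the
  compact set and a ball of radius \<open>e\<close> as the neighbourhood of 0.\<close>

definition nearby :: "real \<Rightarrow> real \<Rightarrow> 'a::real_normed_vector set \<Rightarrow> 'a set \<Rightarrow> bool" where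
  "nearby R e A B \<longleftrightarrow> (\<forall>x\<in>A. norm x \<le> R \<longrightarrow> (\<exists>y\<in>B. norm (x - y) < e))"

lemma nearby_mono: "nearby R e A B \<Longrightarrow> B \<subseteq> B' \<Longrightarrow> nearby R e A B'"
  by (auto simp: nearby_def)

lemma tendsto_closed_subgroupI:
  fixes f :: "'z \<Rightarrow> 'a::{real_normed_vector, heine_borel} closed_subgroup"
  assumes "\<And>R e. e > 0 \<Longrightarrow> \<forall>\<^sub>F z in F. nearby R e (elts (f z)) (elts G)"
    and "\<And>R e. e > 0 \<Longrightarrow> \<forall>\<^sub>F z in F. nearby R e (elts G) (elts (f z))"
  shows "(f \<longlongrightarrow> G) F"
  unfolding filterlim_iff eventually_nhds_closed_subgroup
proof (intro allI impI)
  fix P assume "\<exists>K U. compact K \<and> 0 \<in> interior U \<and> (\<forall>H\<in>chabauty_nbhd K U G. P H)"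
  then obtain K U where K: "compact K" and U: "0 \<in> interior U"
    and P: "\<And>H. H \<in> chabauty_nbhd K U G \<Longrightarrow> P H" by blast
  obtain e where e: "e > 0" "ball 0 e \<subseteq> U" using U mem_interior by blast
  obtain R where R: "\<And>x. x \<in> K \<Longrightarrow> norm x \<le> R"
    using compact_imp_bounded[OF K] bounded_iff by blast
  have sub: "A \<inter> K \<subseteq> {x + u | x u. x \<in> B \<and> u \<in> U}" if n: "nearby R e A B" for A B
  proof
    fix x assume "x \<in> A \<inter> K"
    then obtain y where y: "y \<in> B" "norm (x - y) < e" using n R unfolding nearby_def by blast
    then have "x - y \<in> U" using e(2) by (auto simp: subset_iff)
    then have "x = y + (x - y)" "y \<in> B" "x - y \<in> U" using y by auto
    then show "x \<in> {x + u | x u. x \<in> B \<and> u \<in> U}" by blast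
  qed
  show "\<forall>\<^sub>F z in F. P (f z)"
    using assms(1)[OF e(1), of R] assms(2)[OF e(1), of R]
    by eventually_elim (auto intro!: P simp: chabauty_nbhd_def dest!: sub)
qed

lemma tendsto_closed_subgroupD:
  fixes f :: "'z \<Rightarrow> 'a::{real_normed_vector, heine_borel} closed_subgroup"
  assumes f: "(f \<longlongrightarrow> G) F" and e: "e > 0"
  shows "\<forall>\<^sub>F z in F. nearby R e (elts (f z)) (elts G)"
    "\<forall>\<^sub>F z in F. nearby R e (elts G) (elts (f z))"
proof -
  have sub: "nearby R e A B"
    if "A \<inter> cball 0 R \<subseteq> {x + u | x u. x \<in> B \<and> u \<in> ball 0 e}" for A B :: "'a set"
    unfolding nearby_def
  proof (intro ballI impI)
    fix x assume "x \<in> A" "norm x \<le> R"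
    then have "x \<in> A \<inter> cball 0 R" by auto
    then obtain y u where "x = y + u" "y \<in> B" "norm u < e" using \<open>_ \<subseteq> _\<close> by fastforce
    then show "\<exists>y\<in>B. norm (x - y) < e" by (intro bexI[of _ y]) auto
  qed
  have "\<forall>\<^sub>F H in nhds G. nearby R e (elts H) (elts G) \<and> nearby R e (elts G) (elts H)"
    unfolding eventually_nhds_closed_subgroup
    by (rule exI[of _ "cball 0 R"], rule exI[of _ "ball 0 e"])
      (use e sub in \<open>simp add: chabauty_nbhd_def\<close>)
  then have ev: "\<forall>\<^sub>F z in F. nearby R e (elts (f z)) (elts G) \<and> nearby R e (elts G) (elts (f z))"
    using f unfolding filterlim_iff by blast
  show "\<forall>\<^sub>F z in F. nearby R e (elts (f z)) (elts G)" "\<forall>\<^sub>F z in F. nearby R e (elts G) (elts (f z))"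
    using ev by (auto elim: eventually_mono)
qed

lemma nearby_closure:
  assumes "nearby (R + 1) (e/2) A B" "e > 0"
  shows "nearby R e (closure A) B"
  unfolding nearby_def
proof (intro ballI impI)
  fix x assume x: "x \<in> closure A" "norm x \<le> R"
  then obtain a where a: "a \<in> A" "dist a x < min 1 (e/2)"
    using assms(2) unfolding closure_approachable by (meson half_gt_zero min_less_iff_conj zero_less_one)
  have "norm a \<le> norm x + norm (a - x)" by (metis add_diff_cancel_left' diff_add_cancel norm_triangle_ineq add.commute)
  then have "norm a \<le> R + 1" using x a by (simp add: dist_norm)
  then obtain y where y: "y \<in> B" "norm (a - y) < e/2" using assms(1) a(1) unfolding nearby_def by blast
  have "norm (x - y) \<le> norm (x - a) + norm (a - y)" by (metis norm_diff_triangle_ineq add.commute diff_add_cancel norm_triangle_ineq add_diff_eq)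
  then show "\<exists>y\<in>B. norm (x - y) < e" using y a by (auto simp: dist_norm norm_minus_commute intro!: bexI[of _ y])
qed

lemma tendsto_closed_hull:
  fixes B :: "'a::{real_normed_vector, heine_borel} set"
  assumes A: "\<forall>\<^sub>F z in F. additive_subgroup (A z)" and B: "additive_subgroup B"
    and 1: "\<And>R e. e > 0 \<Longrightarrow> \<forall>\<^sub>F z in F. nearby R e (A z) B"
    and 2: "\<And>R e. e > 0 \<Longrightarrow> \<forall>\<^sub>F z in F. nearby R e B (A z)"
  shows "((\<lambda>z. closed_hull (A z)) \<longlongrightarrow> closed_hull B) F"
proof (rule tendsto_closed_subgroupI)
  fix R e :: real assume e: "e > 0"
  show "\<forall>\<^sub>F z in F. nearby R e (elts (closed_hull (A z))) (elts (closed_hull B))"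
    using eventually_conj[OF A 1[of "e/2" "R + 1"]] e
    by (auto simp: elts_closed_hull B elim!: eventually_mono intro!: nearby_mono[OF nearby_closure closure_subset])
  show "\<forall>\<^sub>F z in F. nearby R e (elts (closed_hull B)) (elts (closed_hull (A z)))"
    using eventually_conj[OF A 2[of "e/2" "R + 1"]] e
    by (auto simp: elts_closed_hull B elim!: eventually_mono intro!: nearby_mono[OF nearby_closure closure_subset])
qed

subsection \<open>The action of linear maps\<close>

definition lin_act :: "('a \<Rightarrow> 'a) \<Rightarrow> 'a::real_normed_vector closed_subgroup \<Rightarrow> 'a closed_subgroup" where
  "lin_act f G = closed_hull (f ` elts G)"

lemma elts_lin_act:
  fixes f :: "'a \<Rightarrow> 'a::euclidean_space"
  assumes "linear f" "inj f"
  shows "elts (lin_act f G) = f ` elts G"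
proof -
  have "closed (f ` elts G)"
    using assms closed_elts closed_injective_linear_image by blast
  then show ?thesis
    using elts_closed_hull[OF additive_subgroup_linear_image[OF assms(1) elts_subgroup]]
    by (simp add: lin_act_def closure_closed)
qed

lemma linear_tendsto_uniform:
  fixes A :: "'z \<Rightarrow> 'a::euclidean_space \<Rightarrow> 'b::real_normed_vector"
  assumes A: "\<forall>\<^sub>F z in F. linear (A z)" and B: "linear B"
    and lim: "\<And>v. ((\<lambda>z. A z v) \<longlongrightarrow> B v) F" and e: "e > 0"
  shows "\<forall>\<^sub>F z in F. \<forall>v. norm (A z v - B v) \<le> e * norm v"
proof -
  have "((\<lambda>z. \<Sum>b\<in>Basis. norm (A z b - B b)) \<longlongrightarrow> (\<Sum>b\<in>Basis. norm (B b - B b))) F"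
    by (intro tendsto_intros lim)
  then have "\<forall>\<^sub>F z in F. (\<Sum>b\<in>Basis. norm (A z b - B b)) < e"
    using e by (intro order_tendstoD(2)) auto
  with A show ?thesis
  proof eventually_elim
    case (elim z)
    show ?case
    proof
      fix v
      have lin: "linear (\<lambda>v. A z v - B v)" using elim(1) B by (rule linear_compose_sub)
      have "A z v - B v = (\<lambda>v. A z v - B v) (\<Sum>b\<in>Basis. (v \<bullet> b) *\<^sub>R b)"
        by (simp only: euclidean_representation)
      also have "\<dots> = (\<Sum>b\<in>Basis. (v \<bullet> b) *\<^sub>R (A z b - B b))"
        by (subst linear_sum[OF lin]) (simp only: linear_cmul[OF lin])
      also have "norm \<dots> \<le> (\<Sum>b\<in>Basis. norm v * norm (A z b - B b))"
        by (intro sum_norm_le) (auto intro!: mult_right_mono simp: Basis_le_norm)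
      also have "\<dots> = (\<Sum>b\<in>Basis. norm (A z b - B b)) * norm v"
        by (simp add: sum_distrib_left mult.commute)
      also have "\<dots> \<le> e * norm v" using elim(2) by (intro mult_right_mono) auto
      finally show "norm (A z v - B v) \<le> e * norm v" .
    qed
  qed
qed

lemma linear_injective_bounded_below_pos:
  fixes f :: "'a::euclidean_space \<Rightarrow> 'b::euclidean_space"
  assumes "linear f" "inj f"
  obtains c where "c > 0" "\<And>x. norm x \<le> c * norm (f x)"
proof -
  obtain g where g: "linear g" "\<And>x. g (f x) = x"
    using linear_injective_left_inverse[OF assms] by (auto simp: fun_eq_iff)
  obtain c where "c > 0" "\<And>x. norm (g x) \<le> c * norm x"
    using linear_bounded_pos[OF g(1)] by blast
  then show ?thesis using that g(2) by metis
qed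

text \<open>The general linear group acts continuously: on the part of \<open>G\<close> that maps into a given ball, which
  is bounded because the limit map is injective, the maps converge uniformly.\<close>

lemma tendsto_lin_act:
  fixes A :: "'z \<Rightarrow> 'a::euclidean_space \<Rightarrow> 'a"
  assumes A: "\<forall>\<^sub>F z in F. linear (A z)" and B: "linear B" "inj B"
    and lim: "\<And>v. ((\<lambda>z. A z v) \<longlongrightarrow> B v) F" and G: "(g \<longlongrightarrow> G) F"
  shows "((\<lambda>z. lin_act (A z) (g z)) \<longlongrightarrow> lin_act B G) F"
  unfolding lin_act_def
proof (rule tendsto_closed_hull)
  show "\<forall>\<^sub>F z in F. additive_subgroup (A z ` elts (g z))"
    using A by eventually_elim (intro additive_subgroup_linear_image elts_subgroup)
  show "additive_subgroup (B ` elts G)"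
    by (intro additive_subgroup_linear_image elts_subgroup B)
next
  fix R' e :: real assume e: "e > 0"
  define R where "R = max R' 1"
  have R: "R' \<le> R" "R > 0" by (auto simp: R_def)
  obtain c where c: "c > 0" "\<And>x. norm x \<le> c * norm (B x)"
    using linear_injective_bounded_below_pos[OF B] by blast
  obtain C where C: "C > 0" "\<And>x. norm (B x) \<le> C * norm x"
    using linear_bounded_pos[OF B(1)] by blast
  define S where "S = 2 * c * R"
  define d where "d = min (1 / (2 * c)) (e / (2 * (S + 1)))"
  have S: "S > 0" using c R by (simp add: S_def)
  have d: "d > 0" "d \<le> 1 / (2 * c)" "d * S < e / 2" 
  proof -
    show "d > 0" "d \<le> 1 / (2 * c)" using c e S by (auto simp: d_def)
    have "d * S \<le> e / (2 * (S + 1)) * S" using S by (intro mult_right_mono) (auto simp: d_def)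
    also have "\<dots> < e / 2" using S e by (simp add: field_simps)
    finally show "d * S < e / 2" .
  qed
  have unif: "\<forall>\<^sub>F z in F. \<forall>v. norm (A z v - B v) \<le> d * norm v"
    by (rule linear_tendsto_uniform[OF A B(1) lim d(1)])
  have small: "e / (2 * C) > 0" using e C by simp
  have Bs: "norm (B v - B w) < e / 2" if "norm (v - w) < e / (2 * C)" for v w
  proof -
    have "norm (B v - B w) \<le> C * norm (v - w)" using C(2)[of "v - w"] by (simp add: linear_diff[OF B(1)])
    also have "\<dots> < e / 2" using that C(1) by (simp add: field_simps)
    finally show ?thesis .
  qed
  show "\<forall>\<^sub>F z in F. nearby R' e (A z ` elts (g z)) (B ` elts G)"
    using unif tendsto_closed_subgroupD(1)[OF G small, of S]
  proof eventually_elim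
    case (elim z)
    show ?case unfolding nearby_def
    proof (safe)
      fix v assume v: "v \<in> elts (g z)" "norm (A z v) \<le> R'"
      have "norm (B v) \<le> norm (A z v) + d * norm v"
        using elim(1)[rule_format, of v] norm_triangle_ineq2[of "B v" "A z v"] by (simp add: norm_minus_commute)
      also have "\<dots> \<le> R + 1 / (2*c) * norm v"
        using v R d by (intro add_mono mult_right_mono) auto
      finally have "norm v \<le> c * (R + 1 / (2*c) * norm v)"
        using c by (meson mult_left_mono order_trans less_imp_le)
      then have "norm v \<le> S" using c(1) by (simp add: S_def field_simps)
      then obtain w where w: "w \<in> elts G" "norm (v - w) < e / (2 * C)"
        using elim(2) v(1) unfolding nearby_def by blast
      have "norm (A z v - B v) \<le> d * S"
        using elim(1)[rule_format, of v] \<open>norm v \<le> S\<close> d(1)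
        by (meson mult_left_mono order_trans less_imp_le)
      then have "norm (A z v - B v) < e / 2" using d(3) by simp
      moreover have "norm (A z v - B w) \<le> norm (A z v - B v) + norm (B v - B w)"
        using norm_triangle_ineq[of "A z v - B v" "B v - B w"] by simp
      ultimately have "norm (A z v - B w) < e" using Bs[OF w(2)] by linarith
      then show "\<exists>y\<in>B ` elts G. norm (A z v - y) < e" using w(1) by blast
    qed
  qed
  have sp: "e / (2 * (S + e / (2 * C))) > 0" using e S small by simp
  show "\<forall>\<^sub>F z in F. nearby R' e (B ` elts G) (A z ` elts (g z))"
    using linear_tendsto_uniform[OF A B(1) lim sp] tendsto_closed_subgroupD(2)[OF G small, of S]
  proof eventually_elim
    case (elim z)
    let ?s = "S + e / (2 * C)"
    have s: "?s > 0" using S small by simp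
    show ?case unfolding nearby_def
    proof (safe)
      fix v assume v: "v \<in> elts G" "norm (B v) \<le> R'"
      have "norm v \<le> c * R" using c v(2) R(1) by (meson mult_left_mono order_trans less_imp_le)
      also have "\<dots> \<le> S" using c R by (simp add: S_def)
      finally have vS: "norm v \<le> S" .
      then obtain w where w: "w \<in> elts (g z)" "norm (v - w) < e / (2 * C)"
        using elim(2) v(1) unfolding nearby_def by blast
      have "norm w \<le> ?s"
        using norm_triangle_ineq2[of w v] w(2) vS by (simp add: norm_minus_commute)
      then have "norm (A z w - B w) \<le> e / (2 * ?s) * ?s"
        using elim(1)[rule_format, of w] s e
        by (meson mult_left_mono order_trans less_imp_le divide_nonneg_pos mult_pos_pos zero_less_numeral)
      also have "\<dots> = e / 2" using s by (simp add: field_simps)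
      finally have "norm (A z w - B w) \<le> e / 2" .
      moreover have "norm (B v - A z w) \<le> norm (A z w - B w) + norm (B v - B w)"
        using norm_triangle_ineq[of "B w - A z w" "B v - B w"] by (simp add: norm_minus_commute)
      ultimately have "norm (B v - A z w) < e" using Bs[OF w(2)] by linarith
      then show "\<exists>y\<in>A z ` elts (g z). norm (B v - y) < e" using w(1) by blast
    qed
  qed
qed

section \<open>Shrinking and spreading along a projection\<close>

definition projection :: "('a::real_vector \<Rightarrow> 'a) \<Rightarrow> bool" where
  "projection P \<longleftrightarrow> linear P \<and> (\<forall>x. P (P x) = P x)"

lemma projectionD:
  assumes "projection P"
  shows "linear P" "P (P x) = P x" "P (x + y) = P x + P y" "P (x - y) = P x - P y"
    "P (r *\<^sub>R x) = r *\<^sub>R P x" "P 0 = 0" "P (- x) = - P x"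
  using assms unfolding projection_def
  by (auto simp: linear_add linear_diff linear_cmul linear_0 linear_neg)

lemma projection_fixes_range: "projection P \<Longrightarrow> x \<in> range P \<Longrightarrow> P x = x"
  by (auto simp: projectionD)

text \<open>For \<open>a \<noteq> 0\<close> the component along the range of \<open>P\<close> is multiplied by \<open>a\<close>, and for \<open>b \<noteq> 0\<close> the component
  along the kernel is divided by \<open>b\<close>. In the limit the range of \<open>P\<close> is added to the
  group in the first case, and everything off the range disappears at infinity in the second. The
  values at 0 are these limits if the group satisfies the respective one of the two conditions
  that are defined next.\<close>

definition shrink :: "('a \<Rightarrow> 'a) \<Rightarrow> real \<Rightarrow> 'a::real_normed_vector closed_subgroup \<Rightarrow> 'a closed_subgroup" where
  "shrink P a G = closed_hull
    (if a = 0 then {x + P v | x v. x \<in> elts G} else (\<lambda>x. a *\<^sub>R P x + (x - P x)) ` elts G)"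

definition spread :: "('a \<Rightarrow> 'a) \<Rightarrow> real \<Rightarrow> 'a::real_normed_vector closed_subgroup \<Rightarrow> 'a closed_subgroup" where
  "spread P b G = closed_hull
    (if b = 0 then {x \<in> elts G. P x = x} else (\<lambda>x. P x + (1 / b) *\<^sub>R (x - P x)) ` elts G)"

definition dense_in_range :: "('a \<Rightarrow> 'a) \<Rightarrow> real \<Rightarrow> 'a::real_normed_vector closed_subgroup \<Rightarrow> bool" where
  "dense_in_range P r G \<longleftrightarrow> (\<forall>v. \<exists>y\<in>elts G. P y = y \<and> norm (P v - y) \<le> r)"

definition separated_off_range :: "('a \<Rightarrow> 'a) \<Rightarrow> real \<Rightarrow> 'a::real_normed_vector closed_subgroup \<Rightarrow> bool" where
  "separated_off_range P e G \<longleftrightarrow> (\<forall>y\<in>elts G. norm (y - P y) < e \<longrightarrow> P y = y)"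

context
  fixes P :: "'a \<Rightarrow> 'a::euclidean_space"
  assumes P: "projection P"
begin

lemma linear_shrink_map: "linear (\<lambda>x. a *\<^sub>R P x + (x - P x))"
  by (rule linearI) (auto simp: projectionD[OF P] algebra_simps)

lemma linear_spread_map: "linear (\<lambda>x. P x + b *\<^sub>R (x - P x))"
  by (rule linearI) (auto simp: projectionD[OF P] algebra_simps)

lemma inj_shrink_map: "a \<noteq> 0 \<Longrightarrow> inj (\<lambda>x. a *\<^sub>R P x + (x - P x))"
proof (subst linear_injective_0[OF linear_shrink_map], intro allI impI)
  fix x assume a: "a \<noteq> 0" and x: "a *\<^sub>R P x + (x - P x) = 0"
  have "P (a *\<^sub>R P x + (x - P x)) = a *\<^sub>R P x" by (simp add: projectionD[OF P])
  then have "P x = 0" using a x by (simp add: projectionD[OF P])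
  then show "x = 0" using x by simp
qed

lemma inj_spread_map: "b \<noteq> 0 \<Longrightarrow> inj (\<lambda>x. P x + b *\<^sub>R (x - P x))"
proof (subst linear_injective_0[OF linear_spread_map], intro allI impI)
  fix x assume b: "b \<noteq> 0" and x: "P x + b *\<^sub>R (x - P x) = 0"
  have "P (P x + b *\<^sub>R (x - P x)) = P x" by (simp add: projectionD[OF P])
  then have "P x = 0" using x by (simp add: projectionD[OF P])
  then show "x = 0" using x b by simp
qed

lemma complement_bound: obtains C where "C > 0" "\<And>x. norm (x - P x) \<le> C * norm x"
proof -
  have "linear (\<lambda>x. x - P x)" using projectionD(1)[OF P] by (intro linear_compose_sub linear_ident)
  then show ?thesis using linear_bounded_pos[of "\<lambda>x. x - P x"] that by blast
qed

lemma shrink_nonzero: "a \<noteq> 0 \<Longrightarrow> shrink P a G = lin_act (\<lambda>x. a *\<^sub>R P x + (x - P x)) G"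
  by (simp add: shrink_def lin_act_def)

lemma spread_nonzero: "b \<noteq> 0 \<Longrightarrow> spread P b G = lin_act (\<lambda>x. P x + (1 / b) *\<^sub>R (x - P x)) G"
  by (simp add: spread_def lin_act_def)

lemma shrink_1 [simp]: "shrink P 1 G = G"
  by (simp add: shrink_def closed_hull_elts)

lemma spread_1 [simp]: "spread P 1 G = G"
  by (simp add: spread_def closed_hull_elts)

lemma additive_subgroup_shrink_0: "additive_subgroup {x + P v | x v. x \<in> elts G}"
  unfolding additive_subgroup_def
proof safe
  show "\<exists>x v. 0 = x + P v \<and> x \<in> elts G"
    by (rule exI[of _ 0], rule exI[of _ 0]) (simp add: projectionD[OF P] additive_subgroupD[OF elts_subgroup])
next
  fix x v y w assume "x \<in> elts G" "y \<in> elts G"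
  then show "\<exists>x' v'. x + P v + (y + P w) = x' + P v' \<and> x' \<in> elts G"
    by (intro exI[of _ "x + y"] exI[of _ "v + w"])
      (simp add: projectionD[OF P] additive_subgroupD[OF elts_subgroup])
next
  fix x v assume "x \<in> elts G"
  then show "\<exists>x' v'. - (x + P v) = x' + P v' \<and> x' \<in> elts G"
    by (intro exI[of _ "- x"] exI[of _ "- v"])
      (simp add: projectionD[OF P] additive_subgroupD[OF elts_subgroup])
qed

lemma additive_subgroup_spread_0: "additive_subgroup {x \<in> elts G. P x = x}"
  unfolding additive_subgroup_def
  by (auto simp: projectionD[OF P] additive_subgroupD[OF elts_subgroup])

lemma closed_spread_0: "closed {x \<in> elts G. P x = x}"
proof -
  have "continuous_on UNIV P" using projectionD(1)[OF P] by (simp add: linear_continuous_on linear_conv_bounded_linear)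
  then have "closed {x. P x = x}" by (intro closed_Collect_eq continuous_on_id)
  then have "closed (elts G \<inter> {x. P x = x})" by (intro closed_Int closed_elts)
  then show ?thesis by (simp add: Int_def)
qed

lemma elts_spread_0: "elts (spread P 0 G) = {x \<in> elts G. P x = x}"
  by (simp add: spread_def elts_closed_hull[OF additive_subgroup_spread_0] closed_spread_0)

lemma elts_shrink_0: "elts (shrink P 0 G) = closure {x + P v | x v. x \<in> elts G}"
  by (simp only: shrink_def if_True elts_closed_hull[OF additive_subgroup_shrink_0] simp_thms)

lemma elts_subset_shrink_0: "elts G \<subseteq> elts (shrink P 0 G)"
proof
  fix x assume "x \<in> elts G"
  then have "x + P 0 \<in> {x + P v | x v. x \<in> elts G}" by blast
  then show "x \<in> elts (shrink P 0 G)"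
    unfolding elts_shrink_0 using closure_subset by (force simp: projectionD[OF P])
qed

lemma range_subset_shrink_0: "P v \<in> elts (shrink P 0 G)"
proof -
  have "0 + P v \<in> {x + P v | x v. x \<in> elts G}"
    using additive_subgroupD(1)[OF elts_subgroup] by blast
  then show ?thesis unfolding elts_shrink_0 using closure_subset by force
qed

lemma dense_representative:
  assumes "dense_in_range P r G" "y \<in> elts G"
  obtains y' where "y' \<in> elts G" "y' - P y' = y - P y" "norm (P y') \<le> r"
proof -
  obtain w where w: "w \<in> elts G" "P w = w" "norm (P y - w) \<le> r"
    using assms(1) unfolding dense_in_range_def by blast
  show ?thesis
    by (rule that[of "y - w"])
      (use w assms(2) in \<open>auto simp: projectionD[OF P] additive_subgroupD[OF elts_subgroup]\<close>)
qed

text \<open>Elements of the group whose component along the kernel is bounded can be made bounded by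
  subtracting elements in the range, which is why density in the range gives the limit uniformly.\<close>

lemma tendsto_shrink_0:
  assumes g: "(g \<longlongrightarrow> G) F" and a: "(a \<longlongrightarrow> 0) F"
    and dense: "\<forall>\<^sub>F z in F. dense_in_range P r (g z)" "dense_in_range P r G"
  shows "((\<lambda>z. shrink P (a z) (g z)) \<longlongrightarrow> shrink P 0 G) F"
  unfolding shrink_def
proof (rule tendsto_closed_hull)
  let ?A = "\<lambda>a G. if a = 0 then {x + P v | x v. x \<in> elts G} else (\<lambda>x. a *\<^sub>R P x + (x - P x)) ` elts G"
  have sub: "additive_subgroup (?A a G)" for a G
    by (cases "a = 0") (simp_all only: if_True if_False simp_thms additive_subgroup_shrink_0
      additive_subgroup_linear_image[OF linear_shrink_map elts_subgroup])
  show "\<forall>\<^sub>F z in F. additive_subgroup (?A (a z) (g z))" "additive_subgroup (?A 0 G)"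
    by (simp_all only: sub eventually_True)
  fix R e :: real assume e: "e > 0"
  obtain C where C: "C > 0" "\<And>x. norm (x - P x) \<le> C * norm x" using complement_bound by blast
  have rep: "\<exists>y\<in>elts H. x - P x = y - P y \<and> norm y \<le> r + C * norm x"
    if H: "dense_in_range P r H" "x \<in> ?A b H" for x b H
  proof -
    obtain y where y: "y \<in> elts H" "x - P x = y - P y"
      using H(2) by (auto simp: projectionD[OF P] split: if_splits)
    obtain y' where y': "y' \<in> elts H" "y' - P y' = y - P y" "norm (P y') \<le> r"
      using dense_representative[OF H(1) y(1)] by blast
    have "norm y' \<le> norm (P y') + norm (y' - P y')" by (metis add.commute diff_add_cancel norm_triangle_ineq)
    then have "norm y' \<le> r + C * norm x" using y y' C(2)[of x] by simp
    then show ?thesis using y y' by (intro bexI[of _ y']) auto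
  qed
  define S where "S = r + C * R"
  have small: "e / (2 * C) > 0" using e C by simp
  have Cs: "norm ((v - P v) - (w - P w)) < e / 2" if "norm (v - w) < e / (2 * C)" for v w
  proof -
    have "norm ((v - P v) - (w - P w)) \<le> C * norm (v - w)"
      using C(2)[of "v - w"] by (simp add: projectionD[OF P] algebra_simps)
    also have "\<dots> < e / 2" using that C(1) by (simp add: field_simps)
    finally show ?thesis .
  qed
  have S: "r + C * norm x \<le> S" if "norm x \<le> R" for x :: 'a
    using that C(1) by (simp add: S_def)
  show "\<forall>\<^sub>F z in F. nearby R e (?A (a z) (g z)) (?A 0 G)"
    using dense(1) tendsto_closed_subgroupD(1)[OF g small, of S]
  proof eventually_elim
    case (elim z)
    show ?case unfolding nearby_def
    proof (intro ballI impI)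
      fix x assume x: "x \<in> ?A (a z) (g z)" "norm x \<le> R"
      obtain y where y: "y \<in> elts (g z)" "x - P x = y - P y" "norm y \<le> r + C * norm x"
        using rep[OF elim(1) x(1)] by blast
      then obtain w where w: "w \<in> elts G" "norm (y - w) < e / (2 * C)"
        using elim(2) S[OF x(2)] unfolding nearby_def by fastforce
      have "x - (w + P (x - w)) = (x - P x) - (w - P w)" by (simp add: projectionD[OF P] algebra_simps)
      then have "norm (x - (w + P (x - w))) = norm ((y - P y) - (w - P w))" by (simp only: y(2))
      then have "norm (x - (w + P (x - w))) < e" using Cs[OF w(2)] e by linarith
      then show "\<exists>y\<in>?A 0 G. norm (x - y) < e" using w(1) by auto
    qed
  qed
  define d where "d = e / (2 * (\<bar>r\<bar> + 1))"
  have d: "d > 0" using e by (simp add: d_def)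
  have "\<forall>\<^sub>F z in F. \<bar>a z\<bar> < d" using a d by (auto simp: tendsto_iff dist_real_def)
  then show "\<forall>\<^sub>F z in F. nearby R e (?A 0 G) (?A (a z) (g z))"
    using dense(1) tendsto_closed_subgroupD(2)[OF g small, of S]
  proof eventually_elim
    case (elim z)
    show ?case unfolding nearby_def
    proof (intro ballI impI)
      fix x assume x: "x \<in> ?A 0 G" "norm x \<le> R"
      obtain y where y: "y \<in> elts G" "x - P x = y - P y" "norm y \<le> r + C * norm x"
        using rep[OF dense(2) x(1)] by blast
      then obtain w where w: "w \<in> elts (g z)" "norm (y - w) < e / (2 * C)"
        using elim(3) S[OF x(2)] unfolding nearby_def by fastforce
      show "\<exists>y\<in>?A (a z) (g z). norm (x - y) < e"
      proof (cases "a z = 0")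
        case True
        have "x - (w + P (x - w)) = (x - P x) - (w - P w)" by (simp add: projectionD[OF P] algebra_simps)
        then have "norm (x - (w + P (x - w))) = norm ((y - P y) - (w - P w))" by (simp only: y(2))
      then have "norm (x - (w + P (x - w))) < e" using Cs[OF w(2)] e by linarith
        then show ?thesis using w(1) True by auto
      next
        case False
        obtain u where u: "u \<in> elts (g z)" "P u = u" "norm (P ((1 / a z) *\<^sub>R x - w) - u) \<le> r"
          using elim(2) unfolding dense_in_range_def by blast
        let ?w = "w + u"
        have eq: "x - (a z *\<^sub>R P ?w + (?w - P ?w)) = ((x - P x) - (w - P w)) + a z *\<^sub>R (P ((1 / a z) *\<^sub>R x - w) - u)"
          using False by (simp add: projectionD[OF P] u(2) algebra_simps)
        moreover have "norm (a z *\<^sub>R (P ((1 / a z) *\<^sub>R x - w) - u)) \<le> d * (\<bar>r\<bar> + 1)"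
          unfolding norm_scaleR using elim(1) u(3) d by (intro mult_mono) auto
        moreover have "d * (\<bar>r\<bar> + 1) = e / 2"
        proof -
          have "\<bar>r\<bar> + 1 \<noteq> 0" by linarith
          moreover have "e / (2 * s) * s = e / 2" if "s \<noteq> 0" for s using that by simp
          ultimately show ?thesis unfolding d_def by blast
        qed
        ultimately have "norm (x - (a z *\<^sub>R P ?w + (?w - P ?w))) < e"
          using Cs[OF w(2)] norm_triangle_ineq[of "(y - P y) - (w - P w)" "a z *\<^sub>R (P ((1 / a z) *\<^sub>R x - w) - u)"]
          unfolding eq unfolding y(2) by linarith
        moreover have "?w \<in> elts (g z)" using w u by (simp add: additive_subgroupD[OF elts_subgroup])
        ultimately show ?thesis using False by auto
      qed
    qed
  qed
qed

lemma tendsto_shrink: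
  assumes g: "(g \<longlongrightarrow> G) F" and a: "(a \<longlongrightarrow> a0) F"
    and dense: "\<forall>\<^sub>F z in F. dense_in_range P r (g z)" "dense_in_range P r G"
  shows "((\<lambda>z. shrink P (a z) (g z)) \<longlongrightarrow> shrink P a0 G) F"
proof (cases "a0 = 0")
  case True
  then show ?thesis using tendsto_shrink_0[OF g _ dense] a by simp
next
  case False
  have "((\<lambda>z. lin_act (\<lambda>x. a z *\<^sub>R P x + (x - P x)) (g z)) \<longlongrightarrow> lin_act (\<lambda>x. a0 *\<^sub>R P x + (x - P x)) G) F"
    by (intro tendsto_lin_act linear_shrink_map inj_shrink_map False g tendsto_intros a always_eventually allI)
  moreover have "\<forall>\<^sub>F z in F. a z \<noteq> 0" using a False by (rule tendsto_imp_eventually_ne)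
  then have "\<forall>\<^sub>F z in F. shrink P (a z) (g z) = lin_act (\<lambda>x. a z *\<^sub>R P x + (x - P x)) (g z)"
    by eventually_elim (simp add: shrink_nonzero)
  ultimately show ?thesis using False by (simp add: shrink_nonzero tendsto_cong)
qed

text \<open>An element that stays in a ball although its component off the range is divided by a small number
  had a tiny such component, hence none by separation.\<close>

lemma tendsto_spread_0:
  assumes g: "(g \<longlongrightarrow> G) F" and b: "(b \<longlongrightarrow> 0) F" and e0: "e0 > 0"
    and sep: "\<forall>\<^sub>F z in F. separated_off_range P e0 (g z)" "separated_off_range P e0 G"
  shows "((\<lambda>z. spread P (b z) (g z)) \<longlongrightarrow> spread P 0 G) F"
  unfolding spread_def
proof (rule tendsto_closed_hull)
  let ?B = "\<lambda>b G. if b = 0 then {x \<in> elts G. P x = x} else (\<lambda>x. P x + (1 / b) *\<^sub>R (x - P x)) ` elts G"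
  have sub: "additive_subgroup (?B b G)" for b G
    by (auto intro: additive_subgroup_spread_0 additive_subgroup_linear_image[OF linear_spread_map elts_subgroup])
  show "\<forall>\<^sub>F z in F. additive_subgroup (?B (b z) (g z))" "additive_subgroup (?B 0 G)"
    by (simp_all only: sub eventually_True)
  fix R e :: real assume e: "e > 0"
  obtain C where C: "C > 0" "\<And>x. norm (x - P x) \<le> C * norm x" using complement_bound by blast
  define e' where "e' = min e (e0 / C)"
  have e': "e' > 0" "e' \<le> e" "e' \<le> e0 / C" using e e0 C by (auto simp: e'_def)
  have snap: "P y = y" if "separated_off_range P e0 H" "y \<in> elts H" "P x = x" "norm (x - y) < e'" for x y H
  proof -
    have "norm (y - P y) = norm ((y - x) - P (y - x))" using that(3) by (simp add: projectionD[OF P])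
    also have "\<dots> \<le> C * norm (y - x)" by (rule C(2))
    also have "\<dots> < C * (e0 / C)" using that(4) e'(3) C(1) by (intro mult_strict_left_mono) (auto simp: norm_minus_commute)
    finally show ?thesis using that(1,2) C(1) by (simp add: separated_off_range_def)
  qed
  define d where "d = e0 / (C * (\<bar>R\<bar> + 1))"
  have d: "d > 0" using e0 C by (auto simp: d_def intro!: divide_pos_pos mult_pos_pos)
  have dC: "d * (C * (\<bar>R\<bar> + 1)) = e0" 
    using C by (simp add: d_def add_eq_0_iff)
  have "\<forall>\<^sub>F z in F. \<bar>b z\<bar> < d" using b d by (auto simp: tendsto_iff dist_real_def)
  then show "\<forall>\<^sub>F z in F. nearby R e (?B (b z) (g z)) (?B 0 G)"
    using sep(1) tendsto_closed_subgroupD(1)[OF g e'(1), of R]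
  proof eventually_elim
    case (elim z)
    show ?case unfolding nearby_def
    proof (intro ballI impI)
      fix x assume x: "x \<in> ?B (b z) (g z)" "norm x \<le> R"
      have x': "x \<in> elts (g z)" "P x = x"
      proof -
        have "x \<in> elts (g z) \<and> P x = x"
        proof (cases "b z = 0")
          case False
          then obtain y where y: "y \<in> elts (g z)" "x = P y + (1 / b z) *\<^sub>R (y - P y)" using x(1) by auto
          have "x - P x = (1 / b z) *\<^sub>R (y - P y)" using y(2) by (simp add: projectionD[OF P])
          then have "y - P y = b z *\<^sub>R (x - P x)" using False by simp
          then have "norm (y - P y) = \<bar>b z\<bar> * norm (x - P x)" by simp
          also have "\<dots> \<le> \<bar>b z\<bar> * (C * (\<bar>R\<bar> + 1))"
            using C(1) x(2) by (intro mult_left_mono order_trans[OF C(2)]) auto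
          also have "\<dots> < d * (C * (\<bar>R\<bar> + 1))"
            using elim(1) C(1) by (intro mult_strict_right_mono mult_pos_pos) auto
          finally have "P y = y" using dC elim(2) y(1) by (simp add: separated_off_range_def)
          then show ?thesis using y by simp
        qed (use x in auto)
        then show "x \<in> elts (g z)" "P x = x" by auto
      qed
      then obtain w where w: "w \<in> elts G" "norm (x - w) < e'"
        using elim(3) x(2) unfolding nearby_def by blast
      then show "\<exists>y\<in>?B 0 G. norm (x - y) < e" using snap[OF sep(2) w(1) x'(2) w(2)] e'(2) by auto
    qed
  qed
  show "\<forall>\<^sub>F z in F. nearby R e (?B 0 G) (?B (b z) (g z))"
    using sep(1) tendsto_closed_subgroupD(2)[OF g e'(1), of R]
  proof eventually_elim
    case (elim z)
    show ?case unfolding nearby_def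
    proof (intro ballI impI)
      fix x assume x: "x \<in> ?B 0 G" "norm x \<le> R"
      then obtain w where w: "w \<in> elts (g z)" "norm (x - w) < e'"
        using elim(2) unfolding nearby_def by auto
      have Pw: "P w = w" using snap[OF elim(1) w(1) _ w(2)] x(1) by auto
      have "w \<in> ?B (b z) (g z)" using w(1) Pw by (auto intro!: image_eqI[of _ _ w])
      then show "\<exists>y\<in>?B (b z) (g z). norm (x - y) < e" using w(2) e'(2) by force
    qed
  qed
qed

lemma tendsto_spread:
  assumes g: "(g \<longlongrightarrow> G) F" and b: "(b \<longlongrightarrow> b0) F" and e0: "e0 > 0"
    and sep: "\<forall>\<^sub>F z in F. separated_off_range P e0 (g z)" "separated_off_range P e0 G"
  shows "((\<lambda>z. spread P (b z) (g z)) \<longlongrightarrow> spread P b0 G) F"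
proof (cases "b0 = 0")
  case True
  then show ?thesis using tendsto_spread_0[OF g _ e0 sep] b by simp
next
  case False
  have "((\<lambda>z. lin_act (\<lambda>x. P x + (1 / b z) *\<^sub>R (x - P x)) (g z)) \<longlongrightarrow> lin_act (\<lambda>x. P x + (1 / b0) *\<^sub>R (x - P x)) G) F"
    using False
    by (intro tendsto_lin_act linear_spread_map inj_spread_map g tendsto_intros b always_eventually allI) auto
  moreover have "\<forall>\<^sub>F z in F. b z \<noteq> 0" using b False by (rule tendsto_imp_eventually_ne)
  then have "\<forall>\<^sub>F z in F. spread P (b z) (g z) = lin_act (\<lambda>x. P x + (1 / b z) *\<^sub>R (x - P x)) (g z)"
    by eventually_elim (simp add: spread_nonzero)
  ultimately show ?thesis using False by (simp add: spread_nonzero tendsto_cong)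
qed

end

text \<open>Adding the range of \<open>P\<close> does not change the components along the kernel.\<close>

lemma separated_shrink_0:
  fixes G :: "'a::euclidean_space closed_subgroup"
  assumes P: "projection P" and G: "separated_off_range P e G"
  shows "separated_off_range P e (shrink P 0 G)"
  unfolding separated_off_range_def
proof (intro ballI impI)
  fix y assume y: "y \<in> elts (shrink P 0 G)" "norm (y - P y) < e"
  have bl: "bounded_linear P" using projectionD(1)[OF P] linear_conv_bounded_linear by blast
  obtain f where f: "\<And>n. f n \<in> {x + P v | x v. x \<in> elts G}" "f \<longlonglongrightarrow> y"
    using y(1) unfolding elts_shrink_0[OF P] closure_sequential by blast
  have lim: "(\<lambda>n. f n - P (f n)) \<longlonglongrightarrow> y - P y"
    by (intro tendsto_diff f(2) bounded_linear.tendsto[OF bl])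
  have "\<forall>\<^sub>F n in sequentially. norm (f n - P (f n)) < e"
    using tendsto_norm[OF lim] y(2) by (rule order_tendstoD(2))
  then have "\<forall>\<^sub>F n in sequentially. f n - P (f n) = 0"
  proof eventually_elim
    case (elim n)
    obtain x v where x: "f n = x + P v" "x \<in> elts G" using f(1)[of n] by blast
    then have eq: "f n - P (f n) = x - P x" by (simp add: projectionD[OF P])
    then have "P x = x" using elim G x(2) by (simp add: separated_off_range_def)
    then show ?case by (simp only: eq diff_self)
  qed
  then have "y - P y = 0" by (rule tendsto_unique[OF sequentially_bot lim tendsto_eventually])
  then show "P y = y" by simp
qed

section \<open>Cocompact subgroups\<close>

text \<open>For a closed subgroup of a Euclidean space, spanning the space is the same as having a compact
  quotient.\<close>

definition cocompact :: "'a::real_vector set \<Rightarrow> bool" where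
  "cocompact A \<longleftrightarrow> span A = UNIV"

lemma cocompact_mono: "cocompact A \<Longrightarrow> A \<subseteq> B \<Longrightarrow> cocompact B"
  unfolding cocompact_def using span_mono by blast

lemma cocompact_linear_image:
  fixes f :: "'a \<Rightarrow> 'a::euclidean_space"
  assumes "cocompact A" "linear f" "inj f"
  shows "cocompact (f ` A)"
proof -
  have "surj f" using assms linear_injective_imp_surjective by blast
  then show ?thesis using assms by (simp add: cocompact_def linear_span_image)
qed

lemma cocompact_lin_act:
  fixes f :: "'a \<Rightarrow> 'a::euclidean_space"
  assumes "cocompact (elts G)" "linear f" "inj f"
  shows "cocompact (elts (lin_act f G))"
  using cocompact_linear_image[OF assms] assms by (simp add: elts_lin_act)

lemma subgroup_dense_in_span:
  assumes A: "additive_subgroup A" and S: "finite S" "S \<subseteq> A" and v: "v \<in> span S"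
  obtains y where "y \<in> A" "y \<in> span S" "norm (v - y) \<le> (\<Sum>x\<in>S. norm x)"
proof -
  obtain c where c: "v = (\<Sum>x\<in>S. c x *\<^sub>R x)" using v S(1) by (auto simp: span_finite)
  let ?y = "\<Sum>x\<in>S. of_int \<lfloor>c x\<rfloor> *\<^sub>R x"
  show ?thesis
  proof (rule that[of ?y])
    show "?y \<in> A" using S by (intro additive_subgroup_sum additive_subgroup_of_int A) auto
    show "?y \<in> span S" by (intro span_sum span_scale span_base)
    have "v - ?y = (\<Sum>x\<in>S. (c x - of_int \<lfloor>c x\<rfloor>) *\<^sub>R x)" by (simp add: c sum_subtractf algebra_simps)
    also have "norm \<dots> \<le> (\<Sum>x\<in>S. norm x)"
    proof (intro sum_norm_le)
      fix x
      have "\<bar>c x - of_int \<lfloor>c x\<rfloor>\<bar> \<le> 1" by linarith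
      then show "norm ((c x - of_int \<lfloor>c x\<rfloor>) *\<^sub>R x) \<le> norm x" by (simp add: mult_left_le_one_le)
    qed
    finally show "norm (v - ?y) \<le> (\<Sum>x\<in>S. norm x)" .
  qed
qed

lemma projection_id: "projection (\<lambda>x. x)"
  by (simp add: projection_def linear_ident)

lemma cocompact_imp_dense:
  fixes G :: "'a::euclidean_space closed_subgroup"
  assumes "cocompact (elts G)"
  obtains r where "r > 0" "dense_in_range (\<lambda>x. x) r G"
proof -
  obtain S where S: "S \<subseteq> elts G" "independent S" "elts G \<subseteq> span S"
    using maximal_independent_subset[of "elts G"] by blast
  have "finite S" using S(2) by (rule finiteI_independent)
  have "span S = UNIV"
    using span_mono[OF S(3)] assms by (simp add: cocompact_def span_span top.extremum_unique)
  show ?thesis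
  proof (rule that[of "(\<Sum>x\<in>S. norm x) + 1"])
    show "(\<Sum>x\<in>S. norm x) + 1 > 0" by (smt (verit) norm_ge_zero sum_nonneg)
    show "dense_in_range (\<lambda>x. x) ((\<Sum>x\<in>S. norm x) + 1) G"
      unfolding dense_in_range_def
    proof
      fix v
      obtain y where "y \<in> elts G" "norm (v - y) \<le> (\<Sum>x\<in>S. norm x)"
        using subgroup_dense_in_span[OF elts_subgroup \<open>finite S\<close> S(1), of v] \<open>span S = UNIV\<close> by blast
      then show "\<exists>y\<in>elts G. y = y \<and> norm (v - y) \<le> (\<Sum>x\<in>S. norm x) + 1"
        by (intro bexI[of _ y]) auto
    qed
  qed
qed

text \<open>Density spreads from a ball to the whole space: a vector of size \<open>2 r n\<close> is reached in \<open>n\<close> steps, and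
  each step only uses elements of the group in a fixed ball.\<close>

lemma dense_nearby:
  fixes G H :: "'a::euclidean_space closed_subgroup"
  assumes r: "r > 0" and G: "dense_in_range (\<lambda>x. x) r G" and near: "nearby (5 * r) r (elts G) (elts H)"
  shows "dense_in_range (\<lambda>x. x) (2 * r) H"
proof -
  have local_dense: "\<exists>y\<in>elts H. norm (v - y) \<le> 2 * r" if "norm v \<le> 4 * r" for v
  proof -
    obtain w where w: "w \<in> elts G" "norm (v - w) \<le> r" using G by (auto simp: dense_in_range_def)
    have "norm w \<le> 5 * r" using w(2) that norm_triangle_ineq2[of w v] by (simp add: norm_minus_commute)
    then obtain y where y: "y \<in> elts H" "norm (w - y) < r" using near w(1) by (auto simp: nearby_def)
    have "norm (v - y) \<le> norm (v - w) + norm (w - y)" using norm_triangle_ineq[of "v - w" "w - y"] by simp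
    then show ?thesis using w y by (intro bexI[of _ y]) auto
  qed
  have "\<exists>y\<in>elts H. norm (v - y) \<le> 2 * r" if "norm v \<le> 2 * r * real n" for n v
    using that
  proof (induction n arbitrary: v)
    case 0
    then show ?case using r additive_subgroupD(1)[OF elts_subgroup] by (intro bexI[of _ 0]) auto
  next
    case (Suc n)
    \<comment> \<open>the point at distance at most \<open>2 r n\<close> from 0 on the segment to \<open>v\<close>\<close>
    define c where "c = real n / real (Suc n)"
    have c: "c \<ge> 0" "c * real (Suc n) = real n" "1 - c = 1 / real (Suc n)"
      by (auto simp: c_def field_simps)
    let ?u = "c *\<^sub>R v"
    have "norm ?u \<le> c * (2 * r * real (Suc n))" using Suc.prems c(1) by (simp add: mult_left_mono)
    also have "\<dots> = 2 * r * (c * real (Suc n))" by (simp only: mult_ac)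
    finally have "norm ?u \<le> 2 * r * real n" by (simp only: c(2))
    then obtain y where y: "y \<in> elts H" "norm (?u - y) \<le> 2 * r" using Suc.IH by blast
    have "v - ?u = (1 - c) *\<^sub>R v" by (simp add: algebra_simps)
    then have "norm (v - ?u) = norm v / real (Suc n)" by (simp add: c(3))
    also have "\<dots> \<le> 2 * r" using Suc.prems by (simp add: divide_le_eq)
    finally have "norm (v - ?u) \<le> 2 * r" .
    then have "norm (v - y) \<le> 4 * r" using y(2) norm_triangle_ineq[of "v - ?u" "?u - y"] by simp
    then obtain x where x: "x \<in> elts H" "norm (v - y - x) \<le> 2 * r" using local_dense by blast
    then show ?case using y(1)
      by (intro bexI[of _ "y + x"]) (auto simp: additive_subgroupD[OF elts_subgroup] diff_diff_add)
  qed
  moreover have "\<exists>n. norm v \<le> 2 * r * real n" for v :: 'a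
    using r real_arch_simple[of "norm v / (2 * r)"] by (auto simp: field_simps)
  ultimately show ?thesis unfolding dense_in_range_def by blast
qed

lemma tendsto_shrink_cocompact:
  fixes G :: "'a::euclidean_space closed_subgroup"
  assumes g: "(g \<longlongrightarrow> G) F" and a: "(a \<longlongrightarrow> a0) F" and G: "cocompact (elts G)"
  shows "((\<lambda>z. shrink (\<lambda>x. x) (a z) (g z)) \<longlongrightarrow> shrink (\<lambda>x. x) a0 G) F"
proof -
  obtain r where r: "r > 0" "dense_in_range (\<lambda>x. x) r G" using cocompact_imp_dense[OF G] .
  have "\<forall>\<^sub>F z in F. dense_in_range (\<lambda>x. x) (2 * r) (g z)"
    using tendsto_closed_subgroupD(2)[OF g r(1), of "5 * r"] by eventually_elim (rule dense_nearby[OF r])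
  moreover have "dense_in_range (\<lambda>x. x) (2 * r) G"
    unfolding dense_in_range_def
  proof
    fix v
    obtain y where "y \<in> elts G" "norm (v - y) \<le> r" using r(2) unfolding dense_in_range_def by blast
    then show "\<exists>y\<in>elts G. y = y \<and> norm (v - y) \<le> 2 * r" using r(1) by (intro bexI[of _ y]) auto
  qed
  ultimately show ?thesis by (intro tendsto_shrink[OF projection_id g a])
qed

lemma shrink_id_0: "shrink (\<lambda>x. x) 0 G = closed_hull UNIV"
proof -
  have "{x + v | x v. x \<in> elts G} = UNIV"
    using additive_subgroupD(1)[OF elts_subgroup[of G]] by (auto intro: exI[of _ 0])
  then show ?thesis by (simp add: shrink_def)
qed

section \<open>Bases of discrete subgroups\<close>

text \<open>Induction on the dimension: project along a shortest nonzero element \<open>x\<close>. The projected group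
  is again discrete, as an element can be changed by a multiple of \<open>x\<close> until its component along \<open>x\<close> is
  at most half of \<open>x\<close>, and then a short projection would make the element shorter than \<open>x\<close>. Lifting a
  basis of the projection and adding \<open>x\<close> gives the basis.\<close>

lemma discrete_subgroup_basis:
  fixes B :: "'a::euclidean_space set"
  assumes "additive_subgroup B" "e > 0" "\<And>y. y \<in> B \<Longrightarrow> norm y < e \<Longrightarrow> y = 0"
  shows "\<exists>S. independent S \<and> S \<subseteq> B \<and> (\<forall>y\<in>B. \<exists>n :: 'a \<Rightarrow> int. y = (\<Sum>k\<in>S. of_int (n k) *\<^sub>R k))"
  using assms
proof (induction "dim B" arbitrary: B e rule: less_induct)
  case less
  note sub = additive_subgroupD[OF less.prems(1)]
  show ?case
  proof (cases "B = {0}")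
    case True
    then show ?thesis by (intro exI[of _ "{}"]) (auto simp: independent_empty)
  next
    case False
    then obtain y0 where y0: "y0 \<in> B" "y0 \<noteq> 0" using sub(1) by blast
    have "closed B"
    proof (rule discrete_imp_closed[OF less.prems(2)], intro ballI impI)
      fix x y assume "x \<in> B" "y \<in> B" "dist y x < e"
      then have "y - x = 0" using less.prems(3)[of "y - x"] sub(4) by (simp add: dist_norm)
      then show "y = x" by simp
    qed
    then have "compact (B \<inter> (cball 0 (norm y0) - ball 0 e))"
      by (intro closed_Int_compact compact_diff) auto
    moreover have "y0 \<in> B \<inter> (cball 0 (norm y0) - ball 0 e)" using y0 less.prems(3) by force
    ultimately obtain x where x: "x \<in> B" "x \<notin> ball 0 e" "norm x \<le> norm y0"
        "\<And>z. z \<in> B \<inter> (cball 0 (norm y0) - ball 0 e) \<Longrightarrow> norm x \<le> norm z"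
      using continuous_attains_inf[of "B \<inter> (cball 0 (norm y0) - ball 0 e)" norm] continuous_on_norm_id by blast
    have x0: "x \<noteq> 0" using x(2) less.prems(2) by auto
    have short: "z = 0" if "z \<in> B" "norm z < norm x" for z
      using x(3) x(4)[of z] less.prems(3)[of z] that by force
    define \<pi> where "\<pi> y = y - (y \<bullet> x / (x \<bullet> x)) *\<^sub>R x" for y
    have lin: "linear \<pi>"
      by (rule linearI) (auto simp: \<pi>_def inner_add_left add_divide_distrib algebra_simps)
    have \<pi>x: "\<pi> x = 0" and orth: "\<pi> y \<bullet> x = 0" for y
      using x0 by (auto simp: \<pi>_def inner_diff_left)
    have near: "\<exists>m::int. norm ((y - of_int m *\<^sub>R x) - \<pi> y) \<le> norm x / 2" for y
    proof -
      have "\<bar>y \<bullet> x / (x \<bullet> x) - of_int (round (y \<bullet> x / (x \<bullet> x)))\<bar> \<le> 1 / 2"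
        using of_int_round_abs_le[of "y \<bullet> x / (x \<bullet> x)"] by (simp add: abs_minus_commute)
      moreover have "(y - of_int m *\<^sub>R x) - \<pi> y = (y \<bullet> x / (x \<bullet> x) - of_int m) *\<^sub>R x" for m
        by (simp add: \<pi>_def algebra_simps)
      ultimately show ?thesis
        using mult_right_mono[of "\<bar>y \<bullet> x / (x \<bullet> x) - of_int (round (y \<bullet> x / (x \<bullet> x)))\<bar>" "1/2" "norm x"]
        by (intro exI[of _ "round (y \<bullet> x / (x \<bullet> x))"]) (simp only: norm_scaleR, simp)
    qed
    have multiple: "of_int m *\<^sub>R x \<in> B" for m by (intro additive_subgroup_of_int less.prems x)
    have \<pi>_short: "\<pi> y = 0 \<and> (\<exists>m::int. y = of_int m *\<^sub>R x)" if y: "y \<in> B" "norm (\<pi> y) < norm x / 2" for y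
    proof -
      obtain m :: int where m: "norm ((y - of_int m *\<^sub>R x) - \<pi> y) \<le> norm x / 2" using near by blast
      have "norm (y - of_int m *\<^sub>R x) < norm x"
        using m y(2) norm_triangle_ineq[of "(y - of_int m *\<^sub>R x) - \<pi> y" "\<pi> y"] by simp
      then have "y - of_int m *\<^sub>R x = 0" using short sub(4) y(1) multiple by blast
      then have "y = of_int m *\<^sub>R x" by simp
      then show ?thesis using linear_cmul[OF lin] \<pi>x by auto
    qed
    have \<pi>B: "additive_subgroup (\<pi> ` B)" by (intro additive_subgroup_linear_image lin less.prems)
    have \<pi>disc: "w = 0" if "w \<in> \<pi> ` B" "norm w < norm x / 2" for w using that \<pi>_short by auto
    have dim: "dim (\<pi> ` B) < dim B"
    proof (rule dim_psubset)
      have "\<pi> y \<in> span B" if "y \<in> B" for y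
        unfolding \<pi>_def using that x(1) by (intro span_diff span_scale span_base)
      then have "span (\<pi> ` B) \<subseteq> span B" by (intro span_minimal subspace_span) auto
      moreover have "span (\<pi> ` B) \<subseteq> {z. z \<bullet> x = 0}"
        by (intro span_minimal) (auto simp: orth subspace_def inner_add_left)
      then have "x \<notin> span (\<pi> ` B)" using x0 by auto
      moreover have "x \<in> span B" using x(1) by (rule span_base)
      ultimately show "span (\<pi> ` B) \<subset> span B" by blast
    qed
    have half: "norm x / 2 > 0" using x0 by simp
    have "\<exists>S. independent S \<and> S \<subseteq> \<pi> ` B \<and>
        (\<forall>w\<in>\<pi> ` B. \<exists>n :: 'a \<Rightarrow> int. w = (\<Sum>k\<in>S. of_int (n k) *\<^sub>R k))"
      by (rule less.hyps[OF dim \<pi>B half]) (rule \<pi>disc)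
    then obtain S where S: "independent S" "S \<subseteq> \<pi> ` B"
        "\<forall>w\<in>\<pi> ` B. \<exists>n :: 'a \<Rightarrow> int. w = (\<Sum>k\<in>S. of_int (n k) *\<^sub>R k)"
      by (elim exE conjE)
    have "\<forall>k\<in>S. \<exists>y. y \<in> B \<and> \<pi> y = k"
    proof
      fix k assume "k \<in> S"
      then have "k \<in> \<pi> ` B" using S(2) by (rule rev_subsetD)
      then obtain y where "y \<in> B" "k = \<pi> y" by (rule imageE)
      then show "\<exists>y. y \<in> B \<and> \<pi> y = k" by (intro exI[of _ y]) simp
    qed
    from bchoice[OF this] obtain l where l: "\<And>k. k \<in> S \<Longrightarrow> l k \<in> B" "\<And>k. k \<in> S \<Longrightarrow> \<pi> (l k) = k"
      by blast
    have fin: "finite S" using S(1) by (rule finiteI_independent)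
    have inj: "inj_on l S" using l(2) by (rule inj_on_inverseI)
    obtain L where L: "linear L" "\<And>k. k \<in> S \<Longrightarrow> L k = l k"
      using linear_independent_extend[OF S(1), of l] by blast
    have \<pi>L: "\<pi> (L u) = u" if "u \<in> span S" for u
      using linear_eq_on[OF linear_compose[OF L(1) lin] linear_ident that] L(2) l(2) by (simp add: o_def)
    have L_image: "L ` S = l ` S" using L(2) by auto
    have "inj_on L (span S)" using \<pi>L by (rule inj_on_inverseI)
    then have "independent (l ` S)"
      unfolding L_image[symmetric] by (rule linear_independent_injective_image[OF L(1) S(1)])
    moreover have "x \<notin> span (l ` S)"
    proof
      assume "x \<in> span (l ` S)"
      then have "x \<in> L ` span S" by (simp only: linear_span_image[OF L(1), symmetric] L_image)
      then obtain u where "u \<in> span S" "x = L u" by (rule imageE)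
      then have "\<pi> x = u" by (simp only: \<pi>L)
      then have "u = 0" using \<pi>x by (rule trans[OF sym])
      then have "x = 0" using \<open>x = L u\<close> linear_0[OF L(1)] by simp
      then show False using x0 by contradiction
    qed
    ultimately have ind: "independent (insert x (l ` S))" by (intro independent_insertI)
    have "x \<notin> l ` S" using \<open>x \<notin> span (l ` S)\<close> by (rule contrapos_nn) (rule span_base)
    have "\<exists>n :: 'a \<Rightarrow> int. y = (\<Sum>k\<in>insert x (l ` S). of_int (n k) *\<^sub>R k)" if y: "y \<in> B" for y
    proof -
      obtain n :: "'a \<Rightarrow> int" where n: "\<pi> y = (\<Sum>k\<in>S. of_int (n k) *\<^sub>R k)"
        using bspec[OF S(3) imageI[OF y]] by (rule exE)
      let ?z = "y - (\<Sum>k\<in>S. of_int (n k) *\<^sub>R l k)"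
      have "?z \<in> B" using y l(1)
        by (intro sub(4) additive_subgroup_sum additive_subgroup_of_int less.prems)
      moreover have "\<pi> ?z = 0"
        using n l(2) by (simp add: linear_diff[OF lin] linear_sum[OF lin] linear_cmul[OF lin])
      ultimately have "\<exists>m::int. ?z = of_int m *\<^sub>R x" using \<pi>_short[of ?z] x0 by simp
      then obtain m :: int where m: "?z = of_int m *\<^sub>R x" by (rule exE)
      let ?n = "\<lambda>w. if w = x then m else n (inv_into S l w)"
      have "(\<Sum>k\<in>insert x (l ` S). of_int (?n k) *\<^sub>R k) = of_int m *\<^sub>R x + (\<Sum>k\<in>l ` S. of_int (?n k) *\<^sub>R k)"
        using \<open>x \<notin> l ` S\<close> fin by simp
      also have "(\<Sum>k\<in>l ` S. of_int (?n k) *\<^sub>R k) = (\<Sum>k\<in>S. of_int (n k) *\<^sub>R l k)"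
        unfolding sum.reindex[OF inj] o_def
      proof (rule sum.cong[OF refl])
        fix k assume k: "k \<in> S"
        then have "l k \<noteq> x" using \<open>x \<notin> l ` S\<close> by blast
        then show "of_int (?n (l k)) *\<^sub>R l k = of_int (n k) *\<^sub>R l k"
          using inv_into_f_f[OF inj k] by simp
      qed
      finally have "(\<Sum>k\<in>insert x (l ` S). of_int (?n k) *\<^sub>R k) = ?z + (\<Sum>k\<in>S. of_int (n k) *\<^sub>R l k)"
        by (simp only: m)
      also have "\<dots> = y" by (rule diff_add_cancel)
      finally show ?thesis by (intro exI[of _ ?n]) (rule sym)
    qed
    moreover have "insert x (l ` S) \<subseteq> B" using x(1) l(1) by blast
    ultimately show ?thesis using ind by (intro exI[of _ "insert x (l ` S)"] conjI ballI)
  qed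
qed

section \<open>Adding a lattice in a complement\<close>

definition complement_basis :: "('a::real_vector \<Rightarrow> 'a) \<Rightarrow> 'a set \<Rightarrow> bool" where
  "complement_basis P S \<longleftrightarrow> independent S \<and> span S = {x. P x = 0}"

definition coord :: "('a::real_vector \<Rightarrow> 'a) \<Rightarrow> 'a set \<Rightarrow> 'a \<Rightarrow> 'a \<Rightarrow> real" where
  "coord P S k x = representation S (x - P x) k"

text \<open>For \<open>G\<close> inside the range of \<open>P\<close> and a basis \<open>S\<close> of the kernel this is the sum of \<open>G\<close> and the lattice
  generated by \<open>S\<close> (see \<open>mem_grid\<close>); the description by coordinates makes closedness evident.\<close>

definition grid :: "('a \<Rightarrow> 'a) \<Rightarrow> 'a set \<Rightarrow> 'a::euclidean_space closed_subgroup \<Rightarrow> 'a closed_subgroup" where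
  "grid P S G = Closed_Subgroup {y. P y \<in> elts G \<and> (\<forall>k\<in>S. coord P S k y \<in> \<int>)}"

context
  fixes P :: "'a \<Rightarrow> 'a::euclidean_space" and S :: "'a set"
  assumes P: "projection P" and S: "complement_basis P S"
begin

lemma complement_basisD: "independent S" "finite S" "span S = {x. P x = 0}" "k \<in> S \<Longrightarrow> P k = 0"
proof -
  show "independent S" "span S = {x. P x = 0}" using S by (auto simp: complement_basis_def)
  then show "finite S" "k \<in> S \<Longrightarrow> P k = 0" using finiteI_independent span_base[of k S] by auto
qed

lemma complement_in_span: "x - P x \<in> span S"
  by (simp add: complement_basisD projectionD[OF P])

lemma linear_coord: "linear (coord P S k)"
proof (rule linearI)
  fix x y :: 'a and r :: real
  have "(x + y) - P (x + y) = (x - P x) + (y - P y)" by (simp add: projectionD[OF P])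
  then show "coord P S k (x + y) = coord P S k x + coord P S k y"
    by (simp only: coord_def representation_add[OF complement_basisD(1) complement_in_span complement_in_span])
  have "r *\<^sub>R x - P (r *\<^sub>R x) = r *\<^sub>R (x - P x)" by (simp add: projectionD[OF P] algebra_simps)
  then show "coord P S k (r *\<^sub>R x) = r *\<^sub>R coord P S k x"
    by (simp add: coord_def representation_scale[OF complement_basisD(1) complement_in_span])
qed

lemma coord_expand: "x = P x + (\<Sum>k\<in>S. coord P S k x *\<^sub>R k)"
  using sum_representation_eq[OF complement_basisD(1) complement_in_span[of x] complement_basisD(2) order_refl]
  by (simp add: coord_def)

lemma coord_basis: "k \<in> S \<Longrightarrow> j \<in> S \<Longrightarrow> coord P S j k = (if j = k then 1 else 0)"
  by (simp add: coord_def complement_basisD representation_basis)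

lemma coord_sum:
  assumes "j \<in> S"
  shows "coord P S j (\<Sum>k\<in>S. c k *\<^sub>R k) = c j"
proof -
  have "coord P S j (\<Sum>k\<in>S. c k *\<^sub>R k) = (\<Sum>k\<in>S. c k * coord P S j k)"
    by (simp add: linear_sum[OF linear_coord] linear_cmul[OF linear_coord])
  also have "\<dots> = (\<Sum>k\<in>S. if k = j then c k else 0)"
    using assms by (intro sum.cong) (auto simp: coord_basis)
  finally show ?thesis using assms complement_basisD(2) by simp
qed

lemma coord_complement: "coord P S k (x - P x) = coord P S k x"
  by (simp add: coord_def projectionD[OF P])

lemma coord_range: "P x = x \<Longrightarrow> coord P S k x = 0"
  by (simp add: coord_def representation_zero)

lemma elts_grid: "elts (grid P S G) = {y. P y \<in> elts G \<and> (\<forall>k\<in>S. coord P S k y \<in> \<int>)}"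
  unfolding grid_def
proof (rule Closed_Subgroup_inverse, clarsimp, intro conjI)
  let ?A = "{y. P y \<in> elts G \<and> (\<forall>k\<in>S. coord P S k y \<in> \<int>)}"
  have "continuous_on UNIV P" "\<And>k. continuous_on UNIV (coord P S k)"
    using projectionD(1)[OF P] linear_coord by (auto simp: linear_continuous_on linear_conv_bounded_linear)
  then have "closed (P -` elts G \<inter> (\<Inter>k\<in>S. coord P S k -` \<int>))"
    by (intro closed_Int closed_INT ballI closed_vimage closed_elts closed_Ints)
  moreover have "?A = P -` elts G \<inter> (\<Inter>k\<in>S. coord P S k -` \<int>)" by auto
  ultimately show "closed ?A" by simp
qed (auto simp: projectionD[OF P] additive_subgroupD[OF elts_subgroup] linear_0[OF linear_coord]
    linear_add[OF linear_coord] linear_neg[OF linear_coord])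

lemma mem_grid: "y \<in> elts (grid P S G) \<longleftrightarrow>
    P y \<in> elts G \<and> (\<exists>n :: 'a \<Rightarrow> int. y - P y = (\<Sum>k\<in>S. of_int (n k) *\<^sub>R k))"
proof -
  have "(\<forall>k\<in>S. coord P S k y \<in> \<int>) \<longleftrightarrow> (\<exists>n :: 'a \<Rightarrow> int. y - P y = (\<Sum>k\<in>S. of_int (n k) *\<^sub>R k))"
  proof
    assume int: "\<forall>k\<in>S. coord P S k y \<in> \<int>"
    have "y - P y = (\<Sum>k\<in>S. coord P S k y *\<^sub>R k)" using coord_expand[of y] by (simp add: algebra_simps)
    also have "\<dots> = (\<Sum>k\<in>S. of_int \<lfloor>coord P S k y\<rfloor> *\<^sub>R k)"
      using int by (intro sum.cong) auto
    finally show "\<exists>n :: 'a \<Rightarrow> int. y - P y = (\<Sum>k\<in>S. of_int (n k) *\<^sub>R k)"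
      by (intro exI[of _ "\<lambda>k. \<lfloor>coord P S k y\<rfloor>"])
  next
    assume "\<exists>n :: 'a \<Rightarrow> int. y - P y = (\<Sum>k\<in>S. of_int (n k) *\<^sub>R k)"
    then obtain n :: "'a \<Rightarrow> int" where "y - P y = (\<Sum>k\<in>S. of_int (n k) *\<^sub>R k)" by blast
    then have "coord P S k y = of_int (n k)" if "k \<in> S" for k
      using coord_sum[OF that, of "\<lambda>k. of_int (n k)"] coord_complement[of k y] by simp
    then show "\<forall>k\<in>S. coord P S k y \<in> \<int>" by simp
  qed
  then show ?thesis by (simp add: elts_grid)
qed

lemma grid_separated: "\<exists>e>0. \<forall>G. separated_off_range P e (grid P S G)"
proof -
  have "\<forall>k. \<exists>C>0. \<forall>x. \<bar>coord P S k x\<bar> \<le> C * norm x"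
  proof
    fix k
    obtain C where "C > 0" "\<And>x. norm (coord P S k x) \<le> C * norm x"
      using linear_bounded_pos[OF linear_coord] by blast
    then show "\<exists>C>0. \<forall>x. \<bar>coord P S k x\<bar> \<le> C * norm x" by auto
  qed
  from choice[OF this] obtain C where C: "\<And>k. C k > 0" "\<And>k x. \<bar>coord P S k x\<bar> \<le> C k * norm x" by blast
  define c where "c = (\<Sum>k\<in>S. C k) + 1"
  have c: "c > 0" "\<And>k. k \<in> S \<Longrightarrow> C k \<le> c"
  proof -
    have "(\<Sum>k\<in>S. C k) \<ge> 0" using C(1) by (intro sum_nonneg) (simp add: less_imp_le)
    then show "c > 0" by (simp add: c_def)
    fix k assume "k \<in> S"
    then have "C k \<le> (\<Sum>k\<in>S. C k)" using C(1) by (intro member_le_sum) (auto simp: complement_basisD less_imp_le)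
    then show "C k \<le> c" by (simp add: c_def)
  qed
  have "separated_off_range P (1 / c) (grid P S G)" for G
    unfolding separated_off_range_def
  proof (intro ballI impI)
    fix y assume y: "y \<in> elts (grid P S G)" "norm (y - P y) < 1 / c"
    have "coord P S k y = 0" if "k \<in> S" for k
    proof -
      have "\<bar>coord P S k y\<bar> \<le> C k * norm (y - P y)" using C(2)[of k "y - P y"] by (simp add: coord_complement)
      also have "\<dots> \<le> c * norm (y - P y)" using c(2)[OF that] by (intro mult_right_mono) auto
      also have "\<dots> < 1" using y(2) c(1) by (simp add: field_simps)
      finally have "\<bar>coord P S k y\<bar> < 1" .
      moreover have "coord P S k y \<in> \<int>" using y(1) that by (simp add: elts_grid)
      ultimately show ?thesis by (rule Ints_nonzero_abs_less1[rotated])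
    qed
    then show "P y = y" using coord_expand[of y] by simp
  qed
  then show ?thesis using c(1) by (intro exI[of _ "1 / c"]) auto
qed

lemma subset_grid: "(\<And>x. x \<in> elts G \<Longrightarrow> P x = x) \<Longrightarrow> elts G \<subseteq> elts (grid P S G)"
  by (auto simp: elts_grid coord_range)

lemma spread_0_grid: 
  assumes "\<And>x. x \<in> elts G \<Longrightarrow> P x = x"
  shows "spread P 0 (grid P S G) = G"
proof -
  have "elts (spread P 0 (grid P S G)) = elts G"
    using assms subset_grid[of G] by (auto simp: elts_spread_0[OF P] elts_grid)
  then show ?thesis by (simp add: elts_inject)
qed

lemma cocompact_spread_grid:
  assumes "span (elts G) = range P" "b \<noteq> 0"
  shows "cocompact (elts (spread P b (grid P S G)))"
proof -
  have G: "P x = x" if "x \<in> elts G" for x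
    using assms(1) span_base[OF that] projectionD(2)[OF P] by auto
  have "S \<subseteq> elts (grid P S G)"
    using complement_basisD(4) by (auto simp: elts_grid coord_basis additive_subgroupD[OF elts_subgroup])
  then have S': "span S \<subseteq> span (elts (grid P S G))" by (rule span_mono)
  have "span (elts G) \<subseteq> span (elts (grid P S G))" using G by (intro span_mono subset_grid)
  then have "P x + (x - P x) \<in> span (elts (grid P S G))" for x
    using S' complement_in_span[of x] assms(1) by (intro span_add) auto
  then have "cocompact (elts (grid P S G))" by (auto simp: cocompact_def)
  then show ?thesis
    using assms(2) by (simp add: spread_nonzero[OF P] cocompact_lin_act linear_spread_map[OF P] inj_spread_map[OF P])
qed

lemma continuous_spread_grid: "continuous_on A (\<lambda>b. spread P b (grid P S G))"
proof -
  obtain e where "e > 0" "separated_off_range P e (grid P S G)" using grid_separated by blast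
  then show ?thesis unfolding continuous_on_def
    by (auto intro!: tendsto_spread[OF P] tendsto_eq_intros)
qed

end

lemma elts_range_subgroup:
  assumes "projection (P :: 'a \<Rightarrow> 'a::euclidean_space)"
  shows "elts (closed_hull (range P)) = range P"
proof -
  have "subspace (range P)" using projectionD(1)[OF assms] linear_subspace_image subspace_UNIV by blast
  then show ?thesis
    by (simp add: elts_closed_hull subspace_additive_subgroup closed_subspace closure_closed)
qed

lemma spread_0_eq_range:
  fixes G :: "'a::euclidean_space closed_subgroup"
  assumes P: "projection P" and "\<And>v. P v \<in> elts G"
  shows "spread P 0 G = closed_hull (range P)"
proof -
  have "elts (spread P 0 G) = range P"
    unfolding elts_spread_0[OF P]
  proof safe
    fix x assume "P x = x"
    then show "x \<in> range P" by (rule range_eqI[OF sym])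
  qed (use assms(2) in \<open>auto simp: projectionD[OF P]\<close>)
  then show ?thesis by (simp add: elts_inject[symmetric] elts_range_subgroup[OF P])
qed

text \<open>A cocompact group that contains the range of \<open>P\<close> and is separated from it is determined by its
  intersection with the kernel, which is a discrete group of full rank and so has a basis.\<close>

lemma grid_of_separated:
  fixes G :: "'a::euclidean_space closed_subgroup"
  assumes P: "projection P" and e: "e > 0" "separated_off_range P e G"
    and range: "\<And>v. P v \<in> elts G" and G: "cocompact (elts G)"
  obtains S where "complement_basis P S" "G = grid P S (closed_hull (range P))"
proof -
  note sub = additive_subgroupD[OF elts_subgroup[of G]]
  let ?B = "{y \<in> elts G. P y = 0}"
  have "\<exists>S. independent S \<and> S \<subseteq> ?B \<and> (\<forall>y\<in>?B. \<exists>n :: 'a \<Rightarrow> int. y = (\<Sum>k\<in>S. of_int (n k) *\<^sub>R k))"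
  proof (rule discrete_subgroup_basis[OF _ e(1)])
    show "additive_subgroup ?B" by (auto simp: additive_subgroup_def sub projectionD[OF P])
    show "y = 0" if "y \<in> ?B" "norm y < e" for y
      using that e(2) by (auto simp: separated_off_range_def)
  qed
  then obtain S where S: "independent S" "S \<subseteq> ?B"
      "\<forall>y\<in>?B. \<exists>n :: 'a \<Rightarrow> int. y = (\<Sum>k\<in>S. of_int (n k) *\<^sub>R k)"
    by (elim exE conjE)
  have B_span: "?B \<subseteq> span S"
  proof
    fix y assume "y \<in> ?B"
    from bspec[OF S(3) this] obtain n :: "'a \<Rightarrow> int" where "y = (\<Sum>k\<in>S. of_int (n k) *\<^sub>R k)" by (rule exE)
    then show "y \<in> span S" by (simp add: span_sum span_scale span_base)
  qed
  have lin: "linear (\<lambda>x. x - P x)" using projectionD(1)[OF P] by (intro linear_compose_sub linear_ident)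
  have "span S = {x. P x = 0}"
  proof
    show "span S \<subseteq> {x. P x = 0}"
      using S(2) by (intro span_minimal) (auto simp: subspace_def projectionD[OF P])
    show "{x. P x = 0} \<subseteq> span S"
    proof
      fix x assume x: "x \<in> {x. P x = 0}"
      have "x \<in> (\<lambda>x. x - P x) ` span (elts G)" using G x by (auto simp: cocompact_def intro!: image_eqI[of _ _ x])
      also have "\<dots> = span ((\<lambda>x. x - P x) ` elts G)" by (simp add: linear_span_image[OF lin])
      also have "\<dots> \<subseteq> span S"
        using B_span sub(4) range by (intro span_minimal subspace_span) (auto simp: projectionD[OF P])
      finally show "x \<in> span S" .
    qed
  qed
  then have basis: "complement_basis P S" using S(1) by (simp add: complement_basis_def)
  have "y \<in> elts G \<longleftrightarrow> y \<in> elts (grid P S (closed_hull (range P)))" for y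
  proof
    assume y: "y \<in> elts G"
    then have "y - P y \<in> ?B" using sub(4) range by (simp add: projectionD[OF P])
    then show "y \<in> elts (grid P S (closed_hull (range P)))"
      using S(3) by (simp add: mem_grid[OF P basis] elts_range_subgroup[OF P])
  next
    assume "y \<in> elts (grid P S (closed_hull (range P)))"
    then obtain n :: "'a \<Rightarrow> int" where n: "y - P y = (\<Sum>k\<in>S. of_int (n k) *\<^sub>R k)"
      by (auto simp: mem_grid[OF P basis])
    have "(\<Sum>k\<in>S. of_int (n k) *\<^sub>R k) \<in> elts G"
      using S(2) by (intro additive_subgroup_sum additive_subgroup_of_int elts_subgroup) auto
    then have "P y + (y - P y) \<in> elts G" using range n by (intro sub(2)) auto
    then show "y \<in> elts G" by simp
  qed
  then have "G = grid P S (closed_hull (range P))" by (simp add: elts_inject[symmetric] set_eq_iff)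
  then show ?thesis using that basis by blast
qed

lemma projection_exists:
  fixes W :: "'a::euclidean_space set"
  assumes "subspace W"
  shows "\<exists>P. projection P \<and> range P = W"
proof -
  obtain B where B: "B \<subseteq> W" "independent B" "W \<subseteq> span B"
    using maximal_independent_subset[of W] by blast
  have W: "span B = W" using B assms by (simp add: span_minimal subset_antisym)
  obtain C where C: "B \<subseteq> C" "independent C" "UNIV \<subseteq> span C"
    using maximal_independent_subset_extend[of B UNIV] B(2) by auto
  obtain P where P: "linear P" "\<And>x. x \<in> C \<Longrightarrow> P x = (if x \<in> B then x else 0)"
    using linear_independent_extend[OF C(2), of "\<lambda>x. if x \<in> B then x else 0"] by blast
  have fix_W: "P x = x" if "x \<in> W" for x
  proof (rule linear_eq_on[OF P(1) linear_ident])
    show "x \<in> span B" using that W by simp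
  qed (use P(2) C(1) in auto)
  have "range P = P ` span C" using C(3) by auto
  also have "\<dots> = span (P ` C)" by (simp add: linear_span_image[OF P(1)])
  also have "\<dots> \<subseteq> W" using P(2) B(1) assms by (intro span_minimal) (auto simp: subspace_0)
  finally have "range P \<subseteq> W" .
  moreover have "W \<subseteq> range P" using fix_W by (auto intro: range_eqI[OF sym])
  ultimately show ?thesis using P(1) fix_W unfolding projection_def by blast
qed

lemma complement_basis_exists:
  fixes P :: "'a \<Rightarrow> 'a::euclidean_space"
  assumes "projection P"
  shows "\<exists>S. complement_basis P S"
proof -
  have "subspace {x. P x = 0}" by (auto simp: subspace_def projectionD[OF assms])
  moreover obtain S where "S \<subseteq> {x. P x = 0}" "independent S" "{x. P x = 0} \<subseteq> span S"
    using maximal_independent_subset[of "{x. P x = 0}"] by blast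
  ultimately show ?thesis
    unfolding complement_basis_def by (intro exI[of _ S] conjI subset_antisym span_minimal)
qed

section \<open>Tails\<close>

text \<open>Any fixed choice for every subspace will do. That it depends on nothing but the subspace
  lets \<open>G\<close> and its linear span share their choices.\<close>

definition proj :: "'a set \<Rightarrow> 'a \<Rightarrow> 'a::euclidean_space" where
  "proj W = (SOME P. projection P \<and> range P = W)"

definition cobasis :: "'a::euclidean_space set \<Rightarrow> 'a set" where
  "cobasis W = (SOME S. complement_basis (proj W) S)"

lemma proj: "subspace W \<Longrightarrow> projection (proj W)" "subspace W \<Longrightarrow> range (proj W) = W"
  using someI_ex[OF projection_exists] unfolding proj_def by blast+

lemma cobasis: "subspace W \<Longrightarrow> complement_basis (proj W) (cobasis W)"
  using someI_ex[OF complement_basis_exists] proj(1) unfolding cobasis_def by blast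

text \<open>At parameter 0 the lattice added to \<open>G\<close> is at infinity; at 1 it has arrived.\<close>

definition fill :: "'a::euclidean_space closed_subgroup \<Rightarrow> real \<Rightarrow> 'a closed_subgroup" where
  "fill G b = (let W = span (elts G) in spread (proj W) b (grid (proj W) (cobasis W) G))"

definition radial :: "'a::euclidean_space closed_subgroup \<Rightarrow> real \<Rightarrow> 'a closed_subgroup" where
  "radial G t = shrink (\<lambda>x. x) (1 - t) G"

definition tail :: "'a::euclidean_space closed_subgroup \<Rightarrow> real \<Rightarrow> 'a closed_subgroup" where
  "tail G = fill G +++ radial (fill G 1)"

lemma fill_0 [simp]: "fill G 0 = G"
proof -
  have "proj (span (elts G)) x = x" if "x \<in> elts G" for x
    using that by (intro projection_fixes_range proj) (auto simp: proj span_base)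
  then show ?thesis unfolding fill_def Let_def by (intro spread_0_grid proj cobasis subspace_span)
qed

lemma cocompact_fill: "b \<noteq> 0 \<Longrightarrow> cocompact (elts (fill G b))"
  unfolding fill_def Let_def by (intro cocompact_spread_grid proj cobasis subspace_span) (simp_all add: proj)

lemma path_fill: "path (fill G)"
  unfolding fill_def Let_def path_def by (intro continuous_spread_grid proj cobasis subspace_span)

lemma radial_0 [simp]: "radial G 0 = G"
  by (simp add: radial_def projection_id)

lemma radial_1 [simp]: "radial G 1 = closed_hull UNIV"
  by (simp add: radial_def shrink_id_0)

lemma continuous_radial:
  fixes p :: "real \<Rightarrow> 'a::euclidean_space closed_subgroup"
  assumes p: "continuous_on {0..1} p" and "\<And>t. t \<in> {0..1} \<Longrightarrow> cocompact (elts (p t))"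
  shows "continuous_on ({0..1} \<times> {0..1}) (\<lambda>(t, s). radial (p t) s)"
  unfolding continuous_on_def split_beta radial_def
proof (intro ballI tendsto_shrink_cocompact)
  fix z :: "real \<times> real" assume z: "z \<in> {0..1} \<times> {0..1}"
  show "((\<lambda>z. p (fst z)) \<longlongrightarrow> p (fst z)) (at z within {0..1} \<times> {0..1})"
    using p z by (intro tendsto_fst_of_path) (simp_all add: path_def)
qed (use assms(2) in \<open>auto intro!: tendsto_intros\<close>)

lemma path_radial: "cocompact (elts G) \<Longrightarrow> path (radial G)"
proof -
  assume "cocompact (elts G)"
  then have "continuous_on ({0..1} \<times> {0..1}) (\<lambda>(t::real, s). radial G s)"
    by (intro continuous_radial continuous_on_const)
  then have "continuous_on {0..1} (\<lambda>s. (\<lambda>(t::real, s). radial G s) (0, s))"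
    by (rule continuous_on_compose2) (auto intro!: continuous_intros)
  then show "path (radial G)" by (simp add: path_def)
qed

interpretation tails "tail :: 'a closed_subgroup \<Rightarrow> real \<Rightarrow> 'a::euclidean_space closed_subgroup" "closed_hull UNIV"
proof
  fix G :: "'a closed_subgroup"
  show "path (tail G)" unfolding tail_def
    by (intro path_join_imp path_fill path_radial cocompact_fill) (simp_all add: pathstart_def pathfinish_def)
  show "pathstart (tail G) = G" "pathfinish (tail G) = closed_hull UNIV"
    by (simp_all add: tail_def) (simp_all add: pathstart_def pathfinish_def)
qed

text \<open>The radial paths of the points of \<open>p\<close> fit into a square whose top is constant.\<close>

lemma radial_homotopy:
  fixes p :: "real \<Rightarrow> 'a::euclidean_space closed_subgroup"
  assumes p: "path p" "\<And>t. t \<in> {0..1} \<Longrightarrow> cocompact (elts (p t))"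
  shows "homotopic_paths UNIV (p +++ radial (p 1)) (radial (p 0))"
proof -
  have "homotopic_paths UNIV (p +++ radial (p 1)) (radial (p 0) +++ (\<lambda>_. closed_hull UNIV))"
    using homotopic_paths_square_sides[OF continuous_radial[OF p[unfolded path_def]]] by simp
  also have "homotopic_paths UNIV \<dots> (radial (p 0))"
    using p(2) by (intro homotopic_paths_join_const path_radial) (auto simp: pathfinish_def)
  finally show ?thesis .
qed

lemma tail_homotopic_radial:
  assumes "cocompact (elts G)"
  shows "homotopic_paths UNIV (tail G) (radial G)"
proof -
  have "cocompact (elts (fill G t))" for t using assms cocompact_fill[of t G] by (cases "t = 0") auto
  then show ?thesis using radial_homotopy[OF path_fill, of G] by (simp add: tail_def)
qed

lemma tame_if_radial:
  assumes "path p" "cocompact (elts (p 1))"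
    and "homotopic_paths UNIV (p +++ radial (p 1)) (tail (p 0))"
  shows "tame p"
proof -
  have "homotopic_paths UNIV (p +++ tail (p 1)) (p +++ radial (p 1))"
    using assms by (intro homotopic_paths_join tail_homotopic_radial) (simp_all add: tail_start pathfinish_def)
  then show ?thesis using assms(1) homotopic_paths_trans[OF _ assms(3)]
    by (simp add: tame_def pathstart_def pathfinish_def)
qed

lemma tame_cocompact:
  assumes p: "path p" "\<And>t. t \<in> {0..1} \<Longrightarrow> cocompact (elts (p t))"
  shows "tame p"
proof (rule tame_if_radial)
  show "homotopic_paths UNIV (p +++ radial (p 1)) (tail (p 0))"
    using p(2)
    by (intro homotopic_paths_trans[OF radial_homotopy[OF p]] homotopic_paths_sym[OF tail_homotopic_radial]) auto
qed (use p in auto)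

lemma tame_fill: "tame (fill G)"
proof (rule tame_if_radial)
  show "homotopic_paths UNIV (fill G +++ radial (fill G 1)) (tail (fill G 0))"
    using path_tail[of G] by (simp add: tail_def)
qed (simp_all add: path_fill cocompact_fill)

section \<open>Changing the lattice\<close>

lemma lin_act_compose:
  fixes f g :: "'a \<Rightarrow> 'a::euclidean_space"
  assumes "linear g" "inj g"
  shows "lin_act f (lin_act g G) = lin_act (f \<circ> g) G"
  unfolding lin_act_def[of f] lin_act_def[of "f \<circ> g"] by (simp only: elts_lin_act assms image_comp)

context
  fixes P :: "'a \<Rightarrow> 'a::euclidean_space" and S :: "'a set" and x y :: 'a
  assumes P: "projection P" and S: "complement_basis P S" and x: "x \<in> S" and y: "P y = 0" "coord P S x y \<noteq> 0"
begin

text \<open>For \<open>u\<close> from 0 to 1 the basis vector \<open>x\<close> moves on a segment to \<open>y\<close> or \<open>- y\<close>, while the other basis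
  vectors and the range of \<open>P\<close> stay fixed. The sign makes the coordinate of the moving vector along
  \<open>x\<close> positive throughout, so that the map remains injective, and it does not affect the lattice in
  the end.\<close>

definition exchange :: "real \<Rightarrow> 'a \<Rightarrow> 'a" where
  "exchange u w = w + (u * coord P S x w) *\<^sub>R (sgn (coord P S x y) *\<^sub>R y - x)"

lemma linear_exchange: "linear (exchange u)"
  unfolding exchange_def
  by (rule linearI) (auto simp: linear_add[OF linear_coord[OF P S]] linear_cmul[OF linear_coord[OF P S]] algebra_simps)

lemma P_exchange: "P (exchange u w) = P w"
  using y(1) complement_basisD(4)[OF P S x] by (simp add: exchange_def projectionD[OF P])

lemma exchange_P: "exchange u (P w) = P w"
  by (simp add: exchange_def coord_range[OF P S] projectionD[OF P])

lemma inj_exchange: assumes u: "u \<in> {0..1}" shows "inj (exchange u)"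
proof (subst linear_injective_0[OF linear_exchange], intro allI impI)
  fix w assume w: "exchange u w = 0"
  let ?c = "coord P S x"
  have "?c (exchange u w) = ?c w * (1 - u + u * \<bar>?c y\<bar>)"
    using x by (simp add: exchange_def linear_add[OF linear_coord[OF P S]] linear_diff[OF linear_coord[OF P S]]
      linear_cmul[OF linear_coord[OF P S]] coord_basis[OF P S] algebra_simps abs_sgn)
  then have "?c w * (1 - u + u * \<bar>?c y\<bar>) = 0" using w linear_0[OF linear_coord[OF P S]] by simp
  moreover have "1 - u + u * \<bar>?c y\<bar> > 0"
    using u y(2) by (cases "u = 1") (auto intro: add_pos_nonneg)
  ultimately have "?c w = 0" by simp
  then show "w = 0" using w by (simp add: exchange_def)
qed

lemma new_vector_notin: "y \<notin> S - {x}"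
  using y(2) coord_basis[OF P S, of y x] x by (auto split: if_splits)

lemma complement_basis_exchange: "complement_basis P (insert y (S - {x}))"
proof -
  note facts = complement_basisD[OF P S]
  have zero: "coord P S x w = 0" if "w \<in> span (S - {x})" for w
    by (rule linear_eq_0_on_span[OF linear_coord[OF P S] _ that]) (use x in \<open>auto simp: coord_basis[OF P S]\<close>)
  have ind: "independent (insert y (S - {x}))"
    using zero[of y] y(2) by (intro independent_insertI independent_mono[OF facts(1)] Diff_subset) auto
  have sub: "insert y (S - {x}) \<subseteq> {x. P x = 0}" using facts(4) y(1) by auto
  have "dim {x. P x = 0} = card S" by (simp only: facts(3)[symmetric] dim_span dim_eq_card_independent[OF facts(1)])
  also have "\<dots> = card (insert y (S - {x}))"
    using new_vector_notin facts(2) card.remove[OF facts(2) x] by simp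
  finally have "{x. P x = 0} \<subseteq> span (insert y (S - {x}))"
    using sub ind by (intro card_ge_dim_independent) auto
  moreover have "span (insert y (S - {x})) \<subseteq> {x. P x = 0}"
    using span_mono[OF sub] by (simp only: facts(3)[symmetric] span_span)
  ultimately have "span (insert y (S - {x})) = {x. P x = 0}" by (rule subset_antisym[rotated])
  then show ?thesis using ind by (simp add: complement_basis_def)
qed

lemma exchange_grid:
  "lin_act (exchange 1) (grid P S G) = grid P (insert y (S - {x})) G"
proof -
  let ?S = "insert y (S - {x})" and ?c = "coord P S x"
  let ?e = "if ?c y > 0 then 1 else - 1 :: int"
  have e: "sgn (?c y) = of_int ?e" "?e * ?e = 1" using y(2) by (auto simp: sgn_if)
  note facts = complement_basisD[OF P S]
  have fin: "finite (S - {x})" using facts(2) by simp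
  have key: "exchange 1 w - P (exchange 1 w) = (\<Sum>k\<in>?S. of_int ((n(y := ?e * n x)) k) *\<^sub>R k)"
    if w: "w - P w = (\<Sum>k\<in>S. of_int (n k) *\<^sub>R k)" for w and n :: "'a \<Rightarrow> int"
  proof -
    have c: "?c w = of_int (n x)"
      using coord_sum[OF P S x, of "\<lambda>k. of_int (n k)"] coord_complement[OF P S, of x w] w by simp
    have "w - P w = of_int (n x) *\<^sub>R x + (\<Sum>k\<in>S - {x}. of_int (n k) *\<^sub>R k)"
      unfolding w using sum.remove[OF facts(2) x] by simp
    then have "exchange 1 w - P (exchange 1 w) = of_int (?e * n x) *\<^sub>R y + (\<Sum>k\<in>S - {x}. of_int (n k) *\<^sub>R k)"
      unfolding P_exchange by (simp add: exchange_def c e(1) algebra_simps)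
    also have "(\<Sum>k\<in>S - {x}. of_int (n k) *\<^sub>R k) = (\<Sum>k\<in>S - {x}. of_int ((n(y := ?e * n x)) k) *\<^sub>R k)"
      using new_vector_notin by (intro sum.cong) auto
    finally show ?thesis using new_vector_notin fin by simp
  qed
  have "z \<in> exchange 1 ` elts (grid P S G) \<longleftrightarrow> z \<in> elts (grid P ?S G)" for z
  proof
    assume "z \<in> exchange 1 ` elts (grid P S G)"
    then obtain w n where w: "z = exchange 1 w" "P w \<in> elts G" "w - P w = (\<Sum>k\<in>S. of_int ((n :: 'a \<Rightarrow> int) k) *\<^sub>R k)"
      by (auto simp: mem_grid[OF P S])
    then show "z \<in> elts (grid P ?S G)"
      using key[OF w(3)] unfolding mem_grid[OF P complement_basis_exchange] w(1)
      by (intro conjI exI) (simp_all only: P_exchange w(2))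
  next
    assume "z \<in> elts (grid P ?S G)"
    then obtain n :: "'a \<Rightarrow> int" where n: "P z \<in> elts G" "z - P z = (\<Sum>k\<in>?S. of_int (n k) *\<^sub>R k)"
      by (auto simp: mem_grid[OF P complement_basis_exchange])
    define m where "m = n(x := ?e * n y)"
    define w where "w = P z + (\<Sum>k\<in>S. of_int (m k) *\<^sub>R k)"
    have "P (\<Sum>k\<in>S. of_int (m k) *\<^sub>R k) = 0"
      using facts(4) by (simp add: linear_sum[OF projectionD(1)[OF P]] projectionD[OF P])
    then have w: "P w = P z" "w - P w = (\<Sum>k\<in>S. of_int (m k) *\<^sub>R k)"
      by (simp_all add: w_def projectionD[OF P])
    have "?e * m x = n y" using e(2) by (simp add: m_def mult.assoc[symmetric])
    then have "(\<Sum>k\<in>?S. of_int ((m(y := ?e * m x)) k) *\<^sub>R k) = (\<Sum>k\<in>?S. of_int (n k) *\<^sub>R k)"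
      using new_vector_notin by (intro sum.cong) (auto simp: m_def)
    then have "exchange 1 w - P (exchange 1 w) = z - P z" using key[OF w(2)] n(2) by simp
    then have "z = exchange 1 w" by (simp add: P_exchange w(1))
    moreover have "w \<in> elts (grid P S G)"
      using w(2) n(1) unfolding mem_grid[OF P S] w(1) by blast
    ultimately show "z \<in> exchange 1 ` elts (grid P S G)" by blast
  qed
  then have "elts (lin_act (exchange 1) (grid P S G)) = elts (grid P ?S G)"
    by (auto simp: elts_lin_act[OF linear_exchange inj_exchange])
  then show ?thesis by (simp add: elts_inject)
qed

lemma exchange_range: 
  assumes "u \<in> {0..1}"
  shows "lin_act (exchange u) (closed_hull (range P)) = closed_hull (range P)"
proof -
  have "exchange u ` range P = range P" by (auto simp: exchange_P image_image)
  then show ?thesis by (simp add: lin_act_def elts_range_subgroup[OF P])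
qed

lemma exchange_spread:
  assumes "u \<in> {0..1}" "b \<noteq> 0"
  shows "lin_act (exchange u) (spread P b G) = spread P b (lin_act (exchange u) G)"
proof -
  have "exchange u (P w + (1 / b) *\<^sub>R (w - P w)) = P (exchange u w) + (1 / b) *\<^sub>R (exchange u w - P (exchange u w))" for w
    by (simp add: linear_add[OF linear_exchange] linear_cmul[OF linear_exchange] linear_diff[OF linear_exchange]
        exchange_P P_exchange)
  then have "exchange u \<circ> (\<lambda>w. P w + (1 / b) *\<^sub>R (w - P w)) = (\<lambda>w. P w + (1 / b) *\<^sub>R (w - P w)) \<circ> exchange u"
    by (simp add: fun_eq_iff)
  then show ?thesis
    using assms by (simp add: spread_nonzero[OF P] lin_act_compose linear_spread_map[OF P] inj_spread_map[OF P]
      linear_exchange inj_exchange)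
qed

text \<open>Applying the exchange to the whole path gives a square: its side at the limit group is
  constant, because the exchange fixes the range, and the opposite side is cocompact.\<close>

lemma tame_exchange:
  assumes "tame (\<lambda>b. spread P b (grid P S (closed_hull (range P))))"
  shows "tame (\<lambda>b. spread P b (grid P (insert y (S - {x})) (closed_hull (range P))))"
proof -
  let ?L = "closed_hull (range P)"
  let ?th = "\<lambda>b. spread P b (grid P S ?L)"
  let ?H = "\<lambda>z. lin_act (exchange (1 - snd z)) (?th (fst z))"
  have L: "P v = v" if "v \<in> elts ?L" for v
    using that unfolding elts_range_subgroup[OF P] by (rule projection_fixes_range[OF P])
  have "subspace (range P)" by (intro linear_subspace_image projectionD(1)[OF P] subspace_UNIV)
  then have span_L: "span (elts ?L) = range P" by (simp add: elts_range_subgroup[OF P] span_eq_iff)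
  have cont: "continuous_on ({0..1} \<times> {0..1}) ?H"
    unfolding continuous_on_def
  proof (rule ballI, rule tendsto_lin_act)
    fix z :: "real \<times> real" assume z: "z \<in> {0..1} \<times> {0..1}"
    have "path ?th" unfolding path_def by (rule continuous_spread_grid[OF P S])
    then show "((\<lambda>z. ?th (fst z)) \<longlongrightarrow> ?th (fst z)) (at z within {0..1} \<times> {0..1})"
      using z by (rule tendsto_fst_of_path)
    show "inj (exchange (1 - snd z))" using z by (intro inj_exchange) auto
    show "((\<lambda>z. exchange (1 - snd z) v) \<longlongrightarrow> exchange (1 - snd z) v) (at z within {0..1} \<times> {0..1})" for v
      unfolding exchange_def by (intro tendsto_intros)
  qed (simp_all add: linear_exchange)
  have const: "?H (0, t) = ?L" if "t \<in> {0..1}" for t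
    using that L by (simp add: spread_0_grid[OF P S] exchange_range)
  have left: "tame (\<lambda>t. ?H (0, t))"
  proof (rule tame_homotopic[OF tame_const[of ?L]], rule homotopic_paths_eq)
    show "?L = ?H (0, t)" if "t \<in> {0..1}" for t by (rule const[OF that, symmetric])
  qed (simp_all add: path_const)
  have "exchange 0 = (\<lambda>w. w)" by (simp add: exchange_def fun_eq_iff)
  then have top: "tame (\<lambda>t. ?H (t, 1))" using assms by (simp add: lin_act_def closed_hull_elts)
  have right: "tame (\<lambda>t. ?H (1, t))"
  proof (rule tame_cocompact)
    have "continuous_on {0..1} (\<lambda>t. ?H (1, t))"
      by (rule continuous_on_compose2[OF cont]) (auto intro!: continuous_intros)
    then show "path (\<lambda>t. ?H (1, t))" by (simp add: path_def)
    show "cocompact (elts (?H (1, t)))" if "t \<in> {0..1}" for t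
      using that span_L cocompact_spread_grid[OF P S, of ?L 1]
      by (intro cocompact_lin_act linear_exchange inj_exchange) auto
  qed
  have "tame (\<lambda>t. ?H (t, 0))" by (rule tame_square[OF cont left top right])
  moreover have "?H (t, 0) = spread P t (grid P (insert y (S - {x})) ?L)" for t
  proof (cases "t = 0")
    case True
    then show ?thesis
      using L by (simp add: spread_0_grid[OF P S] spread_0_grid[OF P complement_basis_exchange] exchange_range)
  qed (simp add: exchange_spread exchange_grid)
  ultimately show ?thesis by simp
qed

end

text \<open>The tail of \<open>W\<close> itself begins with such a path for one particular basis. Steinitz exchange
  leads from there to any other basis.\<close>

lemma tame_spread_lattice:
  fixes W :: "'a::euclidean_space set"
  assumes W: "subspace W" and S: "complement_basis (proj W) S"
  shows "tame (\<lambda>b. spread (proj W) b (grid (proj W) S (closed_hull W)))"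
proof -
  let ?P = "proj W"
  note P = proj(1)[OF W]
  let ?tame = "\<lambda>S. tame (\<lambda>b. spread ?P b (grid ?P S (closed_hull (range ?P))))"
  have step: "?tame T" if "complement_basis ?P T" "complement_basis ?P S" "?tame S" for S T
    using that(2,3)
  proof (induction "card (T - S)" arbitrary: S rule: less_induct)
    case less
    note S = less.prems(1) and T = that(1)
    note fS = complement_basisD[OF P S] and fT = complement_basisD[OF P T]
    show ?case
    proof (cases "T \<subseteq> S")
      case True
      then have "T = S"
        using card_subset_eq[OF fS(2)] dim_eq_card_independent[OF fS(1)] dim_eq_card_independent[OF fT(1)]
          fS(3) fT(3) dim_span[of S] dim_span[of T] by simp
      then show ?thesis using less.prems(2) by simp
    next
      case False
      then obtain y where y: "y \<in> T" "y \<notin> S" by blast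
      have Py: "?P y = 0" using fT(4) y by blast
      have "\<exists>x\<in>S - T. coord ?P S x y \<noteq> 0"
      proof (rule ccontr)
        assume "\<not> (\<exists>x\<in>S - T. coord ?P S x y \<noteq> 0)"
        then have zero: "\<forall>x\<in>S - T. coord ?P S x y = 0" by blast
        have "coord ?P S k y *\<^sub>R k \<in> span (T - {y})" if "k \<in> S" for k
        proof (cases "k \<in> T")
          case True
          then have "k \<in> T - {y}" using y(2) that by blast
          then show ?thesis by (intro span_scale span_base)
        qed (use zero that in \<open>simp add: span_zero\<close>)
        then have "(\<Sum>k\<in>S. coord ?P S k y *\<^sub>R k) \<in> span (T - {y})"
          by (intro span_sum)
        then have "y \<in> span (T - {y})" using coord_expand[OF P S, of y] Py by simp
        then show False using fT(1) y(1) dependent_def by blast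
      qed
      then obtain x where x: "x \<in> S" "x \<notin> T" "coord ?P S x y \<noteq> 0" by blast
      have "T - insert y (S - {x}) \<subset> T - S" using x y by auto
      then have "card (T - insert y (S - {x})) < card (T - S)" using fT(2) by (intro psubset_card_mono) auto
      then show ?thesis
        using less.hyps complement_basis_exchange[OF P S x(1) Py x(3)]
          tame_exchange[OF P S x(1) Py x(3) less.prems(2)] by blast
    qed
  qed
  have "?tame (cobasis W)"
  proof -
    have "span W = W" using W by simp
    moreover have "elts (closed_hull W) = W" using elts_range_subgroup[OF P] by (simp only: proj(2)[OF W])
    ultimately have "fill (closed_hull W) = (\<lambda>b. spread ?P b (grid ?P (cobasis W) (closed_hull (range ?P))))"
      by (intro ext) (simp only: fill_def Let_def proj(2)[OF W])
    then show ?thesis using tame_fill[of "closed_hull W"] by simp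
  qed
  then show ?thesis using step[OF S cobasis[OF W]] by (simp add: proj(2)[OF W])
qed

section \<open>Straightening nearby subgroups\<close>

lemma representation_bound:
  fixes P :: "'a \<Rightarrow> 'a::euclidean_space"
  assumes P: "projection P" and \<beta>: "finite \<beta>" "independent \<beta>" "span \<beta> = range P"
  obtains C where "C > 0" "\<And>v. (\<Sum>x\<in>\<beta>. \<bar>representation \<beta> (P v) x\<bar>) \<le> C * norm v"
proof -
  have in_span: "P v \<in> span \<beta>" for v by (simp add: \<beta>(3))
  have "\<forall>x. \<exists>C. C > 0 \<and> (\<forall>v. \<bar>representation \<beta> (P v) x\<bar> \<le> C * norm v)"
  proof
    fix x
    have "linear (\<lambda>v. representation \<beta> (P v) x)"
      by (rule linearI) (simp_all add: projectionD[OF P] representation_add[OF \<beta>(2) in_span in_span]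
        representation_scale[OF \<beta>(2) in_span])
    then show "\<exists>C. C > 0 \<and> (\<forall>v. \<bar>representation \<beta> (P v) x\<bar> \<le> C * norm v)"
      using linear_bounded_pos[of "\<lambda>v. representation \<beta> (P v) x"] by auto
  qed
  from choice[OF this] obtain C where C: "\<And>x. C x > 0" "\<And>x v. \<bar>representation \<beta> (P v) x\<bar> \<le> C x * norm v"
    by blast
  show ?thesis
  proof (rule that[of "(\<Sum>x\<in>\<beta>. C x) + 1"])
    have "(\<Sum>x\<in>\<beta>. C x) \<ge> 0" using C(1) by (intro sum_nonneg) (simp add: less_imp_le)
    then show "(\<Sum>x\<in>\<beta>. C x) + 1 > 0" by simp
    fix v
    have "(\<Sum>x\<in>\<beta>. \<bar>representation \<beta> (P v) x\<bar>) \<le> (\<Sum>x\<in>\<beta>. C x * norm v)" by (intro sum_mono C)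
    also have "\<dots> = (\<Sum>x\<in>\<beta>. C x) * norm v" by (simp add: sum_distrib_right)
    also have "\<dots> \<le> ((\<Sum>x\<in>\<beta>. C x) + 1) * norm v" by (intro mult_right_mono) auto
    finally show "(\<Sum>x\<in>\<beta>. \<bar>representation \<beta> (P v) x\<bar>) \<le> ((\<Sum>x\<in>\<beta>. C x) + 1) * norm v" .
  qed
qed

text \<open>The range of \<open>P\<close> is the span of a subgroup of which \<open>\<beta>\<close> is a maximal independent subset. The
  constants \<open>C\<close> and \<open>K\<close> bound the coordinates with respect to \<open>\<beta>\<close> and the component along the kernel;
  \<open>\<epsilon>\<close> is the tolerance with which the elements of nearby groups follow \<open>\<beta>\<close>.\<close>

locale straightening =
  fixes P :: "'a \<Rightarrow> 'a::euclidean_space" and \<beta> :: "'a set" and C K \<epsilon> :: real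
  assumes P: "projection P" and fin: "finite \<beta>" and ind: "independent \<beta>" and span_\<beta>: "span \<beta> = range P"
    and C: "C > 0" "\<And>v. (\<Sum>x\<in>\<beta>. \<bar>representation \<beta> (P v) x\<bar>) \<le> C * norm v"
    and K: "K > 0" "\<And>v. norm (v - P v) \<le> K * norm v"
    and \<epsilon>: "\<epsilon> > 0" "C * \<epsilon> \<le> 1/2" "K * (C * \<epsilon> * ((\<Sum>x\<in>\<beta>. norm x) + 2)) \<le> 1/2" "4 * K * \<epsilon> < 1"
begin

definition "\<rho> = (\<Sum>x\<in>\<beta>. norm x)"

text \<open>The radius leaves room for a vector whose component in the range is reduced modulo the lattice
  of \<open>\<beta>\<close>, hence has size at most \<open>\<rho>\<close>, whose other component is at most 2, and which is then
  distorted by a factor at most 2.\<close>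

definition close_groups :: "'a closed_subgroup set" where
  "close_groups = {G. (\<forall>x\<in>\<beta>. \<exists>x'\<in>elts G. norm (x' - x) < \<epsilon>) \<and>
    (\<forall>y\<in>elts G. norm y \<le> 2 * (\<rho> + 2) \<longrightarrow> norm (y - P y) < 1/2)}"

definition follows :: "'a closed_subgroup \<Rightarrow> ('a \<Rightarrow> 'a) \<Rightarrow> bool" where
  "follows G \<xi> \<longleftrightarrow> (\<forall>x\<in>\<beta>. \<xi> x \<in> elts G \<and> norm (\<xi> x - x) < \<epsilon>)"

text \<open>The linear map that sends every \<open>x\<close> in \<open>\<beta>\<close> to \<open>\<xi> x\<close> and is the identity on the kernel of \<open>P\<close>.\<close>

definition move :: "('a \<Rightarrow> 'a) \<Rightarrow> 'a \<Rightarrow> 'a" where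
  "move \<xi> v = v + (\<Sum>x\<in>\<beta>. representation \<beta> (P v) x *\<^sub>R (\<xi> x - x))"

lemma P_in_span: "P v \<in> span \<beta>"
  by (simp add: span_\<beta>)

lemma P_fixes: "v \<in> span \<beta> \<Longrightarrow> P v = v"
  unfolding span_\<beta> by (rule projection_fixes_range[OF P])

lemma linear_move: "linear (move \<xi>)"
proof (rule linearI)
  fix v w :: 'a and r :: real
  show "move \<xi> (v + w) = move \<xi> v + move \<xi> w"
    unfolding move_def projectionD(3)[OF P] representation_add[OF ind P_in_span P_in_span]
      scaleR_add_left sum.distrib by (simp only: ac_simps)
  show "move \<xi> (r *\<^sub>R v) = r *\<^sub>R move \<xi> v"
    unfolding move_def projectionD(5)[OF P] representation_scale[OF ind P_in_span]
    by (simp only: scaleR_add_right scaleR_sum_right scaleR_scaleR)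
qed

lemma move_basis: assumes x: "x \<in> \<beta>" shows "move \<xi> x = \<xi> x"
proof -
  have "(\<Sum>y\<in>\<beta>. representation \<beta> (P x) y *\<^sub>R (\<xi> y - y)) = (\<Sum>y\<in>\<beta>. if y = x then \<xi> y - y else 0)"
    using x by (intro sum.cong) (auto simp: P_fixes span_base representation_basis[OF ind])
  then show ?thesis using x fin by (simp add: move_def)
qed

lemma move_kernel: "P v = 0 \<Longrightarrow> move \<xi> v = v"
  by (simp add: move_def representation_zero)

lemma move_diff:
  assumes "\<And>x. x \<in> \<beta> \<Longrightarrow> norm (\<xi> x - \<zeta> x) \<le> d" and d: "d \<ge> 0"
  shows "norm (move \<xi> v - move \<zeta> v) \<le> C * d * norm v"
proof -
  have "move \<xi> v - move \<zeta> v = (\<Sum>x\<in>\<beta>. representation \<beta> (P v) x *\<^sub>R (\<xi> x - \<zeta> x))"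
    by (simp add: move_def sum_subtractf[symmetric] algebra_simps)
  also have "norm \<dots> \<le> (\<Sum>x\<in>\<beta>. \<bar>representation \<beta> (P v) x\<bar> * d)"
    using assms by (intro sum_norm_le) (auto intro!: mult_left_mono)
  also have "\<dots> = (\<Sum>x\<in>\<beta>. \<bar>representation \<beta> (P v) x\<bar>) * d" by (simp add: sum_distrib_right)
  also have "\<dots> \<le> C * norm v * d" by (intro mult_right_mono C d)
  finally show ?thesis by (simp add: mult_ac)
qed

lemma move_near:
  assumes "follows G \<xi>"
  shows "norm (move \<xi> v - v) \<le> C * \<epsilon> * norm v"
proof -
  have "move (\<lambda>x. x) v = v" by (simp add: move_def)
  moreover have "norm (move \<xi> v - move (\<lambda>x. x) v) \<le> C * \<epsilon> * norm v"
    using assms \<epsilon>(1) by (intro move_diff) (auto simp: follows_def less_imp_le)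
  ultimately show ?thesis by simp
qed

lemma move_lower: "follows G \<xi> \<Longrightarrow> norm v \<le> 2 * norm (move \<xi> v)"
proof -
  assume "follows G \<xi>"
  then have "norm (move \<xi> v - v) \<le> C * \<epsilon> * norm v" by (rule move_near)
  also have "\<dots> \<le> 1/2 * norm v" using \<epsilon>(2) by (intro mult_right_mono) auto
  finally show ?thesis using norm_triangle_ineq2[of v "move \<xi> v"] by (simp add: norm_minus_commute)
qed

lemma inj_move: "follows G \<xi> \<Longrightarrow> inj (move \<xi>)"
proof (subst linear_injective_0[OF linear_move], intro allI impI)
  fix v assume "follows G \<xi>" "move \<xi> v = 0"
  then show "v = 0" using move_lower[of G \<xi> v] by simp
qed

definition unmove :: "('a \<Rightarrow> 'a) \<Rightarrow> 'a \<Rightarrow> 'a" where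
  "unmove \<xi> = inv (move \<xi>)"

context
  fixes G \<xi> assumes follows: "follows G \<xi>"
begin

lemma unmove_move: "unmove \<xi> (move \<xi> v) = v"
  unfolding unmove_def by (rule inv_f_f[OF inj_move[OF follows]])

lemma move_unmove: "move \<xi> (unmove \<xi> v) = v"
  unfolding unmove_def
  using linear_inj_imp_surj[OF linear_move inj_move[OF follows]] by (rule surj_f_inv_f)

lemma linear_unmove: "linear (unmove \<xi>)"
proof (rule linearI)
  show "unmove \<xi> (v + w) = unmove \<xi> v + unmove \<xi> w" for v w
    using unmove_move[of "unmove \<xi> v + unmove \<xi> w"] by (simp add: linear_add[OF linear_move] move_unmove)
  show "unmove \<xi> (r *\<^sub>R v) = r *\<^sub>R unmove \<xi> v" for r v
    using unmove_move[of "r *\<^sub>R unmove \<xi> v"] by (simp add: linear_cmul[OF linear_move] move_unmove)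
qed

lemma unmove_bound: "norm (unmove \<xi> v) \<le> 2 * norm v"
  using move_lower[OF follows, of "unmove \<xi> v"] by (simp add: move_unmove)

lemma unmove_basis: "x \<in> \<beta> \<Longrightarrow> unmove \<xi> (\<xi> x) = x"
  using unmove_move[of x] move_basis[of x \<xi>] by simp

lemma unmove_kernel: "P v = 0 \<Longrightarrow> unmove \<xi> v = v"
  using unmove_move[of v] move_kernel[of v \<xi>] by simp

text \<open>The rigidity that makes everything else work. A small but nonzero component \<open>k\<close> off the range has a
  multiple of size between 1 and 2. The corresponding multiple of \<open>y\<close>, reduced modulo the elements that
  follow \<open>\<beta>\<close>, is an element of \<open>G\<close> in the controlled ball whose component off the
  range has size at least 1/2.\<close>

lemma unmove_snaps:
  assumes G: "G \<in> close_groups" and y: "y \<in> elts G"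
    and small: "norm (unmove \<xi> y - P (unmove \<xi> y)) < 1"
  shows "P (unmove \<xi> y) = unmove \<xi> y"
proof (rule ccontr)
  define z where "z = unmove \<xi> y"
  define k where "k = z - P z"
  assume "\<not> ?thesis"
  then have k: "norm k > 0" "norm k < 1" using small by (auto simp: k_def z_def)
  \<comment> \<open>the least multiple of \<open>k\<close> of norm at least 1\<close>
  define m where "m = \<lceil>1 / norm k\<rceil>"
  have m: "1 \<le> of_int m * norm k" "of_int m * norm k < 2"
  proof -
    have "1 / norm k \<le> of_int m" by (simp add: m_def)
    then show "1 \<le> of_int m * norm k" using k(1) by (simp add: divide_le_eq)
    have "of_int m < 1 / norm k + 1" unfolding m_def by linarith
    then have "of_int m * norm k < (1 / norm k + 1) * norm k" using k(1) by (intro mult_strict_right_mono)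
    also have "\<dots> = 1 + norm k" using k(1) by (simp add: field_simps)
    finally show "of_int m * norm k < 2" using k(2) by simp
  qed
  have "of_int m *\<^sub>R P z \<in> span \<beta>" by (intro span_scale P_in_span)
  then obtain c where c: "of_int m *\<^sub>R P z = (\<Sum>x\<in>\<beta>. c x *\<^sub>R x)" using fin by (auto simp: span_finite)
  define b where "b = (\<Sum>x\<in>\<beta>. of_int \<lfloor>c x\<rfloor> *\<^sub>R x)"
  have "b \<in> span \<beta>" unfolding b_def by (intro span_sum span_scale span_base)
  then have Pb: "P b = b" by (rule P_fixes)
  \<comment> \<open>the multiple, reduced modulo the lattice of \<open>\<beta>\<close>\<close>
  define w where "w = of_int m *\<^sub>R z - b"
  have w_k: "w - P w = of_int m *\<^sub>R k" by (simp add: w_def k_def projectionD[OF P] Pb algebra_simps)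
  have "P w = (\<Sum>x\<in>\<beta>. (c x - of_int \<lfloor>c x\<rfloor>) *\<^sub>R x)"
    by (simp add: w_def projectionD[OF P] Pb c) (simp add: b_def sum_subtractf algebra_simps)
  also have "norm \<dots> \<le> \<rho>" unfolding \<rho>_def
  proof (intro sum_norm_le)
    fix x
    have "\<bar>c x - of_int \<lfloor>c x\<rfloor>\<bar> \<le> 1" by linarith
    then show "norm ((c x - of_int \<lfloor>c x\<rfloor>) *\<^sub>R x) \<le> norm x" by (simp add: mult_left_le_one_le)
  qed
  finally have "norm (P w) \<le> \<rho>" .
  moreover have "m \<ge> 0"
  proof (rule ccontr)
    assume "\<not> m \<ge> 0"
    then have "of_int m * norm k \<le> 0" by (intro mult_nonpos_nonneg) auto
    then show False using m(1) by simp
  qed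
  then have nk: "norm (w - P w) = of_int m * norm k" by (simp add: w_k)
  ultimately have w_norm: "norm w \<le> \<rho> + 2"
    using m(2) norm_triangle_ineq[of "P w" "w - P w"] by simp
  have "move \<xi> w = of_int m *\<^sub>R y - (\<Sum>x\<in>\<beta>. of_int \<lfloor>c x\<rfloor> *\<^sub>R \<xi> x)"
    by (simp add: w_def b_def z_def linear_diff[OF linear_move] linear_cmul[OF linear_move]
      linear_sum[OF linear_move] move_unmove move_basis)
  moreover have "(\<Sum>x\<in>\<beta>. of_int \<lfloor>c x\<rfloor> *\<^sub>R \<xi> x) \<in> elts G"
    using follows by (intro additive_subgroup_sum additive_subgroup_of_int elts_subgroup) (auto simp: follows_def)
  ultimately have in_G: "move \<xi> w \<in> elts G"
    using y by (simp add: additive_subgroupD[OF elts_subgroup] additive_subgroup_of_int[OF elts_subgroup])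
  have near: "norm (move \<xi> w - w) \<le> C * \<epsilon> * (\<rho> + 2)"
    using move_near[OF follows, of w] w_norm C(1) \<epsilon>(1)
    by (meson mult_left_mono order_trans mult_nonneg_nonneg less_imp_le)
  have "norm (move \<xi> w) \<le> norm w + norm (move \<xi> w - w)"
    using norm_triangle_ineq[of w "move \<xi> w - w"] by simp
  also have "\<dots> \<le> norm w + C * \<epsilon> * norm w" using move_near[OF follows, of w] by simp
  also have "\<dots> \<le> norm w + 1/2 * norm w" using \<epsilon>(2) by (intro add_left_mono mult_right_mono) auto
  also have "\<dots> \<le> 2 * norm w" by simp
  also have "\<dots> \<le> 2 * (\<rho> + 2)" using w_norm by simp
  finally have upper: "norm (move \<xi> w - P (move \<xi> w)) < 1/2"
    using G in_G by (auto simp: close_groups_def)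
  have "norm ((w - P w) - (move \<xi> w - P (move \<xi> w))) = norm ((w - move \<xi> w) - P (w - move \<xi> w))"
    by (simp add: projectionD[OF P] algebra_simps)
  also have "\<dots> \<le> K * norm (w - move \<xi> w)" by (rule K)
  also have "\<dots> \<le> K * (C * \<epsilon> * (\<rho> + 2))"
    using near K(1) by (intro mult_left_mono) (auto simp: norm_minus_commute)
  also have "\<dots> \<le> 1/2" using \<epsilon>(3) by (simp add: \<rho>_def)
  finally have "norm (w - P w) < 1"
    using upper norm_triangle_ineq2[of "w - P w" "move \<xi> w - P (move \<xi> w)"] by linarith
  then show False using m(1) nk by simp
qed

end

text \<open>Elements following \<open>\<beta>\<close> in another way have small deviation and therefore none, so both choices
  span the same subspace.\<close>

lemma unmove_complement_unique:
  assumes G: "G \<in> close_groups" and \<xi>: "follows G \<xi>" and \<zeta>: "follows G \<zeta>"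
  shows "unmove \<xi> v - P (unmove \<xi> v) = unmove \<zeta> v - P (unmove \<zeta> v)"
proof -
  let ?f = "\<lambda>v. unmove \<xi> (move \<zeta> v) - P (unmove \<xi> (move \<zeta> v))"
  have lin: "linear ?f"
    by (rule linearI) (simp_all add: linear_add[OF linear_unmove[OF \<xi>]] linear_cmul[OF linear_unmove[OF \<xi>]]
      linear_add[OF linear_move] linear_cmul[OF linear_move] projectionD[OF P] algebra_simps)
  have basis: "?f x = 0" if x: "x \<in> \<beta>" for x
  proof -
    have "unmove \<xi> (\<zeta> x) - x = unmove \<xi> (\<zeta> x - \<xi> x)"
      using unmove_basis[OF \<xi> x] by (simp add: linear_diff[OF linear_unmove[OF \<xi>]])
    also have "norm \<dots> \<le> 2 * norm (\<zeta> x - \<xi> x)" by (rule unmove_bound[OF \<xi>])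
    also have "\<dots> \<le> 2 * (2 * \<epsilon>)"
      using \<xi> \<zeta> x norm_triangle_ineq4[of "\<zeta> x - x" "\<xi> x - x"] by (force simp: follows_def)
    finally have *: "norm (unmove \<xi> (\<zeta> x) - x) \<le> 4 * \<epsilon>" by simp
    have "P x = x" by (intro P_fixes span_base x)
    then have "unmove \<xi> (\<zeta> x) - P (unmove \<xi> (\<zeta> x)) = (unmove \<xi> (\<zeta> x) - x) - P (unmove \<xi> (\<zeta> x) - x)"
      by (simp add: projectionD[OF P])
    also have "norm \<dots> \<le> K * norm (unmove \<xi> (\<zeta> x) - x)" by (rule K)
    also have "\<dots> \<le> K * (4 * \<epsilon>)" using * K(1) by (intro mult_left_mono) auto
    also have "\<dots> < 1" using \<epsilon>(4) by (simp add: mult_ac)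
    finally have "P (unmove \<xi> (\<zeta> x)) = unmove \<xi> (\<zeta> x)"
      using \<zeta> x by (intro unmove_snaps[OF \<xi> G]) (auto simp: follows_def)
    then show ?thesis using x by (simp add: move_basis)
  qed
  have f: "?f w = w - P w" for w
  proof -
    have "?f (P w) = 0"
      using lin basis P_in_span by (rule linear_eq_0_on_span)
    moreover have "?f (w - P w) = w - P w"
      by (simp add: move_kernel unmove_kernel[OF \<xi>] projectionD[OF P])
    moreover have "?f w = ?f (P w) + ?f (w - P w)" using linear_add[OF lin, of "P w" "w - P w"] by simp
    ultimately show ?thesis by simp
  qed
  show ?thesis using f[of "unmove \<zeta> v"] by (simp add: move_unmove[OF \<zeta>])
qed

text \<open>The projection to the kernel of \<open>P\<close> along the subspace spanned by the elements of \<open>G\<close> that follow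
  \<open>\<beta>\<close>.\<close>

definition deviation :: "'a closed_subgroup \<Rightarrow> 'a \<Rightarrow> 'a" where
  "deviation G v = (let \<xi> = SOME \<xi>. follows G \<xi> in unmove \<xi> v - P (unmove \<xi> v))"

lemma follows_exists:
  assumes "G \<in> close_groups"
  obtains \<xi> where "follows G \<xi>"
proof -
  have "\<forall>x\<in>\<beta>. \<exists>x'. x' \<in> elts G \<and> norm (x' - x) < \<epsilon>" using assms by (auto simp: close_groups_def)
  from bchoice[OF this] obtain \<xi> where "\<forall>x\<in>\<beta>. \<xi> x \<in> elts G \<and> norm (\<xi> x - x) < \<epsilon>" by blast
  then have "follows G \<xi>" by (simp only: follows_def)
  then show ?thesis by (rule that)
qed

lemma deviation_eq:
  assumes "G \<in> close_groups" "follows G \<xi>"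
  shows "deviation G v = unmove \<xi> v - P (unmove \<xi> v)"
  unfolding deviation_def Let_def
  by (rule unmove_complement_unique[OF assms(1) someI[where P = "follows G", OF assms(2)] assms(2)])

text \<open>Nearby groups contain elements close to those chosen for \<open>G\<close>, and by uniqueness
  the deviation may be computed from these.\<close>

lemma tendsto_deviation:
  assumes g: "(g \<longlongrightarrow> G) F" and N: "\<forall>\<^sub>F z in F. g z \<in> close_groups" "G \<in> close_groups"
  shows "((\<lambda>z. deviation (g z) v) \<longlongrightarrow> deviation G v) F"
proof (rule tendstoI)
  fix e :: real assume e: "e > 0"
  obtain \<xi> where \<xi>: "follows G \<xi>" using follows_exists[OF N(2)] .
  \<comment> \<open>staying within \<open>d0\<close> of \<open>\<xi>\<close> keeps the tolerance \<open>\<epsilon>\<close>; the 1 covers an empty \<open>\<beta>\<close>\<close>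
  define d0 where "d0 = Min (insert 1 ((\<lambda>x. \<epsilon> - norm (\<xi> x - x)) ` \<beta>))"
  have d0: "d0 > 0" "\<And>x. x \<in> \<beta> \<Longrightarrow> d0 \<le> \<epsilon> - norm (\<xi> x - x)"
  proof -
    have "\<forall>y\<in>insert 1 ((\<lambda>x. \<epsilon> - norm (\<xi> x - x)) ` \<beta>). y > 0" using \<xi> by (simp add: follows_def)
    then show "d0 > 0" unfolding d0_def by (subst Min_gr_iff) (use fin in simp_all)
    show "d0 \<le> \<epsilon> - norm (\<xi> x - x)" if "x \<in> \<beta>" for x
      unfolding d0_def using fin that by (intro Min_le) simp_all
  qed
  define d where "d = min d0 (e / (K * (4 * C) * (norm v + 1)))"
  have pos: "K * (4 * C) * (norm v + 1) > 0" using K(1) C(1) by (intro mult_pos_pos add_nonneg_pos) auto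
  then have d: "d > 0" "d \<le> d0" "d \<le> e / (K * (4 * C) * (norm v + 1))" using e d0(1) by (auto simp: d_def)
  define R where "R = (\<Sum>x\<in>\<beta>. norm (\<xi> x))"
  have R: "norm (\<xi> x) \<le> R" if "x \<in> \<beta>" for x
    unfolding R_def using that fin by (intro member_le_sum) auto
  show "\<forall>\<^sub>F z in F. dist (deviation (g z) v) (deviation G v) < e"
    using N(1) tendsto_closed_subgroupD(2)[OF g d(1), of R]
  proof eventually_elim
    case (elim z)
    have "\<forall>x\<in>\<beta>. \<exists>y. y \<in> elts (g z) \<and> norm (\<xi> x - y) < d"
    proof
      fix x assume x: "x \<in> \<beta>"
      then have "\<xi> x \<in> elts G" using \<xi> by (simp add: follows_def)
      then show "\<exists>y. y \<in> elts (g z) \<and> norm (\<xi> x - y) < d"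
        using elim(2) R[OF x] unfolding nearby_def by blast
    qed
    from bchoice[OF this] obtain \<zeta> where \<zeta>: "\<And>x. x \<in> \<beta> \<Longrightarrow> \<zeta> x \<in> elts (g z) \<and> norm (\<xi> x - \<zeta> x) < d"
      by blast
    have fol: "follows (g z) \<zeta>" unfolding follows_def
    proof
      fix x assume x: "x \<in> \<beta>"
      have "norm (\<zeta> x - x) \<le> norm (\<xi> x - x) + norm (\<xi> x - \<zeta> x)"
        using norm_triangle_ineq4[of "\<xi> x - x" "\<xi> x - \<zeta> x"] by simp
      then show "\<zeta> x \<in> elts (g z) \<and> norm (\<zeta> x - x) < \<epsilon>" using \<zeta>[OF x] d0(2)[OF x] d(2) by simp
    qed
    define D where "D = unmove \<zeta> v - unmove \<xi> v"
    define w where "w = unmove \<xi> v"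
    have v: "v = move \<xi> w" by (simp only: w_def move_unmove[OF \<xi>])
    have "unmove \<zeta> (move \<xi> w - move \<zeta> w) = unmove \<zeta> (move \<xi> w) - unmove \<zeta> (move \<zeta> w)"
      by (rule linear_diff[OF linear_unmove[OF fol]])
    then have "D = unmove \<zeta> (move \<xi> w - move \<zeta> w)"
      by (simp only: D_def unmove_move[OF fol] v[symmetric] w_def[symmetric])
    then have "norm D \<le> 2 * norm (move \<xi> w - move \<zeta> w)" by (simp only: unmove_bound[OF fol])
    also have "norm (move \<xi> w - move \<zeta> w) \<le> C * d * norm w"
    proof (rule move_diff)
      show "norm (\<xi> x - \<zeta> x) \<le> d" if "x \<in> \<beta>" for x using \<zeta>[OF that] by simp
    qed (use d(1) in simp)
    also have "C * d * norm w \<le> C * d * (2 * norm v)"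
      unfolding w_def using C(1) d(1) by (intro mult_left_mono unmove_bound[OF \<xi>]) simp
    finally have D: "norm D \<le> 4 * C * d * norm v" by simp
    have "deviation (g z) v - deviation G v = D - P D"
      by (simp add: D_def deviation_eq[OF elim(1) fol] deviation_eq[OF N(2) \<xi>] projectionD[OF P])
    also have "norm \<dots> \<le> K * norm D" by (rule K)
    also have "\<dots> \<le> K * (4 * C * d * norm v)" using K(1) D by (intro mult_left_mono) auto
    also have "\<dots> = K * (4 * C) * norm v * d" by (simp only: mult_ac)
    also have "\<dots> < K * (4 * C) * (norm v + 1) * d"
      using K(1) C(1) d(1) by (intro mult_strict_right_mono mult_strict_left_mono) auto
    also have "\<dots> \<le> e" using d(3) pos by (simp only: pos_le_divide_eq mult.commute)
    finally show ?case by (simp add: dist_norm)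
  qed
qed

definition straighten :: "real \<Rightarrow> 'a closed_subgroup \<Rightarrow> 'a \<Rightarrow> 'a" where
  "straighten u G v = (1 - u) *\<^sub>R v + u *\<^sub>R (P v + deviation G v)"

context
  fixes G assumes G: "G \<in> close_groups"
begin

lemma P_deviation: "P (deviation G v) = 0"
  by (simp add: deviation_def Let_def projectionD[OF P])

lemma linear_straighten: "linear (straighten u G)"
proof -
  obtain \<xi> where \<xi>: "follows G \<xi>" using follows_exists[OF G] .
  show ?thesis
    by (rule linearI) (simp_all add: straighten_def deviation_eq[OF G \<xi>] linear_add[OF linear_unmove[OF \<xi>]]
      linear_cmul[OF linear_unmove[OF \<xi>]] projectionD[OF P] algebra_simps)
qed

lemma inj_straighten: "inj (straighten u G)"
proof (subst linear_injective_0[OF linear_straighten], intro allI impI)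
  obtain \<xi> where \<xi>: "follows G \<xi>" using follows_exists[OF G] .
  fix v assume v: "straighten u G v = 0"
  have "P (straighten u G v) = P v" by (simp add: straighten_def projectionD[OF P] P_deviation algebra_simps)
  then have Pv: "P v = 0" using v by (simp add: projectionD[OF P])
  then have "deviation G v = v" by (simp add: deviation_eq[OF G \<xi>] unmove_kernel[OF \<xi>])
  then show "v = 0" using v Pv by (simp add: straighten_def algebra_simps)
qed

lemma straighten_0: "straighten 0 G = (\<lambda>v. v)"
  by (simp add: straighten_def fun_eq_iff)

lemma separated_straightened: "separated_off_range P 1 (lin_act (straighten 1 G) G)"
  unfolding separated_off_range_def elts_lin_act[OF linear_straighten inj_straighten]
proof safe
  obtain \<xi> where \<xi>: "follows G \<xi>" using follows_exists[OF G] .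
  fix y assume y: "y \<in> elts G" "norm (straighten 1 G y - P (straighten 1 G y)) < 1"
  have P: "P (straighten 1 G y) = P y" by (simp add: straighten_def projectionD[OF P] P_deviation)
  then have deviation: "straighten 1 G y - P (straighten 1 G y) = deviation G y" by (simp add: straighten_def)
  then have "deviation G y = 0" using y unmove_snaps[OF \<xi> G y(1)] by (simp add: deviation_eq[OF G \<xi>])
  then show "P (straighten 1 G y) = straighten 1 G y" using deviation by simp
qed

text \<open>The straightened group contains the images of the elements following \<open>\<beta>\<close>. They lie in the range
  of \<open>P\<close> and span it, and their size is bounded independently of the group.\<close>

lemma dense_straightened:
  "dense_in_range P (\<Sum>x\<in>\<beta>. (1 + K) * (norm x + \<epsilon>)) (lin_act (straighten 1 G) G)"
  unfolding dense_in_range_def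
proof
  fix v
  obtain \<xi> where \<xi>: "follows G \<xi>" using follows_exists[OF G] .
  let ?s = "straighten 1 G" and ?H = "lin_act (straighten 1 G) G"
  let ?B = "(\<lambda>x. ?s (\<xi> x)) ` \<beta>"
  have s_move: "?s (move \<xi> w) = P (move \<xi> w) + (w - P w)" for w
    by (simp add: straighten_def deviation_eq[OF G \<xi>] unmove_move[OF \<xi>])
  have s_basis: "?s (\<xi> x) = P (\<xi> x)" if "x \<in> \<beta>" for x
    using s_move[of x] that by (simp add: move_basis P_fixes span_base)
  have B: "?B \<subseteq> elts ?H"
    using \<xi> by (auto simp: elts_lin_act[OF linear_straighten inj_straighten] follows_def)
  have B_range: "span ?B \<subseteq> range P"
    using s_basis projectionD(1)[OF P]
    by (intro span_minimal linear_subspace_image subspace_UNIV) auto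
  have surj: "surj ?s" "surj (move \<xi>)"
    by (intro linear_inj_imp_surj linear_straighten inj_straighten linear_move inj_move[OF \<xi>])+
  obtain u where u: "P v = ?s u" using surjD[OF surj(1), of "P v"] by (rule exE)
  obtain w where "u = move \<xi> w" using surjD[OF surj(2), of u] by (rule exE)
  then have w: "P v = ?s (move \<xi> w)" using u by simp
  then have "P (P v) = P (?s (move \<xi> w))" by simp
  then have "P v = P (move \<xi> w)" by (simp add: s_move projectionD[OF P])
  then have "w = P w" using w by (simp add: s_move)
  then have w_span: "w \<in> span \<beta>" using P_in_span[of w] by simp
  have lin: "linear (\<lambda>w. ?s (move \<xi> w))"
    using linear_compose[OF linear_move linear_straighten] by (simp add: o_def)
  have "?B = (\<lambda>w. ?s (move \<xi> w)) ` \<beta>" by (auto simp: move_basis)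
  then have "P v \<in> span ?B" using w w_span by (simp add: linear_span_image[OF lin])
  then obtain y where y: "y \<in> elts ?H" "y \<in> span ?B" "norm (P v - y) \<le> (\<Sum>b\<in>?B. norm b)"
    using subgroup_dense_in_span[OF elts_subgroup _ B] fin by blast
  have "(\<Sum>b\<in>?B. norm b) \<le> (\<Sum>x\<in>\<beta>. norm (?s (\<xi> x)))"
    using fin by (intro sum_image_le[where g = norm, unfolded o_def]) auto
  also have "\<dots> \<le> (\<Sum>x\<in>\<beta>. (1 + K) * (norm x + \<epsilon>))"
  proof (rule sum_mono)
    fix x assume x: "x \<in> \<beta>"
    have "norm (P (\<xi> x)) \<le> norm (\<xi> x) + norm (\<xi> x - P (\<xi> x))"
      using norm_triangle_ineq4[of "\<xi> x" "\<xi> x - P (\<xi> x)"] by simp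
    also have "\<dots> \<le> (1 + K) * norm (\<xi> x)" using K(2)[of "\<xi> x"] by (simp add: algebra_simps)
    also have "\<dots> \<le> (1 + K) * (norm x + \<epsilon>)"
      using \<xi> x K(1) norm_triangle_ineq2[of "\<xi> x" x] by (intro mult_left_mono) (auto simp: follows_def)
    finally show "norm (?s (\<xi> x)) \<le> (1 + K) * (norm x + \<epsilon>)" by (simp add: s_basis x)
  qed
  finally have "norm (P v - y) \<le> (\<Sum>x\<in>\<beta>. (1 + K) * (norm x + \<epsilon>))"
    using y(3) by (rule order_trans[rotated])
  moreover have "P y = y" by (rule projection_fixes_range[OF P subsetD[OF B_range y(2)]])
  ultimately show "\<exists>y\<in>elts ?H. P y = y \<and> norm (P v - y) \<le> (\<Sum>x\<in>\<beta>. (1 + K) * (norm x + \<epsilon>))"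
    using y(1) by blast
qed

end

lemma tendsto_straighten:
  assumes g: "(g \<longlongrightarrow> G) F" and N: "\<forall>\<^sub>F z in F. g z \<in> close_groups" "G \<in> close_groups" and u: "(u \<longlongrightarrow> u0) F"
  shows "((\<lambda>z. lin_act (straighten (u z) (g z)) (g z)) \<longlongrightarrow> lin_act (straighten u0 G) G) F"
proof (rule tendsto_lin_act[OF _ linear_straighten[OF N(2)] inj_straighten[OF N(2)] _ g])
  show "\<forall>\<^sub>F z in F. linear (straighten (u z) (g z))" using N(1) by eventually_elim (rule linear_straighten)
  show "((\<lambda>z. straighten (u z) (g z) v) \<longlongrightarrow> straighten u0 G v) F" for v
    unfolding straighten_def by (intro tendsto_intros u tendsto_deviation[OF g N])
qed

end

section \<open>Contracting a neighbourhood to a linear subspace\<close>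

context straightening
begin

definition straightening_track :: "'a closed_subgroup \<Rightarrow> real \<Rightarrow> 'a closed_subgroup" where
  "straightening_track G u = lin_act (straighten u G) G"

definition shrinking_track :: "'a closed_subgroup \<Rightarrow> real \<Rightarrow> 'a closed_subgroup" where
  "shrinking_track G s = shrink P (1 - s) (straightening_track G 1)"

definition spreading_track :: "'a closed_subgroup \<Rightarrow> real \<Rightarrow> 'a closed_subgroup" where
  "spreading_track G s = spread P (1 - s) (shrinking_track G 1)"

text \<open>The track of \<open>G\<close> under the contraction of the close groups to the range of \<open>P\<close>.\<close>

definition contraction :: "'a closed_subgroup \<Rightarrow> real \<Rightarrow> 'a closed_subgroup" where
  "contraction G = straightening_track G +++ (shrinking_track G +++ spreading_track G)"

lemma straightening_track_0: "G \<in> close_groups \<Longrightarrow> straightening_track G 0 = G"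
  by (simp add: straightening_track_def straighten_0 lin_act_def closed_hull_elts)

lemma shrinking_track_0: "shrinking_track G 0 = straightening_track G 1"
  by (simp add: shrinking_track_def P)

lemma spreading_track_0: "spreading_track G 0 = shrinking_track G 1"
  by (simp add: spreading_track_def P)

lemma shrinking_track_1: "shrinking_track G 1 = shrink P 0 (straightening_track G 1)"
  by (simp add: shrinking_track_def)

lemma spreading_track_1: "spreading_track G 1 = closed_hull (range P)"
  by (simp add: spreading_track_def shrinking_track_1 spread_0_eq_range[OF P] range_subset_shrink_0[OF P])

lemma contraction_ends:
  assumes "G \<in> close_groups"
  shows "contraction G 0 = G" "contraction G 1 = closed_hull (range P)"
  using assms by (simp_all add: contraction_def joinpaths_def straightening_track_0 spreading_track_1)

lemma dense_straightening_track: "G \<in> close_groups \<Longrightarrow>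
    dense_in_range P (\<Sum>x\<in>\<beta>. (1 + K) * (norm x + \<epsilon>)) (straightening_track G 1)"
  unfolding straightening_track_def by (rule dense_straightened)

lemma separated_shrinking_track: "G \<in> close_groups \<Longrightarrow> separated_off_range P 1 (shrinking_track G 1)"
  unfolding shrinking_track_1 straightening_track_def by (intro separated_shrink_0 P separated_straightened)

lemma tendsto_straightening_track:
  assumes "(g \<longlongrightarrow> G) F" "\<forall>\<^sub>F z in F. g z \<in> close_groups" "G \<in> close_groups" "(u \<longlongrightarrow> u0) F"
  shows "((\<lambda>z. straightening_track (g z) (u z)) \<longlongrightarrow> straightening_track G u0) F"
  unfolding straightening_track_def by (rule tendsto_straighten[OF assms])

lemma tendsto_shrinking_track:
  assumes "(g \<longlongrightarrow> G) F" "\<forall>\<^sub>F z in F. g z \<in> close_groups" "G \<in> close_groups" "(u \<longlongrightarrow> u0) F"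
  shows "((\<lambda>z. shrinking_track (g z) (u z)) \<longlongrightarrow> shrinking_track G u0) F"
  unfolding shrinking_track_def
  by (rule tendsto_shrink[OF P tendsto_straightening_track[OF assms(1,2,3) tendsto_const]
      tendsto_diff[OF tendsto_const assms(4)] eventually_mono[OF assms(2) dense_straightening_track] dense_straightening_track[OF assms(3)]])

lemma tendsto_spreading_track:
  assumes "(g \<longlongrightarrow> G) F" "\<forall>\<^sub>F z in F. g z \<in> close_groups" "G \<in> close_groups" "(u \<longlongrightarrow> u0) F"
  shows "((\<lambda>z. spreading_track (g z) (u z)) \<longlongrightarrow> spreading_track G u0) F"
  unfolding spreading_track_def
  by (rule tendsto_spread[OF P tendsto_shrinking_track[OF assms(1,2,3) tendsto_const]
      tendsto_diff[OF tendsto_const assms(4)] zero_less_one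
      eventually_mono[OF assms(2) separated_shrinking_track] separated_shrinking_track[OF assms(3)]])

context
  fixes p :: "real \<Rightarrow> 'a closed_subgroup"
  assumes p: "path p" "\<And>t. t \<in> {0..1} \<Longrightarrow> p t \<in> close_groups"
begin

lemma continuous_tracks:
  "continuous_on ({0..1} \<times> {0..1}) (\<lambda>z. straightening_track (p (fst z)) (snd z))"
  "continuous_on ({0..1} \<times> {0..1}) (\<lambda>z. shrinking_track (p (fst z)) (snd z))"
  "continuous_on ({0..1} \<times> {0..1}) (\<lambda>z. spreading_track (p (fst z)) (snd z))"
proof -
  have ev: "\<forall>\<^sub>F y in at z within {0..1} \<times> {0..1}. p (fst y) \<in> close_groups" for z :: "real \<times> real"
    unfolding eventually_at_filter
    by (intro always_eventually allI impI p(2)) (simp add: mem_Times_iff)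
  have snd: "(snd \<longlongrightarrow> snd z) (at z within {0..1} \<times> {0..1})" for z :: "real \<times> real"
    by (intro tendsto_snd tendsto_ident_at)
  have fst_in: "p (fst z) \<in> close_groups" if "z \<in> {0..1} \<times> {0..1}" for z :: "real \<times> real"
    using that by (intro p(2)) auto
  show "continuous_on ({0..1} \<times> {0..1}) (\<lambda>z. straightening_track (p (fst z)) (snd z))"
    unfolding continuous_on_def by (intro ballI tendsto_straightening_track[OF tendsto_fst_of_path[OF p(1)] ev fst_in snd])
  show "continuous_on ({0..1} \<times> {0..1}) (\<lambda>z. shrinking_track (p (fst z)) (snd z))"
    unfolding continuous_on_def by (intro ballI tendsto_shrinking_track[OF tendsto_fst_of_path[OF p(1)] ev fst_in snd])
  show "continuous_on ({0..1} \<times> {0..1}) (\<lambda>z. spreading_track (p (fst z)) (snd z))"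
    unfolding continuous_on_def by (intro ballI tendsto_spreading_track[OF tendsto_fst_of_path[OF p(1)] ev fst_in snd])
qed

lemma continuous_contraction:
  "continuous_on ({0..1} \<times> {0..1}) (\<lambda>z. contraction (p (fst z)) (snd z))"
  unfolding contraction_def
  using continuous_tracks
  by (intro continuous_on_homotopic_join_lemma[where p = "\<lambda>t. straightening_track (p t)" and q = "\<lambda>t. shrinking_track (p t) +++ spreading_track (p t)"]
      continuous_on_homotopic_join_lemma[where p = "\<lambda>t. shrinking_track (p t)" and q = "\<lambda>t. spreading_track (p t)"])
    (simp_all add: pathstart_join, simp_all add: pathstart_def pathfinish_def shrinking_track_0 spreading_track_0)

end

lemma path_tracks:
  assumes "G \<in> close_groups"
  shows "path (straightening_track G)" "path (shrinking_track G)" "path (spreading_track G)"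
proof -
  have slice: "path (\<lambda>s. h (0, s))" if "continuous_on ({0..1} \<times> {0..1}) h" for h :: "real \<times> real \<Rightarrow> 'a closed_subgroup"
    unfolding path_def by (rule continuous_on_compose2[OF that]) (auto intro!: continuous_intros)
  note cont = continuous_tracks[OF path_const, of G, OF assms]
  show "path (straightening_track G)" "path (shrinking_track G)" "path (spreading_track G)"
    using slice[OF cont(1)] slice[OF cont(2)] slice[OF cont(3)] by simp_all
qed

lemma cocompact_tracks:
  assumes G: "G \<in> close_groups" "cocompact (elts G)"
  shows "cocompact (elts (straightening_track G u))" "cocompact (elts (shrinking_track G u))"
proof -
  show one: "cocompact (elts (straightening_track G u))" for u
    unfolding straightening_track_def by (intro cocompact_lin_act G(2) linear_straighten[OF G(1)] inj_straighten[OF G(1)])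
  show "cocompact (elts (shrinking_track G u))"
  proof (cases "u = 1")
    case True
    then show ?thesis
      unfolding True shrinking_track_1 by (intro cocompact_mono[OF one elts_subset_shrink_0[OF P]])
  next
    case False
    then have "1 - u \<noteq> 0" by simp
    then show ?thesis
      unfolding shrinking_track_def shrink_nonzero[OF P \<open>1 - u \<noteq> 0\<close>]
      by (intro cocompact_lin_act one linear_shrink_map[OF P] inj_shrink_map[OF P])
  qed
qed

text \<open>Straightening and shrinking keep the group cocompact. What then remains is the range of \<open>P\<close> plus
  a lattice, and spreading it is the reverse of letting a lattice come in from infinity.\<close>

lemma tame_contraction_cocompact:
  assumes proj: "P = proj (range P)" and G: "G \<in> close_groups" "cocompact (elts G)"
  shows "tame (contraction G)"
proof -
  let ?D = "shrinking_track G 1"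
  have range: "P v \<in> elts ?D" for v
    unfolding shrinking_track_1 by (rule range_subset_shrink_0[OF P])
  obtain S where S: "complement_basis P S" "?D = grid P S (closed_hull (range P))"
    using grid_of_separated[OF P zero_less_one separated_shrinking_track[OF G(1)] range cocompact_tracks(2)[OF G]] .
  have W: "subspace (range P)" by (intro linear_subspace_image projectionD(1)[OF P] subspace_UNIV)
  have "tame (\<lambda>b. spread P b ?D)"
    using tame_spread_lattice[OF W, of S] S proj[symmetric] by simp
  then have "tame (reversepath (\<lambda>b. spread P b ?D))" by (rule tame_reversepath)
  moreover have "reversepath (\<lambda>b. spread P b ?D) = spreading_track G"
    by (simp add: reversepath_def spreading_track_def fun_eq_iff)
  ultimately have "tame (spreading_track G)" by simp
  moreover have "tame (straightening_track G)" "tame (shrinking_track G)"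
    using path_tracks[OF G(1)] cocompact_tracks[OF G] by (auto intro: tame_cocompact)
  ultimately show ?thesis unfolding contraction_def
    by (intro tame_join) (simp_all add: pathstart_def pathfinish_def shrinking_track_0 spreading_track_0 joinpaths_def)
qed

text \<open>A short initial piece \<open>q\<close> of \<open>fill G\<close> stays among the close groups and ends in a cocompact one. It is
  tame since both \<open>fill G\<close> and the rest of it are. In the square of the tracks of the points of \<open>q\<close> the
  track of \<open>G\<close> is then the fourth side.\<close>

lemma tame_contraction:
  assumes proj: "P = proj (range P)" and U: "open U" "U \<subseteq> close_groups" and G: "G \<in> U"
  shows "tame (contraction G)"
proof -
  have cont: "continuous_on {0..1} (fill G)" using path_fill by (simp add: path_def)
  then have "(fill G \<longlongrightarrow> fill G 0) (at 0 within {0..1})" unfolding continuous_on_def by (rule bspec) simp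
  then have "\<forall>\<^sub>F b in at 0 within {0..1}. fill G b \<in> U" using U(1) G by (intro topological_tendstoD) auto
  then obtain d where d: "d > 0" "\<And>b. b \<in> {0..1} \<Longrightarrow> b \<noteq> 0 \<Longrightarrow> \<bar>b\<bar> < d \<Longrightarrow> fill G b \<in> U"
    unfolding eventually_at by (auto simp: dist_real_def)
  define b where "b = min 1 (d / 2)"
  have b: "b > 0" "b \<le> 1" "b < d" using d(1) by (auto simp: b_def)
  define q where "q = portion 0 b (fill G)"
  have q: "path q" "q 0 = G" "q 1 = fill G b" 
    using b by (auto simp: q_def path_portion path_fill) (simp_all add: portion_def linepath_def)
  have q_U: "q t \<in> close_groups" if "t \<in> {0..1}" for t
  proof -
    have "linepath 0 b t \<in> {0..1}" "\<bar>linepath 0 b t\<bar> \<le> b"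
      using that b by (auto simp: linepath_def mult_le_one mult_left_le_one_le)
    then have "fill G (linepath 0 b t) \<in> U"
      using d(2)[of "linepath 0 b t"] G b(3) by (cases "linepath 0 b t = 0") auto
    then show ?thesis using U(2) by (auto simp: q_def portion_def)
  qed
  have tame_q: "tame q"
  proof (rule tame_cancel)
    have "portion 0 1 (fill G) = fill G" by (simp add: portion_def linepath_def)
    moreover have "homotopic_paths UNIV (portion 0 b (fill G) +++ portion b 1 (fill G)) (portion 0 1 (fill G))"
      using b by (intro portion_join path_fill) auto
    ultimately show "tame (q +++ portion b 1 (fill G))"
      unfolding q_def by (intro tame_homotopic[OF tame_fill]) (simp only: homotopic_paths_sym_eq)
    show "tame (portion b 1 (fill G))"
    proof (rule tame_cocompact)
      show "path (portion b 1 (fill G))" using b by (intro path_portion path_fill) auto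
      fix t :: real assume t: "t \<in> {0..1}"
      then have "linepath b 1 t \<in> closed_segment b 1" unfolding linepath_image_01[symmetric] by (rule imageI)
      then have "linepath b 1 t \<noteq> 0" using b by (auto simp: closed_segment_eq_real_ivl)
      then show "cocompact (elts (portion b 1 (fill G) t))" by (simp add: portion_def cocompact_fill)
    qed
  qed (use q b in \<open>auto simp: q_def path_portion path_fill\<close>)
  let ?H = "\<lambda>z. contraction (q (snd z)) (fst z)"
  have "continuous_on ({0..1} \<times> {0..1}) (\<lambda>z::real\<times>real. (\<lambda>z. contraction (q (fst z)) (snd z)) (snd z, fst z))"
    by (rule continuous_on_compose2[OF continuous_contraction[OF q(1) q_U]]) (auto intro!: continuous_intros)
  then have H: "continuous_on ({0..1} \<times> {0..1}) ?H" by (simp only: fst_conv snd_conv)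
  have 1: "?H (0, t) = q t" "?H (1, t) = closed_hull (range P)" if "t \<in> {0..1}" for t
    using contraction_ends[OF q_U[OF that]] by auto
  have "tame (\<lambda>t. ?H (0, t))"
    by (rule tame_homotopic[OF tame_q], rule homotopic_paths_eq) (use q(1) 1 in auto)
  moreover have "tame (\<lambda>t. ?H (1, t))"
    by (rule tame_homotopic[OF tame_const], rule homotopic_paths_eq) (use 1 path_const in auto)
  moreover have "tame (\<lambda>t. ?H (t, 1))"
    using tame_contraction_cocompact[OF proj q_U[of 1]] b q(3) cocompact_fill[of b G] by simp
  ultimately have "tame (\<lambda>t. ?H (t, 0))" by (intro tame_square[OF H])
  then show ?thesis using q(2) by simp
qed

lemma tame_close:
  assumes proj: "P = proj (range P)" and U: "open U" "U \<subseteq> close_groups" and p: "path p" "path_image p \<subseteq> U"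
  shows "tame p"
proof -
  have p_U: "p t \<in> U" if "t \<in> {0..1}" for t using p(2) that by (auto simp: path_image_def)
  then have p_N: "p t \<in> close_groups" if "t \<in> {0..1}" for t using U(2) that by blast
  let ?H = "\<lambda>z. contraction (p (fst z)) (snd z)"
  have ends: "?H (t, 0) = p t" "?H (t, 1) = closed_hull (range P)" if "t \<in> {0..1}" for t
    using contraction_ends[OF p_N[OF that]] by auto
  have top: "tame (\<lambda>t. ?H (t, 1))"
    by (rule tame_homotopic[OF tame_const], rule homotopic_paths_eq) (use ends path_const in auto)
  have sides: "tame (\<lambda>t. ?H (0, t))" "tame (\<lambda>t. ?H (1, t))"
    using tame_contraction[OF proj U] p_U by auto
  have bot: "tame (\<lambda>t. ?H (t, 0))"
    by (rule tame_square[OF continuous_contraction[OF p(1) p_N] sides(1) top sides(2)])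
  show ?thesis
    by (rule tame_homotopic[OF bot], rule homotopic_paths_eq) (use bot tame_imp_path ends in auto)
qed

end

section \<open>Simple connectedness\<close>

lemma locally_tame:
  fixes G :: "'a::euclidean_space closed_subgroup"
  shows "\<exists>U. open U \<and> G \<in> U \<and> (\<forall>p. path p \<and> path_image p \<subseteq> U \<longrightarrow> tame p)"
proof -
  define W where "W = span (elts G)"
  define P where "P = proj W"
  have W: "subspace W" by (simp add: W_def)
  have proj_P: "projection P" and range_P: "range P = W" using proj[OF W] by (auto simp: P_def)
  obtain \<beta> where \<beta>: "\<beta> \<subseteq> elts G" "independent \<beta>" "elts G \<subseteq> span \<beta>"
    using maximal_independent_subset[of "elts G"] by blast
  have fin: "finite \<beta>" using \<beta>(2) by (rule finiteI_independent)
  have "span \<beta> = W"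
    using span_mono[OF \<beta>(1)] span_mono[OF \<beta>(3)] unfolding W_def span_span by (rule subset_antisym)
  then have span_\<beta>: "span \<beta> = range P" by (simp add: range_P)
  obtain C where C: "C > 0" "\<And>v. (\<Sum>x\<in>\<beta>. \<bar>representation \<beta> (P v) x\<bar>) \<le> C * norm v"
    using representation_bound[OF proj_P fin \<beta>(2) span_\<beta>] by blast
  obtain K where K: "K > 0" "\<And>v. norm (v - P v) \<le> K * norm v" using complement_bound[OF proj_P] by blast
  define r where "r = (\<Sum>x\<in>\<beta>. norm x) + 2"
  have "(\<Sum>x\<in>\<beta>. norm x) \<ge> 0" by (intro sum_nonneg) simp
  then have r: "r > 0" by (simp add: r_def)
  \<comment> \<open>small enough for the three bounds that the locale imposes\<close>
  define \<epsilon> where "\<epsilon> = min (1 / (2 * C)) (min (1 / (2 * (K * (C * r)))) (1 / (8 * K)))"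
  have \<epsilon>: "\<epsilon> > 0" "\<epsilon> \<le> 1 / (2 * C)" "\<epsilon> \<le> 1 / (2 * (K * (C * r)))" "\<epsilon> \<le> 1 / (8 * K)"
    using C(1) K(1) r by (auto simp: \<epsilon>_def)
  have bounds: "C * \<epsilon> \<le> 1/2" "K * (C * \<epsilon> * r) \<le> 1/2" "4 * K * \<epsilon> < 1"
  proof -
    have scale: "X * \<epsilon> \<le> 1 / n" if "X > 0" "n > 0" "\<epsilon> \<le> 1 / (n * X)" for X n :: real
    proof -
      have "X * \<epsilon> \<le> X * (1 / (n * X))" using that by (intro mult_left_mono) auto
      then show ?thesis using that by simp
    qed
    show "C * \<epsilon> \<le> 1/2" using scale[of C 2] C(1) \<epsilon>(2) by simp
    have "K * (C * r) * \<epsilon> \<le> 1/2" using scale[of "K * (C * r)" 2] C(1) K(1) r \<epsilon>(3) by simp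
    then show "K * (C * \<epsilon> * r) \<le> 1/2" by (simp add: mult_ac)
    have "K * \<epsilon> \<le> 1/8" using scale[of K 8] K(1) \<epsilon>(4) by simp
    then show "4 * K * \<epsilon> < 1" by simp
  qed
  interpret straightening P \<beta> C K \<epsilon>
    by (rule straightening.intro[OF proj_P fin \<beta>(2) span_\<beta> C K \<epsilon>(1) bounds[unfolded r_def]])
  have id: "((\<lambda>H. H) \<longlongrightarrow> G) (nhds G)" by (rule filterlim_ident)
  have half: "1 / (2 * K) > 0" using K(1) by simp
  have G_fix: "P x = x" if "x \<in> elts G" for x
  proof (rule projection_fixes_range[OF proj_P])
    show "x \<in> range P" unfolding range_P W_def using that by (rule span_base)
  qed
  have "\<forall>\<^sub>F H in nhds G. H \<in> close_groups"
    using tendsto_closed_subgroupD(2)[OF id \<epsilon>(1), of \<rho>] tendsto_closed_subgroupD(1)[OF id half, of "2 * (\<rho> + 2)"]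
  proof eventually_elim
    case (elim H)
    have "\<exists>x'\<in>elts H. norm (x' - x) < \<epsilon>" if x: "x \<in> \<beta>" for x
    proof -
      have "norm x \<le> \<rho>" unfolding \<rho>_def using x fin by (intro member_le_sum) auto
      then obtain y where "y \<in> elts H" "norm (x - y) < \<epsilon>"
        using elim(1) \<beta>(1) x unfolding nearby_def by blast
      then show ?thesis by (intro bexI[of _ y]) (simp add: norm_minus_commute)
    qed
    moreover have "norm (y - P y) < 1/2" if y: "y \<in> elts H" "norm y \<le> 2 * (\<rho> + 2)" for y
    proof -
      obtain x where x: "x \<in> elts G" "norm (y - x) < 1 / (2 * K)" using elim(2) y unfolding nearby_def by blast
      have "norm (y - P y) = norm ((y - x) - P (y - x))" using G_fix[OF x(1)] by (simp add: projectionD[OF proj_P])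
      also have "\<dots> \<le> K * norm (y - x)" by (rule K)
      also have "\<dots> < K * (1 / (2 * K))" using x(2) K(1) by (rule mult_strict_left_mono)
      also have "\<dots> = 1/2" using K(1) by simp
      finally show ?thesis .
    qed
    ultimately show ?case by (simp add: close_groups_def)
  qed
  then obtain U where U: "open U" "G \<in> U" "\<And>H. H \<in> U \<Longrightarrow> H \<in> close_groups"
    unfolding eventually_nhds by blast
  have "P = proj (range P)" by (simp only: range_P) (rule P_def)
  then have "tame p" if "path p" "path_image p \<subseteq> U" for p
    using that U(3) by (intro tame_close[OF _ U(1)]) auto
  then show ?thesis using U by blast
qed

theorem simply_connected_closed_subgroups:
  "simply_connected (UNIV :: 'a::euclidean_space closed_subgroup set)"
  by (rule simply_connected_if_locally_tame[OF locally_tame])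

lemma closed_subgroup_euclidean0: "(G :: euclidean0 closed_subgroup) = H"
proof -
  have "elts K = UNIV" for K :: "euclidean0 closed_subgroup"
  proof -
    have "x \<in> elts K" for x
      using additive_subgroupD(1)[OF elts_subgroup[of K]] euclidean0_eq[of x 0] by simp
    then show ?thesis by (intro equalityI subsetI) simp_all
  qed
  then have "elts G = elts H" by (simp only:)
  then show ?thesis by (simp only: elts_inject)
qed

theorem theoremC:
  shows "simply_connected (UNIV :: (real ^ 'n::finite) closed_subgroup set) \<and>
         simply_connected (UNIV :: euclidean0 closed_subgroup set)"
proof
  show "simply_connected (UNIV :: (real ^ 'n) closed_subgroup set)"
    by (rule simply_connected_closed_subgroups)
  show "simply_connected (UNIV :: euclidean0 closed_subgroup set)"
    unfolding simply_connected_def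
  proof (intro allI impI)
    fix p q :: "real \<Rightarrow> euclidean0 closed_subgroup"
    have "q = p" by (rule ext) (rule closed_subgroup_euclidean0)
    moreover assume "path p \<and> pathfinish p = pathstart p \<and> path_image p \<subseteq> UNIV \<and>
      path q \<and> pathfinish q = pathstart q \<and> path_image q \<subseteq> UNIV"
    ultimately show "homotopic_loops UNIV p q" by (simp add: homotopic_loops_refl)
  qed
qed

end
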